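(* Let $s:\Omega\to\mathbb{R}$ be measurable with $s(x)\in[0,1]$ for almost all $x\in\Omega$ and $|\{x\in\Omega:s(x)=0\}|=0$, and let $\mathrm{G}_s:\Omega\to\mathbb{R}$ be a weight with $\mathrm{G}_s^{-1}\in L^1_{\mathrm{loc}}(\Omega)$ such that, if $s(\cdot)=s\in(0,1)$ is constant, then $\mathrm{G}_s(x)=2^{2s-1}\Gamma(s)/\Gamma(1-s)$ for all $x\in\Omega$. Let $w(x,y)=\mathrm{G}_s(x)y^{1-2s(x)}$ and $\tilde w(x)=\mathrm{G}_s(x)(2s(x))^2$. Assume that functions in $\mathscr{H}_{0,L}^{1,2}(\mathcal{C},w)$ satisfy a Poincaré inequality, i.e. there is $C>0$ with $\|u\|_{L^2(\mathcal{C},w)}\le C\|\nabla u\|_{L^2(\mathcal{C},w)}$ for all $u\in\mathscr{H}_{0,L}^{1,2}(\mathcal{C},w)$. Then for every $h\in L^2(\Omega,\tilde w)$ the equation $$(-\Delta)^{s(\cdot)}v=h$$ admits a unique solution $v\in\mathscr{Y}(\Omega,w)\subset L^2(\Omega,\tilde w)$.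
   Context: $\Omega\subset\mathbb{R}^N$, $N\ge1$, is a non-empty bounded open set with Lipschitz boundary. $\mathcal{C}=\Omega\times(0,\infty)$, $\partial_L\mathcal{C}=\partial\Omega\times[0,\infty)$, $\mathcal{C}_\Omega=\mathcal{C}\cup(\Omega\times\{0\})$; points are written $X=(x,y)$ with $x\in\Omega$, $y>0$. A weight is a measurable function that is positive and finite a.e. For an open set $U$ and a weight $\rho$ on $U$, $L^2(U,\rho)$ is the space of measurable $u$ with $\|u\|_{L^2(U,\rho)}=(\int_U|u|^2\rho)^{1/2}<\infty$; if $\rho^{-1}\in L^1_{\mathrm{loc}}(U)$, $W^{1,2}(U,\rho)$ is the space of $u\in L^2(U,\rho)$ with weak gradient satisfying $|\nabla u|\in L^2(U,\rho)$, normed by $(\int_U|u|^2\rho+\int_U|\nabla u|^2\rho)^{1/2}$. $C_c^\infty(\mathcal{C}_\Omega)$ is the set of $u\in C^\infty(\overline{\mathcal{C}})$ with compact support in $\mathcal{C}_\Omega$ (so the support does not meet $\partial_L\mathcal{C}$, while $u$ need not vanish on $\Omega\times\{0\}$). $\mathscr{H}_{0,L}^{1,2}(\mathcal{C},w)$ is the closure of $C_c^\infty(\mathcal{C}_\Omega)\cap W^{1,2}(\mathcal{C},w)$ in $W^{1,2}(\mathcal{C},w)$; under the Poincaré inequality it is endowed with the norm $\|u\|_{\mathscr{H}_{0,L}^{1,2}(\mathcal{C},w)}=\|\nabla u\|_{L^2(\mathcal{C},w)}$. Under the stated assumptions on $s$ and $\mathrm{G}_s$ there is a unique bounded linear operator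 $\mathrm{tr}_\Omega:\mathscr{H}_{0,L}^{1,2}(\mathcal{C},w)\to L^2(\Omega,\tilde w)$ with $\mathrm{tr}_\Omega u=u(\cdot,0)$ for all $u\in\mathscr{H}_{0,L}^{1,2}(\mathcal{C},w)\cap C_c^\infty(\mathcal{C}_\Omega)$. Set $\mathscr{W}_0^{1,2}(\mathcal{C},w)=\{u\in\mathscr{H}_{0,L}^{1,2}(\mathcal{C},w):\mathrm{tr}_\Omega u=0\}$ and $$\mathscr{Y}(\Omega,w)=\mathscr{H}_{0,L}^{1,2}(\mathcal{C},w)/\mathscr{W}_0^{1,2}(\mathcal{C},w)$$ with the quotient norm, and let $\mathrm{TR}_\Omega:\mathscr{H}_{0,L}^{1,2}(\mathcal{C},w)\to\mathscr{Y}(\Omega,w)$, $\mathrm{TR}_\Omega u=[u]$. The inclusion $\mathscr{Y}(\Omega,w)\subset L^2(\Omega,\tilde w)$ is via the bounded linear injection $I([u])=\mathrm{tr}_\Omega u$. For $v\in\mathscr{Y}(\Omega,w)$, $S(v)$ is the unique minimizer of $\frac12\int_{\mathcal{C}}w|\nabla u|^2dX$ over $u\in\mathscr{H}_{0,L}^{1,2}(\mathcal{C},w)$ with $\mathrm{TR}_\Omega u=v$. The operator $(-\Delta)^{s(\cdot)}:\mathscr{Y}(\Omega,w)\to\mathscr{Y}(\Omega,w)'$ is defined by $$\langle(-\Delta)^{s(\cdot)}v,\mathrm{TR}_\Omega\psi\rangle_{\mathscr{Y}',\mathscr{Y}}=\int_{\mathcal{C}}w\,\nabla S(v)\cdot\nabla\psi\,dX\qquad\text{for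 all }\psi\in\mathscr{H}_{0,L}^{1,2}(\mathcal{C},w).$$ A function $h\in L^2(\Omega,\tilde w)$ is regarded as an element of $\mathscr{Y}(\Omega,w)'$ by identifying $L^2(\Omega,\tilde w)$ with its dual and applying the adjoint $I'$, i.e. $\langle h,\mathrm{TR}_\Omega\psi\rangle_{\mathscr{Y}',\mathscr{Y}}=\int_\Omega h\,(\mathrm{tr}_\Omega\psi)\,\tilde w\,dx$; the equation is understood in $\mathscr{Y}(\Omega,w)'$. *)

theory Defs
  imports "HOL-Analysis.Analysis"
begin

section \<open>Domains, weights and weighted Lebesgue spaces\<close>

text \<open>
  Near each boundary point the set is, after a choice of the vertical direction \<open>e\<close>, the strict
  epigraph of a Lipschitz function on the hyperplane orthogonal to \<open>e\<close>. In dimension one that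
  hyperplane is a single point.
\<close>

definition lipschitz_boundary :: "'a::euclidean_space set \<Rightarrow> bool" where
  "lipschitz_boundary \<Omega> \<longleftrightarrow>
     (\<forall>p\<in>frontier \<Omega>. \<exists>r>0. \<exists>e. norm e = 1 \<and>
        (\<exists>\<gamma> L. L-lipschitz_on {z. z \<bullet> e = 0} (\<gamma> :: 'a \<Rightarrow> real) \<and>
           \<Omega> \<inter> ball p r = {x \<in> ball p r. \<gamma> (x - (x \<bullet> e) *\<^sub>R e) < x \<bullet> e}))"

definition weight :: "'b::euclidean_space set \<Rightarrow> ('b \<Rightarrow> real) \<Rightarrow> bool" where
  "weight U \<rho> \<longleftrightarrow>
     \<rho> \<in> borel_measurable (lebesgue_on U) \<and> (AE x in lebesgue_on U. 0 < \<rho> x)"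

definition L1_loc :: "'b::euclidean_space set \<Rightarrow> ('b \<Rightarrow> real) \<Rightarrow> bool" where
  "L1_loc U f \<longleftrightarrow> (\<forall>K. compact K \<and> K \<subseteq> U \<longrightarrow> set_integrable lebesgue K f)"

text \<open>
  Elements of function spaces are represented by functions on the whole type of which only the
  values on the underlying set matter. Functions that agree almost everywhere there represent the
  same element.
\<close>

definition L2 :: "'b::euclidean_space set \<Rightarrow> ('b \<Rightarrow> real) \<Rightarrow> ('b \<Rightarrow> real) set" where
  "L2 U \<rho> = {u. u \<in> borel_measurable (lebesgue_on U) \<and>
                 set_integrable lebesgue U (\<lambda>x. (u x)\<^sup>2 * \<rho> x)}"

definition L2_norm :: "'b::euclidean_space set \<Rightarrow> ('b \<Rightarrow> real) \<Rightarrow> ('b \<Rightarrow> real) \<Rightarrow> real" where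
  "L2_norm U \<rho> u = sqrt (LINT x:U|lebesgue. (u x)\<^sup>2 * \<rho> x)"


section \<open>Smooth functions and weak gradients\<close>

text \<open>
  The class \<open>C\<^sup>k\<close> up to the boundary of an open set \<open>U\<close>: all partial derivatives up to order \<open>k\<close>
  exist in \<open>U\<close> and extend continuously to the closure; \<open>g\<close> below is the extended derivative.
  For \<open>U = UNIV\<close> this is the ordinary class \<open>C\<^sup>k\<close>.
\<close>

primrec Ck_closure :: "nat \<Rightarrow> 'b::euclidean_space set \<Rightarrow> ('b \<Rightarrow> real) \<Rightarrow> bool" where
  "Ck_closure 0 U u \<longleftrightarrow> continuous_on (closure U) u"
| "Ck_closure (Suc k) U u \<longleftrightarrow>
     continuous_on (closure U) u \<and>
     (\<forall>x\<in>U. u differentiable (at x)) \<and>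
     (\<forall>b\<in>Basis. \<exists>g. Ck_closure k U g \<and> (\<forall>x\<in>U. g x = frechet_derivative u (at x) b))"

definition smooth_closure :: "'b::euclidean_space set \<Rightarrow> ('b \<Rightarrow> real) \<Rightarrow> bool" where
  "smooth_closure U u \<longleftrightarrow> (\<forall>k. Ck_closure k U u)"

definition test_functions :: "'b::euclidean_space set \<Rightarrow> ('b \<Rightarrow> real) set" where
  "test_functions U = {\<phi>. smooth_closure UNIV \<phi> \<and>
                          compact (closure {x. \<phi> x \<noteq> 0}) \<and> closure {x. \<phi> x \<noteq> 0} \<subseteq> U}"

definition has_weak_gradient ::
    "'b::euclidean_space set \<Rightarrow> ('b \<Rightarrow> real) \<Rightarrow> ('b \<Rightarrow> 'b) \<Rightarrow> bool" where
  "has_weak_gradient U u g \<longleftrightarrow>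
     L1_loc U u \<and>
     (\<forall>b\<in>Basis. L1_loc U (\<lambda>x. g x \<bullet> b) \<and>
        (\<forall>\<phi>\<in>test_functions U.
           (LINT x:U|lebesgue. u x * frechet_derivative \<phi> (at x) b) =
           - (LINT x:U|lebesgue. (g x \<bullet> b) * \<phi> x)))"

text \<open>The weak gradient is determined only almost everywhere; one representative is chosen.\<close>

definition weak_gradient :: "'b::euclidean_space set \<Rightarrow> ('b \<Rightarrow> real) \<Rightarrow> 'b \<Rightarrow> 'b" where
  "weak_gradient U u = (SOME g. has_weak_gradient U u g)"

definition W12 :: "'b::euclidean_space set \<Rightarrow> ('b \<Rightarrow> real) \<Rightarrow> ('b \<Rightarrow> real) set" where
  "W12 U \<rho> = {u \<in> L2 U \<rho>. (\<exists>g. has_weak_gradient U u g) \<and>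
                            (\<lambda>x. norm (weak_gradient U u x)) \<in> L2 U \<rho>}"

definition W12_norm :: "'b::euclidean_space set \<Rightarrow> ('b \<Rightarrow> real) \<Rightarrow> ('b \<Rightarrow> real) \<Rightarrow> real" where
  "W12_norm U \<rho> u =
     sqrt ((LINT x:U|lebesgue. (u x)\<^sup>2 * \<rho> x) +
           (LINT x:U|lebesgue. (norm (weak_gradient U u x))\<^sup>2 * \<rho> x))"


section \<open>The space on the cylinder and its trace space\<close>

definition cylinder :: "'a::euclidean_space set \<Rightarrow> ('a \<times> real) set" where
  "cylinder \<Omega> = \<Omega> \<times> {0<..}"

definition cylinder_base :: "'a::euclidean_space set \<Rightarrow> ('a \<times> real) set" where
  "cylinder_base \<Omega> = cylinder \<Omega> \<union> \<Omega> \<times> {0}"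

definition Cc_cylinder :: "'a::euclidean_space set \<Rightarrow> ('a \<times> real \<Rightarrow> real) set" where
  "Cc_cylinder \<Omega> =
     {u. smooth_closure (cylinder \<Omega>) u \<and>
         compact (closure {X \<in> closure (cylinder \<Omega>). u X \<noteq> 0}) \<and>
         closure {X \<in> closure (cylinder \<Omega>). u X \<noteq> 0} \<subseteq> cylinder_base \<Omega>}"

definition H0L :: "'a::euclidean_space set \<Rightarrow> ('a \<times> real \<Rightarrow> real) \<Rightarrow> ('a \<times> real \<Rightarrow> real) set" where
  "H0L \<Omega> w = {u \<in> W12 (cylinder \<Omega>) w.
                 \<forall>\<epsilon>>0. \<exists>\<phi> \<in> Cc_cylinder \<Omega> \<inter> W12 (cylinder \<Omega>) w.
                   W12_norm (cylinder \<Omega>) w (\<lambda>X. u X - \<phi> X) < \<epsilon>}"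

definition H0L_norm ::
    "'a::euclidean_space set \<Rightarrow> ('a \<times> real \<Rightarrow> real) \<Rightarrow> ('a \<times> real \<Rightarrow> real) \<Rightarrow> real" where
  "H0L_norm \<Omega> w u = L2_norm (cylinder \<Omega>) w (\<lambda>X. norm (weak_gradient (cylinder \<Omega>) u X))"

text \<open>
  In the remaining definitions \<open>w\<close> is the weight on the cylinder and \<open>wt\<close> the weight on \<open>\<Omega>\<close>.
\<close>

definition trace_operator ::
    "'a::euclidean_space set \<Rightarrow> ('a \<times> real \<Rightarrow> real) \<Rightarrow> ('a \<Rightarrow> real) \<Rightarrow>
     (('a \<times> real \<Rightarrow> real) \<Rightarrow> 'a \<Rightarrow> real) \<Rightarrow> bool" where
  "trace_operator \<Omega> w wt T \<longleftrightarrow>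
     (\<forall>u\<in>H0L \<Omega> w. T u \<in> L2 \<Omega> wt) \<and>
     (\<forall>u\<in>H0L \<Omega> w. \<forall>v\<in>H0L \<Omega> w.
        AE x in lebesgue_on \<Omega>. T (\<lambda>X. u X + v X) x = T u x + T v x) \<and>
     (\<forall>c. \<forall>u\<in>H0L \<Omega> w. AE x in lebesgue_on \<Omega>. T (\<lambda>X. c * u X) x = c * T u x) \<and>
     (\<exists>K. \<forall>u\<in>H0L \<Omega> w. L2_norm \<Omega> wt (T u) \<le> K * H0L_norm \<Omega> w u) \<and>
     (\<forall>u\<in>H0L \<Omega> w \<inter> Cc_cylinder \<Omega>. AE x in lebesgue_on \<Omega>. T u x = u (x, 0))"

text \<open>
  The trace operator is unique up to equality almost everywhere; a representative is chosen.
\<close>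

definition trace_map ::
    "'a::euclidean_space set \<Rightarrow> ('a \<times> real \<Rightarrow> real) \<Rightarrow> ('a \<Rightarrow> real) \<Rightarrow>
     ('a \<times> real \<Rightarrow> real) \<Rightarrow> 'a \<Rightarrow> real" where
  "trace_map \<Omega> w wt = (SOME T. trace_operator \<Omega> w wt T)"

definition W0 ::
    "'a::euclidean_space set \<Rightarrow> ('a \<times> real \<Rightarrow> real) \<Rightarrow> ('a \<Rightarrow> real) \<Rightarrow>
     ('a \<times> real \<Rightarrow> real) set" where
  "W0 \<Omega> w wt = {u \<in> H0L \<Omega> w. AE x in lebesgue_on \<Omega>. trace_map \<Omega> w wt u x = 0}"

definition mod_W0 ::
    "'a::euclidean_space set \<Rightarrow> ('a \<times> real \<Rightarrow> real) \<Rightarrow> ('a \<Rightarrow> real) \<Rightarrow>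
     (('a \<times> real \<Rightarrow> real) \<times> ('a \<times> real \<Rightarrow> real)) set" where
  "mod_W0 \<Omega> w wt = {(u, v). u \<in> H0L \<Omega> w \<and> v \<in> H0L \<Omega> w \<and> (\<lambda>X. u X - v X) \<in> W0 \<Omega> w wt}"

definition Y_space ::
    "'a::euclidean_space set \<Rightarrow> ('a \<times> real \<Rightarrow> real) \<Rightarrow> ('a \<Rightarrow> real) \<Rightarrow>
     ('a \<times> real \<Rightarrow> real) set set" where
  "Y_space \<Omega> w wt = H0L \<Omega> w // mod_W0 \<Omega> w wt"

definition TR ::
    "'a::euclidean_space set \<Rightarrow> ('a \<times> real \<Rightarrow> real) \<Rightarrow> ('a \<Rightarrow> real) \<Rightarrow>
     ('a \<times> real \<Rightarrow> real) \<Rightarrow> ('a \<times> real \<Rightarrow> real) set" where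
  "TR \<Omega> w wt u = mod_W0 \<Omega> w wt `` {u}"

definition Y_norm ::
    "'a::euclidean_space set \<Rightarrow> ('a \<times> real \<Rightarrow> real) \<Rightarrow> ('a \<times> real \<Rightarrow> real) set \<Rightarrow> real" where
  "Y_norm \<Omega> w z = (INF u\<in>z. H0L_norm \<Omega> w u)"

text \<open>The inclusion of the quotient space into the weighted \<open>L\<^sup>2\<close> space on \<open>\<Omega>\<close>.\<close>

definition Y_incl ::
    "'a::euclidean_space set \<Rightarrow> ('a \<times> real \<Rightarrow> real) \<Rightarrow> ('a \<Rightarrow> real) \<Rightarrow>
     ('a \<times> real \<Rightarrow> real) set \<Rightarrow> 'a \<Rightarrow> real" where
  "Y_incl \<Omega> w wt z = trace_map \<Omega> w wt (SOME u. u \<in> z)"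

text \<open>
  Functionals on the quotient space are normalised to be \<open>undefined\<close> outside it, so that equality
  in the dual space is equality of functions.
\<close>

definition Y_dual ::
    "'a::euclidean_space set \<Rightarrow> ('a \<times> real \<Rightarrow> real) \<Rightarrow> ('a \<Rightarrow> real) \<Rightarrow>
     (('a \<times> real \<Rightarrow> real) set \<Rightarrow> real) set" where
  "Y_dual \<Omega> w wt =
     {F \<in> extensional (Y_space \<Omega> w wt).
        (\<forall>u\<in>H0L \<Omega> w. \<forall>v\<in>H0L \<Omega> w.
           F (TR \<Omega> w wt (\<lambda>X. u X + v X)) = F (TR \<Omega> w wt u) + F (TR \<Omega> w wt v)) \<and>
        (\<forall>c. \<forall>u\<in>H0L \<Omega> w. F (TR \<Omega> w wt (\<lambda>X. c * u X)) = c * F (TR \<Omega> w wt u)) \<and>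
        (\<exists>K. \<forall>z\<in>Y_space \<Omega> w wt. \<bar>F z\<bar> \<le> K * Y_norm \<Omega> w z)}"


section \<open>The operator\<close>

definition energy :: "'a::euclidean_space set \<Rightarrow> ('a \<times> real \<Rightarrow> real) \<Rightarrow> ('a \<times> real \<Rightarrow> real) \<Rightarrow> real" where
  "energy \<Omega> w u =
     (1/2) * (LINT X:cylinder \<Omega>|lebesgue. w X * (norm (weak_gradient (cylinder \<Omega>) u X))\<^sup>2)"

text \<open>The minimizer is unique as an element of the function space, so up to null sets.\<close>

definition minimizer ::
    "'a::euclidean_space set \<Rightarrow> ('a \<times> real \<Rightarrow> real) \<Rightarrow> ('a \<Rightarrow> real) \<Rightarrow>
     ('a \<times> real \<Rightarrow> real) set \<Rightarrow> ('a \<times> real \<Rightarrow> real)" where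
  "minimizer \<Omega> w wt v =
     (SOME u. u \<in> H0L \<Omega> w \<and> TR \<Omega> w wt u = v \<and>
        (\<forall>u'\<in>H0L \<Omega> w. TR \<Omega> w wt u' = v \<longrightarrow> energy \<Omega> w u \<le> energy \<Omega> w u'))"

definition frac_laplacian ::
    "'a::euclidean_space set \<Rightarrow> ('a \<times> real \<Rightarrow> real) \<Rightarrow> ('a \<Rightarrow> real) \<Rightarrow>
     ('a \<times> real \<Rightarrow> real) set \<Rightarrow> (('a \<times> real \<Rightarrow> real) set \<Rightarrow> real)" where
  "frac_laplacian \<Omega> w wt v =
     (THE F. F \<in> Y_dual \<Omega> w wt \<and>
        (\<forall>\<psi>\<in>H0L \<Omega> w. F (TR \<Omega> w wt \<psi>) =
           (LINT X:cylinder \<Omega>|lebesgue.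
              w X * (weak_gradient (cylinder \<Omega>) (minimizer \<Omega> w wt v) X
                       \<bullet> weak_gradient (cylinder \<Omega>) \<psi> X))))"

text \<open>
  The adjoint of the inclusion, with the weighted \<open>L\<^sup>2\<close> space on \<open>\<Omega>\<close> identified with its dual.
\<close>

definition Y_incl_adjoint ::
    "'a::euclidean_space set \<Rightarrow> ('a \<times> real \<Rightarrow> real) \<Rightarrow> ('a \<Rightarrow> real) \<Rightarrow>
     ('a \<Rightarrow> real) \<Rightarrow> (('a \<times> real \<Rightarrow> real) set \<Rightarrow> real)" where
  "Y_incl_adjoint \<Omega> w wt h =
     (\<lambda>z\<in>Y_space \<Omega> w wt. LINT x:\<Omega>|lebesgue. h x * Y_incl \<Omega> w wt z x * wt x)"

end

theory Submission imports Defs begin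

text \<open>
  Write \<open>H\<close> for the space of functions on the cylinder and \<open>form u v\<close> for the weighted integral of
  \<open>\<nabla>u \<bullet> \<nabla>v\<close>. By the Poincare inequality \<open>form\<close> is an inner product on \<open>H\<close>, up to null sets,
  whose norm is equivalent to the Sobolev norm. If \<open>H\<close> is complete and the trace is bounded on it, then
  \<open>l \<psi> = \<integral> h (tr \<psi>) wt\<close> is a bounded functional, and by the Riesz representation theorem there is
  \<open>u\<close> in \<open>H\<close> with \<open>form u \<psi> = l \<psi>\<close> for all \<open>\<psi>\<close>. Since \<open>l\<close> vanishes on functions with zero trace, \<open>u\<close> is
  orthogonal to them; this is also what characterises the energy minimizer of the class of \<open>u\<close>. So the
  operator sends the class of \<open>u\<close> to \<open>h\<close>. Uniqueness is definiteness: if two minimizers induce the same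
  functional then their difference has energy zero, hence trace zero, and the two classes agree.

  Three facts carry this.

  \<^item> Weak gradients are unique almost everywhere, hence linear (\<open>fundamental_lemma\<close>,
    \<open>has_weak_gradient_unique\<close>). The gradient in the definitions is a chosen representative, so nothing
    can be computed without this. It needs smooth functions that approximate the indicators of boxes.

  \<^item> \<open>H\<close> is complete (\<open>W12_complete\<close>, \<open>H_closed\<close>). Because \<open>1/w\<close> is locally integrable, integration
    against a test function is continuous for the weighted norm, and weak gradients pass to limits.

  \<^item> The trace of a smooth function is bounded by its Sobolev norm (\<open>trace_inequality\<close>). On each
    vertical line this is the fundamental theorem of calculus with the Cauchy--Schwarz inequality
    (\<open>trace_inequality_line\<close>); the weight \<open>(2 s)\<^sup>2\<close> on the base cancels the factor \<open>1/(2 s)\<close> from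
    \<open>\<integral>\<^sub>0\<^sup>y t\<^bsup>2s - 1\<^esup> dt\<close>. By density and completeness the trace extends to \<open>H\<close>
    (\<open>trace_operator_exists\<close>).

  The Riesz representation and the existence of energy minimizers are both instances of minimising a
  quadratic functional (\<open>quadratic_minimum_exists\<close>, \<open>quadratic_minimum_stationary\<close>).
\<close>

section \<open>Square integrable functions\<close>

definition square_integrable :: "'x measure \<Rightarrow> ('x \<Rightarrow> 'v::euclidean_space) \<Rightarrow> bool" where
  "square_integrable M f \<longleftrightarrow> f \<in> borel_measurable M \<and> integrable M (\<lambda>x. (norm (f x))\<^sup>2)"

lemma norm_add_squared_le: "(norm (a + b :: 'v::real_normed_vector))\<^sup>2 \<le> 2 * (norm a)\<^sup>2 + 2 * (norm b)\<^sup>2"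
proof -
  have "(norm (a + b))\<^sup>2 \<le> (norm a + norm b)\<^sup>2"
    by (intro power_mono norm_triangle_ineq norm_ge_zero)
  also have "\<dots> \<le> 2 * (norm a)\<^sup>2 + 2 * (norm b)\<^sup>2"
    using sum_squares_bound[of "norm a" "norm b"] by (simp add: power2_sum)
  finally show ?thesis .
qed

lemma square_integrable_add:
  assumes "square_integrable M f" "square_integrable M g"
  shows "square_integrable M (\<lambda>x. f x + g x)"
proof -
  have [measurable]: "f \<in> borel_measurable M" "g \<in> borel_measurable M"
    using assms by (auto simp: square_integrable_def)
  have "integrable M (\<lambda>x. (norm (f x + g x))\<^sup>2)"
  proof (rule Bochner_Integration.integrable_bound)
    show "integrable M (\<lambda>x. 2 * (norm (f x))\<^sup>2 + 2 * (norm (g x))\<^sup>2)"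
      using assms by (auto simp: square_integrable_def)
  qed (auto intro: order_trans[OF norm_add_squared_le])
  then show ?thesis by (simp add: square_integrable_def)
qed

lemma square_integrable_scale:
  assumes "square_integrable M f"
  shows "square_integrable M (\<lambda>x. c *\<^sub>R f x)"
  using assms by (auto simp: square_integrable_def power_mult_distrib)

lemma square_integrable_diff:
  assumes "square_integrable M f" "square_integrable M g"
  shows "square_integrable M (\<lambda>x. f x - g x)"
  using square_integrable_add[OF assms(1) square_integrable_scale[OF assms(2), of "-1"]] by simp

lemma square_integrable_inner:
  assumes "square_integrable M f" "square_integrable M g"
  shows "integrable M (\<lambda>x. f x \<bullet> g x)"
proof -
  have [measurable]: "f \<in> borel_measurable M" "g \<in> borel_measurable M"
    using assms by (auto simp: square_integrable_def)
  show ?thesis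
  proof (rule Bochner_Integration.integrable_bound)
    show "integrable M (\<lambda>x. (norm (f x))\<^sup>2 + (norm (g x))\<^sup>2)"
      using assms by (auto simp: square_integrable_def)
    have "\<bar>f x \<bullet> g x\<bar> \<le> (norm (f x))\<^sup>2 + (norm (g x))\<^sup>2" for x
    proof -
      have "\<bar>f x \<bullet> g x\<bar> \<le> norm (f x) * norm (g x)" by (rule Cauchy_Schwarz_ineq2)
      moreover have "2 * norm (f x) * norm (g x) \<le> (norm (f x))\<^sup>2 + (norm (g x))\<^sup>2"
        by (rule sum_squares_bound)
      moreover have "0 \<le> norm (f x) * norm (g x)" by simp
      ultimately show ?thesis by linarith
    qed
    then show "AE x in M. norm (f x \<bullet> g x) \<le> norm ((norm (f x))\<^sup>2 + (norm (g x))\<^sup>2)"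
      by auto
  qed simp
qed

text \<open>
  Used for the Cauchy--Schwarz inequality and, with \<open>a = 0\<close>, for Euler--Lagrange equations.
\<close>

lemma nonneg_quadratic_discriminant:
  fixes a b c :: real
  assumes "\<And>t. 0 \<le> a + 2 * t * b + t\<^sup>2 * c" "0 \<le> c"
  shows "b\<^sup>2 \<le> a * c"
proof (cases "c = 0")
  case True
  have "b = 0"
  proof (rule ccontr)
    assume "b \<noteq> 0"
    then show False using assms(1)[of "- (a + 1) / (2 * b)"] True by (simp add: field_simps)
  qed
  then show ?thesis using True by simp
next
  case False
  then have "c > 0" using assms(2) by simp
  have "0 \<le> (a + 2 * (- b / c) * b + (- b / c)\<^sup>2 * c) * c"
    using assms(1)[of "- b / c"] assms(2) by (intro mult_nonneg_nonneg)
  also have "\<dots> = a * c - b\<^sup>2" using \<open>c > 0\<close> by (simp add: field_simps power2_eq_square)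
  finally show ?thesis by simp
qed

lemma integral_Cauchy_Schwarz:
  fixes f g :: "'x \<Rightarrow> 'v::euclidean_space"
  assumes f: "square_integrable M f" and g: "square_integrable M g"
  shows "(LINT x|M. f x \<bullet> g x)\<^sup>2 \<le> (LINT x|M. (norm (f x))\<^sup>2) * (LINT x|M. (norm (g x))\<^sup>2)"
proof (rule nonneg_quadratic_discriminant)
  fix t
  have i: "integrable M (\<lambda>x. (norm (f x))\<^sup>2)" "integrable M (\<lambda>x. (norm (g x))\<^sup>2)"
    using f g by (auto simp: square_integrable_def)
  have "(norm (f x + t *\<^sub>R g x))\<^sup>2 = (norm (f x))\<^sup>2 + 2 * t * (f x \<bullet> g x) + t\<^sup>2 * (norm (g x))\<^sup>2" for x
    unfolding power2_norm_eq_inner inner_add_left inner_add_right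
    by (simp add: inner_commute[of "g x" "f x"] power2_eq_square algebra_simps)
  then have "(LINT x|M. (norm (f x + t *\<^sub>R g x))\<^sup>2) =
     (LINT x|M. (norm (f x))\<^sup>2) + 2 * t * (LINT x|M. f x \<bullet> g x) + t\<^sup>2 * (LINT x|M. (norm (g x))\<^sup>2)"
    using i square_integrable_inner[OF f g] by simp
  moreover have "0 \<le> (LINT x|M. (norm (f x + t *\<^sub>R g x))\<^sup>2)" by simp
  ultimately show "0 \<le> (LINT x|M. (norm (f x))\<^sup>2) + 2 * t * (LINT x|M. f x \<bullet> g x)
     + t\<^sup>2 * (LINT x|M. (norm (g x))\<^sup>2)" by simp
qed simp

text \<open>
  The triangle inequality of the norm is replaced throughout by its squared form with the
  constant 2, which is all that limit arguments require.
\<close>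

lemma integral_norm_add_squared_le:
  assumes "square_integrable M f" "square_integrable M g"
  shows "(LINT x|M. (norm (f x + g x))\<^sup>2) \<le> 2 * (LINT x|M. (norm (f x))\<^sup>2) + 2 * (LINT x|M. (norm (g x))\<^sup>2)"
proof -
  have "(LINT x|M. (norm (f x + g x))\<^sup>2) \<le> (LINT x|M. 2 * (norm (f x))\<^sup>2 + 2 * (norm (g x))\<^sup>2)"
    using assms square_integrable_add[OF assms]
    by (intro integral_mono norm_add_squared_le) (auto simp: square_integrable_def)
  also have "\<dots> = 2 * (LINT x|M. (norm (f x))\<^sup>2) + 2 * (LINT x|M. (norm (g x))\<^sup>2)"
    using assms by (simp add: square_integrable_def)
  finally show ?thesis .
qed

text \<open>
  The sum of \<open>2\<^sup>k |F (k + 1) - F k|\<^sup>2\<close> has finite integral, so it is finite almost everywhere.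
  There the increments are \<open>O(2\<^bsup>-k/2\<^esup>)\<close> and the telescoping series converges absolutely.
\<close>

lemma rapid_Cauchy_imp_AE_convergent:
  fixes F :: "nat \<Rightarrow> 'x \<Rightarrow> 'v::euclidean_space"
  assumes F: "\<And>n. square_integrable M (F n)"
    and rapid: "\<And>k. (LINT x|M. (norm (F (Suc k) x - F k x))\<^sup>2) \<le> (1/4) ^ k"
  shows "AE x in M. convergent (\<lambda>k. F k x)"
proof -
  have [measurable]: "F n \<in> borel_measurable M" for n
    using F by (auto simp: square_integrable_def)
  define e where "e k x = ennreal (2 ^ k * (norm (F (Suc k) x - F k x))\<^sup>2)" for k x
  have [measurable]: "e k \<in> borel_measurable M" for k unfolding e_def by simp
  have e_le: "(\<integral>\<^sup>+x. e k x \<partial>M) \<le> ennreal ((1/2) ^ k)" for k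
  proof -
    have "(\<integral>\<^sup>+x. e k x \<partial>M) = ennreal (LINT x|M. 2 ^ k * (norm (F (Suc k) x - F k x))\<^sup>2)"
      unfolding e_def using square_integrable_diff[OF F F]
      by (intro nn_integral_eq_integral) (auto simp: square_integrable_def)
    also have "\<dots> \<le> ennreal (2 ^ k * (1/4) ^ k)"
      using rapid[of k] by (intro ennreal_leI) simp
    also have "2 ^ k * (1/4) ^ k = ((1/2)::real) ^ k"
      by (simp add: power_mult_distrib[symmetric])
    finally show ?thesis .
  qed
  have "(\<integral>\<^sup>+x. (\<Sum>k. e k x) \<partial>M) = (\<Sum>k. \<integral>\<^sup>+x. e k x \<partial>M)"
    by (rule nn_integral_suminf) simp
  also have "\<dots> \<le> (\<Sum>k. ennreal ((1/2) ^ k))" by (intro suminf_le e_le) auto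
  also have "\<dots> < \<infinity>"
    using summable_geometric[of "1/2::real"]
    by (simp add: ennreal_suminf_neq_top less_top[symmetric])
  finally have "AE x in M. (\<Sum>k. e k x) \<noteq> \<infinity>"
    by (intro nn_integral_noteq_infinite) auto
  then show ?thesis
  proof eventually_elim
    case (elim x)
    define S where "S = enn2real (\<Sum>k. e k x)"
    have bound: "2 ^ k * (norm (F (Suc k) x - F k x))\<^sup>2 \<le> S" for k
    proof -
      have "e k x \<le> (\<Sum>k. e k x)"
        using sum_le_suminf[of "\<lambda>k. e k x" "{k}"] by simp
      also have "\<dots> = ennreal S" using elim by (simp add: S_def less_top)
      finally show ?thesis by (simp add: e_def S_def)
    qed
    define q :: real where "q = sqrt (1/2)"
    have q: "0 < q" "q < 1" by (auto simp: q_def real_sqrt_divide)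
    have le: "norm (F (Suc k) x - F k x) \<le> sqrt S * q ^ k" for k
    proof -
      have "(norm (F (Suc k) x - F k x))\<^sup>2 \<le> S * (1/2) ^ k"
        using bound[of k] by (simp add: field_simps)
      then have "norm (F (Suc k) x - F k x) \<le> sqrt (S * (1/2) ^ k)"
        by (rule real_le_rsqrt)
      then show ?thesis by (simp add: real_sqrt_mult real_sqrt_power q_def)
    qed
    have "summable (\<lambda>k. sqrt S * q ^ k)"
      using q by (intro summable_mult summable_geometric) simp
    then have "summable (\<lambda>k. F (Suc k) x - F k x)"
      by (rule summable_comparison_test'[where N = 0]) (rule le)
    then have "convergent (\<lambda>n. \<Sum>k<n. F (Suc k) x - F k x)"
      by (simp add: summable_iff_convergent)
    then have "convergent (\<lambda>n. (F n x - F 0 x) + F 0 x)"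
      unfolding sum_lessThan_telescope[of "\<lambda>k. F k x"] by (rule convergent_add[OF _ convergent_const])
    then show ?case by simp
  qed
qed

text \<open>
  The Riesz--Fischer theorem: a subsequence converges almost everywhere, and by Fatou's lemma its
  limit is also the limit in mean.
\<close>

lemma square_integrable_complete:
  fixes F :: "nat \<Rightarrow> 'x \<Rightarrow> 'v::euclidean_space"
  assumes F: "\<And>n. square_integrable M (F n)"
    and cauchy: "\<And>\<epsilon>. 0 < \<epsilon> \<Longrightarrow> \<exists>N. \<forall>m\<ge>N. \<forall>n\<ge>N. (LINT x|M. (norm (F m x - F n x))\<^sup>2) \<le> \<epsilon>"
  shows "\<exists>f. square_integrable M f \<and> (\<lambda>n. LINT x|M. (norm (F n x - f x))\<^sup>2) \<longlonglongrightarrow> 0"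
proof -
  have [measurable]: "F n \<in> borel_measurable M" for n
    using F by (auto simp: square_integrable_def)
  have "\<exists>N. \<forall>m\<ge>N. \<forall>n\<ge>N. (LINT x|M. (norm (F m x - F n x))\<^sup>2) \<le> (1/4) ^ k" for k
    by (rule cauchy) simp
  then obtain N where N: "\<And>k m n. m \<ge> N k \<Longrightarrow> n \<ge> N k \<Longrightarrow>
      (LINT x|M. (norm (F m x - F n x))\<^sup>2) \<le> (1/4) ^ k" by metis
  \<comment> \<open>A partial sum dominates \<open>N k\<close> and is monotone, and the successors force it to infinity.\<close>
  define r where "r k = (\<Sum>i\<le>k. Suc (N i))" for k
  have r_ge: "N k \<le> r k" "N k \<le> r (Suc k)" "k \<le> r k" for k
  proof -
    have "Suc (N k) \<le> r k" unfolding r_def by (rule member_le_sum) auto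
    then show "N k \<le> r k" "N k \<le> r (Suc k)" by (simp_all add: r_def)
    show "k \<le> r k"
      unfolding r_def by (induction k) auto
  qed
  have conv: "AE x in M. convergent (\<lambda>k. F (r k) x)"
    by (rule rapid_Cauchy_imp_AE_convergent[OF F N[OF r_ge(2,1)]])
  define f where "f x = lim (\<lambda>k. F (r k) x)" for x
  have f_meas[measurable]: "f \<in> borel_measurable M"
    unfolding f_def[abs_def] by (rule borel_measurable_lim_metric) simp
  have dist: "(\<integral>\<^sup>+x. ennreal ((norm (F n x - f x))\<^sup>2) \<partial>M) \<le> ennreal \<epsilon>"
    if K: "\<And>m n. m \<ge> K \<Longrightarrow> n \<ge> K \<Longrightarrow> (LINT x|M. (norm (F m x - F n x))\<^sup>2) \<le> \<epsilon>" and n: "n \<ge> K" for K n \<epsilon>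
  proof -
    have "(\<integral>\<^sup>+x. ennreal ((norm (F n x - f x))\<^sup>2) \<partial>M)
        = (\<integral>\<^sup>+x. liminf (\<lambda>k. ennreal ((norm (F n x - F (r k) x))\<^sup>2)) \<partial>M)"
    proof (rule nn_integral_cong_AE)
      show "AE x in M. ennreal ((norm (F n x - f x))\<^sup>2) = liminf (\<lambda>k. ennreal ((norm (F n x - F (r k) x))\<^sup>2))"
        using conv
      proof eventually_elim
        case (elim x)
        then have "(\<lambda>k. F (r k) x) \<longlonglongrightarrow> f x" by (simp add: f_def convergent_LIMSEQ_iff)
        then have "(\<lambda>k. ennreal ((norm (F n x - F (r k) x))\<^sup>2)) \<longlonglongrightarrow> ennreal ((norm (F n x - f x))\<^sup>2)"
          by (intro tendsto_ennrealI tendsto_intros)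
        then show ?case by (metis lim_imp_Liminf sequentially_bot)
      qed
    qed
    also have "\<dots> \<le> liminf (\<lambda>k. \<integral>\<^sup>+x. ennreal ((norm (F n x - F (r k) x))\<^sup>2) \<partial>M)"
      by (rule nn_integral_liminf) simp
    also have "\<dots> \<le> limsup (\<lambda>k. \<integral>\<^sup>+x. ennreal ((norm (F n x - F (r k) x))\<^sup>2) \<partial>M)"
      by (rule Liminf_le_Limsup) simp
    also have "\<dots> \<le> ennreal \<epsilon>"
    proof (rule Limsup_bounded)
      show "\<forall>\<^sub>F k in sequentially. (\<integral>\<^sup>+x. ennreal ((norm (F n x - F (r k) x))\<^sup>2) \<partial>M) \<le> ennreal \<epsilon>"
      proof (rule eventually_sequentiallyI[of K])
        fix k assume "K \<le> k"
        then have "(LINT x|M. (norm (F n x - F (r k) x))\<^sup>2) \<le> \<epsilon>"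
          using r_ge(3)[of k] by (intro K n) simp
        moreover have "(\<integral>\<^sup>+x. ennreal ((norm (F n x - F (r k) x))\<^sup>2) \<partial>M)
            = ennreal (LINT x|M. (norm (F n x - F (r k) x))\<^sup>2)"
          using square_integrable_diff[OF F F]
          by (intro nn_integral_eq_integral) (auto simp: square_integrable_def)
        ultimately show "(\<integral>\<^sup>+x. ennreal ((norm (F n x - F (r k) x))\<^sup>2) \<partial>M) \<le> ennreal \<epsilon>"
          by (simp add: ennreal_leI)
      qed
    qed
    finally show ?thesis .
  qed
  have sq: "square_integrable M (\<lambda>x. F (N 0) x - f x)"
    using dist[of "N 0" 1 "N 0"] N[of 0]
    by (auto simp: square_integrable_def integrable_iff_bounded intro: le_less_trans)
  have "square_integrable M f"
    using square_integrable_diff[OF F[of "N 0"] sq] by simp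
  moreover have "(\<lambda>n. LINT x|M. (norm (F n x - f x))\<^sup>2) \<longlonglongrightarrow> 0"
  proof (rule LIMSEQ_I)
    fix e :: real assume "0 < e"
    then obtain K where K: "\<And>m n. m \<ge> K \<Longrightarrow> n \<ge> K \<Longrightarrow> (LINT x|M. (norm (F m x - F n x))\<^sup>2) \<le> e / 2"
      using cauchy[of "e / 2"] by auto
    have "(LINT x|M. (norm (F n x - f x))\<^sup>2) \<le> e / 2" if "n \<ge> K" for n
    proof -
      have "ennreal (LINT x|M. (norm (F n x - f x))\<^sup>2) = (\<integral>\<^sup>+x. ennreal ((norm (F n x - f x))\<^sup>2) \<partial>M)"
        using square_integrable_diff[OF F \<open>square_integrable M f\<close>]
        by (intro nn_integral_eq_integral[symmetric]) (auto simp: square_integrable_def)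
      then have "ennreal (LINT x|M. (norm (F n x - f x))\<^sup>2) \<le> ennreal (e / 2)"
        using dist[OF K that] by simp
      then show ?thesis using \<open>0 < e\<close> by (subst (asm) ennreal_le_iff) auto
    qed
    then show "\<exists>no. \<forall>n\<ge>no. norm ((LINT x|M. (norm (F n x - f x))\<^sup>2) - 0) < e"
      using \<open>0 < e\<close> by (intro exI[of _ K]) fastforce
  qed
  ultimately show ?thesis by blast
qed

section \<open>Smooth functions and cut-offs\<close>

lemma Ck_closure_continuous: "Ck_closure k U u \<Longrightarrow> continuous_on (closure U) u"
  by (cases k) auto

text \<open>
  The definition speaks of the operator \<open>frechet_derivative\<close> and of anonymous extensions. The next two
  rules exchange these for a derivative \<open>D\<close> and a family \<open>g\<close> of extended partial derivatives.
\<close>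

lemma Ck_closure_SucI:
  assumes "continuous_on (closure U) u"
    and "\<And>x. x \<in> U \<Longrightarrow> (u has_derivative D x) (at x)"
    and "\<And>b. b \<in> Basis \<Longrightarrow> Ck_closure k U (g b)"
    and "\<And>b x. b \<in> Basis \<Longrightarrow> x \<in> U \<Longrightarrow> g b x = D x b"
  shows "Ck_closure (Suc k) U u"
proof -
  have "frechet_derivative u (at x) = D x" if "x \<in> U" for x
    using frechet_derivative_at[OF assms(2)[OF that]] by simp
  then show ?thesis using assms by (auto simp: differentiable_def intro!: exI)
qed

lemma Ck_closure_SucE:
  assumes "Ck_closure (Suc k) U u"
  obtains D g where "continuous_on (closure U) u"
    and "\<And>x. x \<in> U \<Longrightarrow> (u has_derivative D x) (at x)"
    and "\<And>b. b \<in> Basis \<Longrightarrow> Ck_closure k U (g b)"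
    and "\<And>b x. b \<in> Basis \<Longrightarrow> x \<in> U \<Longrightarrow> g b x = D x b"
proof -
  have "\<forall>b\<in>Basis. \<exists>g. Ck_closure k U g \<and> (\<forall>x\<in>U. g x = frechet_derivative u (at x) b)"
    using assms by simp
  then obtain g where "\<forall>b\<in>Basis. Ck_closure k U (g b) \<and> (\<forall>x\<in>U. g b x = frechet_derivative u (at x) b)"
    by metis
  then show thesis
    using assms by (intro that[of "\<lambda>x. frechet_derivative u (at x)" g]) (auto simp: frechet_derivative_works)
qed

lemma Ck_closure_Suc_imp: "Ck_closure (Suc k) U u \<Longrightarrow> Ck_closure k U u"
proof (induction k arbitrary: u)
  case (Suc k)
  from Suc.prems obtain D g where *: "continuous_on (closure U) u"
    "\<And>x. x \<in> U \<Longrightarrow> (u has_derivative D x) (at x)"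
    "\<And>b. b \<in> Basis \<Longrightarrow> Ck_closure (Suc k) U (g b)"
    "\<And>b x. b \<in> Basis \<Longrightarrow> x \<in> U \<Longrightarrow> g b x = D x b"
    by (rule Ck_closure_SucE) blast
  show ?case by (rule Ck_closure_SucI[OF *(1,2) Suc.IH[OF *(3)] *(4)])
qed simp

lemma Ck_closure_const: "Ck_closure k U (\<lambda>_. c)"
proof (induction k arbitrary: c)
  case (Suc k)
  show ?case by (rule Ck_closure_SucI[where D = "\<lambda>_ _. 0" and g = "\<lambda>_ _. 0"]) (auto intro: Suc)
qed simp

lemma Ck_closure_add: "Ck_closure k U u \<Longrightarrow> Ck_closure k U v \<Longrightarrow> Ck_closure k U (\<lambda>x. u x + v x)"
proof (induction k arbitrary: u v)
  case 0
  then show ?case by (simp add: continuous_on_add)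
next
  case (Suc k)
  obtain D g where u: "continuous_on (closure U) u"
    "\<And>x. x \<in> U \<Longrightarrow> (u has_derivative D x) (at x)"
    "\<And>b. b \<in> Basis \<Longrightarrow> Ck_closure k U (g b)"
    "\<And>b x. b \<in> Basis \<Longrightarrow> x \<in> U \<Longrightarrow> g b x = D x b"
    using Suc.prems(1) by (rule Ck_closure_SucE) blast
  obtain E h where v: "continuous_on (closure U) v"
    "\<And>x. x \<in> U \<Longrightarrow> (v has_derivative E x) (at x)"
    "\<And>b. b \<in> Basis \<Longrightarrow> Ck_closure k U (h b)"
    "\<And>b x. b \<in> Basis \<Longrightarrow> x \<in> U \<Longrightarrow> h b x = E x b"
    using Suc.prems(2) by (rule Ck_closure_SucE) blast
  show ?case
  proof (rule Ck_closure_SucI)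
    show "continuous_on (closure U) (\<lambda>x. u x + v x)" by (intro continuous_intros u v)
    show "((\<lambda>x. u x + v x) has_derivative (\<lambda>b. D x b + E x b)) (at x)" if "x \<in> U" for x
      by (intro has_derivative_add u v that)
    show "Ck_closure k U (\<lambda>x. g b x + h b x)" if "b \<in> Basis" for b
      by (intro Suc.IH u v that)
    show "g b x + h b x = D x b + E x b" if "b \<in> Basis" "x \<in> U" for b x
      using u(4)[OF that] v(4)[OF that] by simp
  qed
qed

lemma Ck_closure_mult: "Ck_closure k U u \<Longrightarrow> Ck_closure k U v \<Longrightarrow> Ck_closure k U (\<lambda>x. u x * v x)"
proof (induction k arbitrary: u v)
  case 0
  then show ?case by (simp add: continuous_on_mult)
next
  case (Suc k)
  obtain D g where u: "continuous_on (closure U) u"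
    "\<And>x. x \<in> U \<Longrightarrow> (u has_derivative D x) (at x)"
    "\<And>b. b \<in> Basis \<Longrightarrow> Ck_closure k U (g b)"
    "\<And>b x. b \<in> Basis \<Longrightarrow> x \<in> U \<Longrightarrow> g b x = D x b"
    using Suc.prems(1) by (rule Ck_closure_SucE) blast
  obtain E h where v: "continuous_on (closure U) v"
    "\<And>x. x \<in> U \<Longrightarrow> (v has_derivative E x) (at x)"
    "\<And>b. b \<in> Basis \<Longrightarrow> Ck_closure k U (h b)"
    "\<And>b x. b \<in> Basis \<Longrightarrow> x \<in> U \<Longrightarrow> h b x = E x b"
    using Suc.prems(2) by (rule Ck_closure_SucE) blast
  show ?case
  proof (rule Ck_closure_SucI)
    show "continuous_on (closure U) (\<lambda>x. u x * v x)" by (intro continuous_intros u v)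
    show "((\<lambda>x. u x * v x) has_derivative (\<lambda>b. u x * E x b + D x b * v x)) (at x)" if "x \<in> U" for x
      by (intro has_derivative_mult u v that)
    show "Ck_closure k U (\<lambda>x. u x * h b x + g b x * v x)" if "b \<in> Basis" for b
      by (rule Ck_closure_add[OF Suc.IH[OF Ck_closure_Suc_imp[OF Suc.prems(1)] v(3)[OF that]]
          Suc.IH[OF u(3)[OF that] Ck_closure_Suc_imp[OF Suc.prems(2)]]])
    show "u x * h b x + g b x * v x = u x * E x b + D x b * v x" if "b \<in> Basis" "x \<in> U" for b x
      using u(4)[OF that] v(4)[OF that] by simp
  qed
qed

lemma Ck_closure_cmult: "Ck_closure k U u \<Longrightarrow> Ck_closure k U (\<lambda>x. c * u x)"
  by (rule Ck_closure_mult[OF Ck_closure_const])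

lemma Ck_closure_prod:
  "finite I \<Longrightarrow> (\<And>i. i \<in> I \<Longrightarrow> Ck_closure k U (f i)) \<Longrightarrow> Ck_closure k U (\<lambda>x. \<Prod>i\<in>I. f i x)"
proof (induction I rule: finite_induct)
  case empty
  then show ?case by (simp add: Ck_closure_const)
next
  case (insert i I)
  then have "Ck_closure k U (\<lambda>x. f i x * (\<Prod>i\<in>I. f i x))"
    by (simp add: Ck_closure_mult)
  then show ?case using insert by simp
qed

lemma smooth_closure_one_minus_power:
  assumes "smooth_closure U u"
  shows "smooth_closure U (\<lambda>x. 1 - (1 - u x) ^ n)"
  unfolding smooth_closure_def
proof
  fix k
  have u: "Ck_closure k U u" using assms by (simp add: smooth_closure_def)
  have "Ck_closure k U (\<lambda>x. 1 + (-1) * u x)"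
    by (rule Ck_closure_add[OF Ck_closure_const Ck_closure_cmult[OF u]])
  then have v: "Ck_closure k U (\<lambda>x. 1 - u x)" by simp
  have "Ck_closure k U (\<lambda>x. (1 - u x) ^ n)"
  proof (induction n)
    case (Suc n)
    then show ?case using Ck_closure_mult[OF v Suc] by simp
  qed (simp add: Ck_closure_const)
  then have "Ck_closure k U (\<lambda>x. 1 + (-1) * (1 - u x) ^ n)"
    by (rule Ck_closure_add[OF Ck_closure_const Ck_closure_cmult])
  then show "Ck_closure k U (\<lambda>x. 1 - (1 - u x) ^ n)" by simp
qed

text \<open>
  All derivatives of \<open>exp (-1/t)\<close> are polynomials in \<open>1/t\<close> times the function itself, and
  each such function vanishes as \<open>t\<close> tends to 0. Admitting the polynomial factor in the definition
  makes the family closed under differentiation.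
\<close>

definition flat :: "real poly \<Rightarrow> real \<Rightarrow> real" where
  "flat p t = (if 0 < t then poly p (1 / t) * exp (- (1 / t)) else 0)"

definition flat_deriv :: "real poly \<Rightarrow> real poly" where
  "flat_deriv p = [:0, 0, 1:] * (p - pderiv p)"

lemma poly_times_exp_minus_tendsto_0: "((\<lambda>z::real. poly p z * exp (- z)) \<longlongrightarrow> 0) at_top"
proof -
  have "((\<lambda>z. \<Sum>i\<le>degree p. coeff p i * (z ^ i / exp z)) \<longlongrightarrow> (\<Sum>i\<le>degree p. coeff p i * 0)) at_top"
    by (intro tendsto_intros tendsto_power_div_exp_0)
  then show ?thesis
    by (simp add: poly_altdef sum_distrib_right exp_minus divide_inverse mult.assoc)
qed

lemma flat_tendsto_0: "(flat p \<longlongrightarrow> 0) (at 0)"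
proof -
  have "((\<lambda>t::real. poly p (inverse t) * exp (- inverse t)) \<longlongrightarrow> 0) (at_right 0)"
    by (rule filterlim_compose[OF poly_times_exp_minus_tendsto_0 filterlim_inverse_at_top_right])
  then have "(flat p \<longlongrightarrow> 0) (at_right 0)"
    by (rule Lim_transform_eventually) (auto simp: flat_def eventually_at_right_field inverse_eq_divide intro: exI[of _ 1])
  moreover have "(flat p \<longlongrightarrow> 0) (at_left 0)"
    by (rule Lim_transform_eventually[OF tendsto_const])
      (auto simp: flat_def eventually_at_left_field intro: exI[of _ "-1"])
  ultimately show ?thesis by (simp add: filterlim_at_split)
qed

text \<open>
  Only \<open>t = 0\<close> needs an argument: there the difference quotient is again a function of the family,
  with the polynomial multiplied by its variable, so it tends to 0.
\<close>

lemma flat_has_real_derivative: "(flat p has_real_derivative flat (flat_deriv p) t) (at t)"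
proof -
  consider "t > 0" | "t < 0" | "t = 0" by linarith
  then show ?thesis
  proof cases
    case 1
    have "((\<lambda>t. poly p (1 / t) * exp (- (1 / t))) has_real_derivative flat (flat_deriv p) t) (at t)"
      using 1 by (auto intro!: derivative_eq_intros DERIV_chain2[OF poly_DERIV]
          simp: flat_def flat_deriv_def field_simps power2_eq_square)
    then show ?thesis
      by (rule has_field_derivative_transform_within_open[of _ _ _ "{0<..}"]) (use 1 in \<open>auto simp: flat_def\<close>)
  next
    case 2
    have "((\<lambda>t. 0) has_real_derivative flat (flat_deriv p) t) (at t)"
      using 2 by (simp add: flat_def)
    then show ?thesis
      by (rule has_field_derivative_transform_within_open[of _ _ _ "{..<0}"]) (use 2 in \<open>auto simp: flat_def\<close>)
  next
    case 3
    have "flat ([:0, 1:] * p) h = (flat p (0 + h) - flat p 0) / h" for h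
      by (simp add: flat_def field_simps)
    then have "((\<lambda>h. (flat p (0 + h) - flat p 0) / h) \<longlongrightarrow> 0) (at 0)"
      using flat_tendsto_0[of "[:0, 1:] * p"] by presburger
    then show ?thesis using 3 by (simp add: DERIV_def flat_def)
  qed
qed

lemma smooth_flat_affine:
  fixes v :: "'b::euclidean_space"
  shows "smooth_closure UNIV (\<lambda>x. flat p (x \<bullet> v + c))"
  unfolding smooth_closure_def
proof
  fix k
  show "Ck_closure k UNIV (\<lambda>x. flat p (x \<bullet> v + c))"
  proof (induction k arbitrary: p)
    case 0
    have "isCont (flat p) t" for t using flat_has_real_derivative by (rule DERIV_isCont)
    then have "continuous_on UNIV (flat p)" by (simp add: continuous_on_eq_continuous_at)
    then show ?case
      by (auto intro!: continuous_on_compose2[of UNIV "flat p"] continuous_intros)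
  next
    case (Suc k)
    have der: "((\<lambda>x. flat p (x \<bullet> v + c)) has_derivative (\<lambda>b. (b \<bullet> v) * flat (flat_deriv p) (x \<bullet> v + c))) (at x)" for x
    proof -
      have "((\<lambda>x. x \<bullet> v + c) has_derivative (\<lambda>b. b \<bullet> v)) (at x)"
        by (auto intro!: derivative_eq_intros)
      moreover have "(flat p has_derivative (\<lambda>h. h * flat (flat_deriv p) (x \<bullet> v + c))) (at (x \<bullet> v + c))"
        using flat_has_real_derivative[of p "x \<bullet> v + c"]
        by (simp add: has_field_derivative_def mult.commute[of _ "flat _ _"])
      ultimately show ?thesis by (rule has_derivative_compose)
    qed
    have "continuous_on (closure UNIV) (\<lambda>x. flat p (x \<bullet> v + c))"
      using has_derivative_continuous[OF der] by (simp add: continuous_on_eq_continuous_at)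
    then show ?case
      by (rule Ck_closure_SucI[where g = "\<lambda>b x. (b \<bullet> v) * flat (flat_deriv p) (x \<bullet> v + c)"])
        (auto intro: der Ck_closure_cmult Suc.IH)
  qed
qed

lemma flat_1_nonneg_le_1: "0 \<le> flat 1 t" "flat 1 t \<le> 1" and flat_1_pos_iff: "0 < flat 1 t \<longleftrightarrow> 0 < t"
  by (auto simp: flat_def)

definition box_bump :: "'b::euclidean_space \<Rightarrow> 'b \<Rightarrow> 'b \<Rightarrow> real" where
  "box_bump c d x = (\<Prod>b\<in>Basis. flat 1 (x \<bullet> b - c \<bullet> b) * flat 1 (d \<bullet> b - x \<bullet> b))"

lemma smooth_box_bump:
  fixes c d :: "'b::euclidean_space"
  shows "smooth_closure UNIV (box_bump c d)"
  unfolding smooth_closure_def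
proof
  fix k
  have "Ck_closure k UNIV (\<lambda>x. \<Prod>b\<in>Basis. flat 1 (x \<bullet> b + - (c \<bullet> b)) * flat 1 (x \<bullet> (- b) + d \<bullet> b))"
  proof (rule Ck_closure_prod)
    fix b :: 'b
    have "Ck_closure k UNIV (\<lambda>x. flat 1 (x \<bullet> v + t))" for v :: 'b and t
      using smooth_flat_affine[of 1 v t] unfolding smooth_closure_def by blast
    then show "Ck_closure k UNIV (\<lambda>x. flat 1 (x \<bullet> b + - (c \<bullet> b)) * flat 1 (x \<bullet> (- b) + d \<bullet> b))"
      by (intro Ck_closure_mult)
  qed simp
  then show "Ck_closure k UNIV (box_bump c d)"
    by (simp add: box_bump_def[abs_def])
qed

lemma box_bump_range: "0 \<le> box_bump c d x" "box_bump c d x \<le> 1"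
  by (auto simp: box_bump_def intro!: prod_nonneg prod_le_1 mult_nonneg_nonneg mult_le_one flat_1_nonneg_le_1)

lemma box_bump_pos_iff: "0 < box_bump c d x \<longleftrightarrow> x \<in> box c d"
proof -
  let ?f = "\<lambda>b. flat 1 (x \<bullet> b - c \<bullet> b) * flat 1 (d \<bullet> b - x \<bullet> b)"
  have pos: "0 < ?f b \<longleftrightarrow> c \<bullet> b < x \<bullet> b \<and> x \<bullet> b < d \<bullet> b" for b
    using flat_1_nonneg_le_1(1)[of "x \<bullet> b - c \<bullet> b"] by (auto simp: zero_less_mult_iff flat_1_pos_iff)
  have nonneg: "0 \<le> ?f b" for b by (simp add: flat_1_nonneg_le_1(1))
  have "0 < box_bump c d x \<longleftrightarrow> (\<forall>b\<in>Basis. ?f b \<noteq> 0)"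
    using box_bump_range(1)[of c d x] unfolding box_bump_def by (simp add: less_le)
  also have "\<dots> \<longleftrightarrow> (\<forall>b\<in>Basis. 0 < ?f b)" using nonneg by (simp add: less_le)
  also have "\<dots> \<longleftrightarrow> x \<in> box c d" by (simp only: pos mem_box)
  finally show ?thesis .
qed

text \<open>
  Test functions that increase to the indicator of a box: \<open>1 - (1 - \<beta>)\<^sup>n\<close> for a bump \<open>\<beta>\<close> with
  values in \<open>[0, 1]\<close> that is positive exactly on the box.
\<close>

definition box_cutoff :: "'b::euclidean_space \<Rightarrow> 'b \<Rightarrow> nat \<Rightarrow> 'b \<Rightarrow> real" where
  "box_cutoff c d n x = 1 - (1 - box_bump c d x) ^ n"

lemma box_cutoff_range: "0 \<le> box_cutoff c d n x" "box_cutoff c d n x \<le> 1"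
  using box_bump_range[of c d x] by (auto simp: box_cutoff_def intro!: power_le_one)

lemma box_cutoff_eq_0: "x \<notin> box c d \<Longrightarrow> box_cutoff c d n x = 0"
  using box_bump_pos_iff[of c d x] box_bump_range(1)[of c d x]
  by (simp add: box_cutoff_def less_le)

lemma box_cutoff_tendsto: "(\<lambda>n. box_cutoff c d n x) \<longlonglongrightarrow> indicator (box c d) x"
proof (cases "x \<in> box c d")
  case True
  then have "norm (1 - box_bump c d x) < 1"
    using box_bump_pos_iff[of c d x] box_bump_range(2)[of c d x] by simp
  then have "(\<lambda>n. (1 - box_bump c d x) ^ n) \<longlonglongrightarrow> 0"
    by (rule LIMSEQ_power_zero)
  then have "(\<lambda>n. 1 - (1 - box_bump c d x) ^ n) \<longlonglongrightarrow> 1 - 0" by (rule tendsto_diff[OF tendsto_const])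
  then show ?thesis using True by (simp add: box_cutoff_def)
qed (simp add: box_cutoff_eq_0)

lemma box_cutoff_test_function:
  assumes "cbox c d \<subseteq> U"
  shows "box_cutoff c d n \<in> test_functions U"
proof -
  have sub: "closure {x. box_cutoff c d n x \<noteq> 0} \<subseteq> cbox c d"
  proof (rule closure_minimal)
    show "{x. box_cutoff c d n x \<noteq> 0} \<subseteq> cbox c d"
      using box_cutoff_eq_0[of _ c d n] box_subset_cbox[of c d] by blast
  qed (rule closed_cbox)
  then have "compact (closure {x. box_cutoff c d n x \<noteq> 0})"
    by (metis bounded_cbox bounded_subset closed_closure compact_eq_bounded_closed)
  moreover have "smooth_closure UNIV (box_cutoff c d n)"
    using smooth_closure_one_minus_power[OF smooth_box_bump] by (simp add: box_cutoff_def[abs_def])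
  ultimately show ?thesis using sub assms by (auto simp: test_functions_def)
qed

section \<open>Weak gradients\<close>

text \<open>
  Boxes are an intersection-stable generator of the Borel sets, and the sets over which the integral
  vanishes form a Dynkin system.
\<close>

lemma integrals_over_boxes_zero_imp_AE_zero:
  fixes f :: "'b::euclidean_space \<Rightarrow> real"
  assumes f: "integrable lborel f" and zero: "\<And>c d. (LINT x:box c d|lborel. f x) = 0"
  shows "AE x in lborel. f x = 0"
proof (rule density_unique_real)
  let ?I = "\<lambda>A. LINT x:A|lborel. f x"
  have int: "set_integrable lborel A f" if "A \<in> sets borel" for A
    unfolding set_integrable_def using f that by (intro integrable_mult_indicator) auto
  have UNIV: "?I UNIV = 0"
  proof -
    let ?A = "\<lambda>n::nat. box (- (real n *\<^sub>R One)) (real n *\<^sub>R One) :: 'b set"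
    have "(\<lambda>n. ?I (?A n)) \<longlonglongrightarrow> ?I (\<Union>n. ?A n)"
    proof (rule set_integral_cont_up)
      show "incseq ?A"
        by (intro monoI) (fastforce simp: mem_box)
    qed (unfold UN_box_eq_UNIV, auto intro: int)
    then show ?thesis unfolding UN_box_eq_UNIV zero by (simp add: LIMSEQ_const_iff)
  qed
  show "?I A = (LINT x:A|lborel. 0)" if "A \<in> sets lborel" for A
  proof -
    let ?G = "range (\<lambda>(c, d). box c d :: 'b set)"
    have "Int_stable ?G" by (auto simp: Int_stable_def box_Int_box)
    moreover have "?G \<subseteq> Pow UNIV" by simp
    moreover have "A \<in> sigma_sets UNIV ?G" using that by (simp add: borel_eq_box)
    ultimately have "?I A = 0"
    proof (induction rule: sigma_sets_induct_disjoint)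
      case (compl A)
      then have A: "A \<in> sets borel" by (simp add: borel_eq_box)
      then have "?I (A \<union> (UNIV - A)) = ?I A + ?I (UNIV - A)"
        by (intro set_integral_Un int) auto
      then show ?case using compl UNIV by simp
    next
      case (union A)
      then have A: "A n \<in> sets borel" for n by (auto simp: borel_eq_box)
      have "?I (\<Union>n. A n) = (\<Sum>n. ?I (A n))"
      proof (rule lebesgue_integral_countable_add)
        show "A i \<inter> A j = {}" if "i \<noteq> j" for i j
          using union(1) that by (simp add: disjoint_family_on_def)
      qed (use A int in auto)
      then show ?case using union by simp
    qed (auto simp: zero, simp add: set_lebesgue_integral_def)
    then show ?thesis by simp
  qed
qed (use f in auto)

lemma set_lebesgue_integral_lebesgue_on:
  "U \<in> sets lebesgue \<Longrightarrow> (LINT x:U|lebesgue. f x) = integral\<^sup>L (lebesgue_on U) f" for f :: "_ \<Rightarrow> real"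
  by (simp add: set_lebesgue_integral_def integral_restrict_space)

lemma set_integrable_lebesgue_on:
  "U \<in> sets lebesgue \<Longrightarrow> set_integrable lebesgue U f \<longleftrightarrow> integrable (lebesgue_on U) f" for f :: "_ \<Rightarrow> real"
  by (simp add: set_integrable_def integrable_restrict_space)

lemma L1_loc_add: "L1_loc U f \<Longrightarrow> L1_loc U g \<Longrightarrow> L1_loc U (\<lambda>x. f x + g x)"
  by (auto simp: L1_loc_def)

lemma L1_loc_cmult: "L1_loc U f \<Longrightarrow> L1_loc U (\<lambda>x. c * f x)"
  by (auto simp: L1_loc_def)

text \<open>
  Local integrability gives measurability on compact subsets only, and an exhaustion by these gives it
  on the whole open set.
\<close>

lemma L1_loc_measurable:
  fixes f :: "'b::euclidean_space \<Rightarrow> real"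
  assumes "open U" and f: "L1_loc U f"
  shows "f \<in> borel_measurable (lebesgue_on U)"
proof -
  obtain C where C: "\<And>n::nat. compact (C n)" "\<And>n. C n \<subseteq> U"
    "\<And>K. \<lbrakk>compact K; K \<subseteq> U\<rbrakk> \<Longrightarrow> \<exists>N. \<forall>n\<ge>N. K \<subseteq> C n"
    using open_Union_compact_subsets[OF \<open>open U\<close>] by metis
  have "(\<lambda>x. indicat_real U x *\<^sub>R f x) \<in> borel_measurable lebesgue"
  proof (rule borel_measurable_LIMSEQ_real)
    show "(\<lambda>x. indicat_real (C n) x *\<^sub>R f x) \<in> borel_measurable lebesgue" for n
      using f C(1,2)[of n] by (auto simp: L1_loc_def set_integrable_def)
    show "(\<lambda>n. indicat_real (C n) x *\<^sub>R f x) \<longlonglongrightarrow> indicat_real U x *\<^sub>R f x" for x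
    proof (cases "x \<in> U")
      case True
      then obtain N where "\<forall>n\<ge>N. {x} \<subseteq> C n" using C(3)[of "{x}"] by auto
      then have "\<forall>\<^sub>F n in sequentially. indicat_real U x *\<^sub>R f x = indicat_real (C n) x *\<^sub>R f x"
        using True by (intro eventually_sequentiallyI[of N]) auto
      then show ?thesis by (rule Lim_transform_eventually[OF tendsto_const])
    next
      case False
      then have "x \<notin> C n" for n using C(2)[of n] by blast
      then show ?thesis using False by (simp add: indicator_def)
    qed
  qed
  then show ?thesis using \<open>open U\<close> by (simp add: borel_measurable_restrict_space_iff)
qed

lemma test_function_continuous: "\<phi> \<in> test_functions U \<Longrightarrow> continuous_on UNIV \<phi>"
  using Ck_closure_continuous[of 0 UNIV \<phi>] by (simp add: test_functions_def smooth_closure_def)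

lemma test_function_has_derivative:
  assumes "\<phi> \<in> test_functions U"
  shows "(\<phi> has_derivative frechet_derivative \<phi> (at x)) (at x)"
proof -
  have "Ck_closure (Suc 0) UNIV \<phi>" using assms by (simp add: test_functions_def smooth_closure_def)
  then show ?thesis by (simp add: frechet_derivative_works)
qed

lemma test_function_derivative_continuous:
  assumes "\<phi> \<in> test_functions U" "b \<in> Basis"
  shows "continuous_on UNIV (\<lambda>x. frechet_derivative \<phi> (at x) b)"
proof -
  have "Ck_closure (Suc 0) UNIV \<phi>" using assms by (simp add: test_functions_def smooth_closure_def)
  then obtain g where g: "continuous_on UNIV g" "\<And>x. g x = frechet_derivative \<phi> (at x) b"
    using assms(2) by auto
  from g(1) show ?thesis unfolding g(2) .
qed

lemma test_function_derivative_support: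
  assumes "\<phi> \<in> test_functions U" "x \<notin> closure {x. \<phi> x \<noteq> 0}"
  shows "frechet_derivative \<phi> (at x) b = 0"
proof -
  have "((\<lambda>_. 0) has_derivative (\<lambda>_. 0)) (at x)" by simp
  then have "(\<phi> has_derivative (\<lambda>_. 0)) (at x)"
    by (rule has_derivative_transform_within_open[of _ _ _ _ "- closure {x. \<phi> x \<noteq> 0}"])
      (use assms closure_subset[of "{x. \<phi> x \<noteq> 0}"] in auto)
  from frechet_derivative_at[OF this] show ?thesis by metis
qed

text \<open>
  Every pairing in the definition of the weak gradient is of this kind, so that sums under the
  integral sign may be split.
\<close>

lemma L1_loc_times_continuous_integrable:
  fixes f \<phi> :: "'b::euclidean_space \<Rightarrow> real"
  assumes f: "L1_loc U f" and U: "open U" and K: "compact K" "K \<subseteq> U"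
    and \<phi>: "continuous_on UNIV \<phi>" "\<And>x. x \<notin> K \<Longrightarrow> \<phi> x = 0"
  shows "set_integrable lebesgue U (\<lambda>x. f x * \<phi> x)"
proof -
  have "compact (\<phi> ` K)" using K \<phi>(1) by (intro compact_continuous_image) (auto intro: continuous_on_subset)
  then obtain B where B: "\<And>x. x \<in> K \<Longrightarrow> \<bar>\<phi> x\<bar> \<le> B"
    by (metis bounded_iff compact_imp_bounded imageI real_norm_def)
  have [measurable]: "\<phi> \<in> borel_measurable lebesgue"
    using \<phi>(1) by (intro measurable_completion) (simp add: borel_measurable_continuous_onI)
  have int: "integrable lebesgue (\<lambda>x. indicat_real K x *\<^sub>R f x)"
    using f K by (auto simp: L1_loc_def set_integrable_def)
  have "integrable lebesgue (\<lambda>x. \<phi> x * (indicat_real K x *\<^sub>R f x))"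
  proof (rule Bochner_Integration.integrable_bound)
    show "integrable lebesgue (\<lambda>x. B * (indicat_real K x *\<^sub>R f x))" using int by simp
    show "AE x in lebesgue. norm (\<phi> x * (indicat_real K x *\<^sub>R f x)) \<le> norm (B * (indicat_real K x *\<^sub>R f x))"
      using B by (intro AE_I2) (auto simp: abs_mult indicator_def intro!: mult_right_mono order_trans[OF B])
  qed (use int in measurable)
  moreover have eq: "\<phi> x * (indicat_real K x *\<^sub>R f x) = indicat_real U x *\<^sub>R (f x * \<phi> x)" for x
    using K \<phi>(2) by (auto simp: indicator_def)
  ultimately show ?thesis unfolding set_integrable_def by (simp only: eq)
qed

lemma L1_loc_times_test_function_integrable:
  assumes "open U" "L1_loc U f" "\<phi> \<in> test_functions U"
  shows "set_integrable lebesgue U (\<lambda>x. f x * \<phi> x)"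
proof (rule L1_loc_times_continuous_integrable[where K = "closure {x. \<phi> x \<noteq> 0}"])
  show "\<phi> x = 0" if "x \<notin> closure {x. \<phi> x \<noteq> 0}" for x
    using that closure_subset[of "{x. \<phi> x \<noteq> 0}"] by auto
qed (use assms test_function_continuous[OF assms(3)] in \<open>simp_all add: test_functions_def\<close>)

lemma L1_loc_times_test_function_derivative_integrable:
  assumes "open U" "L1_loc U f" "\<phi> \<in> test_functions U" "b \<in> Basis"
  shows "set_integrable lebesgue U (\<lambda>x. f x * frechet_derivative \<phi> (at x) b)"
proof (rule L1_loc_times_continuous_integrable[where K = "closure {x. \<phi> x \<noteq> 0}"])
  show "continuous_on UNIV (\<lambda>x. frechet_derivative \<phi> (at x) b)"
    by (rule test_function_derivative_continuous[OF assms(3,4)])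
  show "frechet_derivative \<phi> (at x) b = 0" if "x \<notin> closure {x. \<phi> x \<noteq> 0}" for x
    by (rule test_function_derivative_support[OF assms(3) that])
qed (use assms in \<open>simp_all add: test_functions_def\<close>)

text \<open>
  The fundamental lemma of the calculus of variations. The cut-offs of a box are test functions that
  converge to its indicator, so the integral over every box in the domain vanishes.
\<close>

lemma fundamental_lemma:
  fixes f :: "'b::euclidean_space \<Rightarrow> real"
  assumes U: "open U" and f: "L1_loc U f"
    and zero: "\<And>\<phi>. \<phi> \<in> test_functions U \<Longrightarrow> (LINT x:U|lebesgue. f x * \<phi> x) = 0"
  shows "AE x in lebesgue_on U. f x = 0"
proof -
  have box_zero: "(LINT x:box c d|lebesgue. f x) = 0" if sub: "cbox c d \<subseteq> U" for c d
  proof -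
    have int: "integrable lebesgue (\<lambda>x. indicat_real (cbox c d) x *\<^sub>R f x)"
      using f sub by (auto simp: L1_loc_def set_integrable_def)
    have [measurable]: "box_cutoff c d n \<in> borel_measurable lebesgue" for n
      using test_function_continuous[OF box_cutoff_test_function[OF sub]]
      by (intro measurable_completion) (simp add: borel_measurable_continuous_onI)
    have "(\<lambda>n. LINT x|lebesgue. box_cutoff c d n x * (indicat_real (cbox c d) x *\<^sub>R f x))
      \<longlonglongrightarrow> (LINT x|lebesgue. indicat_real (box c d) x * (indicat_real (cbox c d) x *\<^sub>R f x))"
    proof (rule integral_dominated_convergence[where w = "\<lambda>x. \<bar>indicat_real (cbox c d) x *\<^sub>R f x\<bar>"])
      show "AE x in lebesgue. (\<lambda>n. box_cutoff c d n x * (indicat_real (cbox c d) x *\<^sub>R f x))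
          \<longlonglongrightarrow> indicat_real (box c d) x * (indicat_real (cbox c d) x *\<^sub>R f x)"
        by (intro AE_I2 tendsto_intros box_cutoff_tendsto)
      show "AE x in lebesgue. norm (box_cutoff c d n x * (indicat_real (cbox c d) x *\<^sub>R f x))
          \<le> \<bar>indicat_real (cbox c d) x *\<^sub>R f x\<bar>" for n
        using box_cutoff_range[of c d n] by (intro AE_I2) (auto simp: abs_mult mult_left_le_one_le)
      show "(\<lambda>x. indicat_real (box c d) x * (indicat_real (cbox c d) x *\<^sub>R f x)) \<in> borel_measurable lebesgue"
        using int by (intro borel_measurable_times borel_measurable_indicator) (auto dest: borel_measurable_integrable)
      show "(\<lambda>x. box_cutoff c d n x * (indicat_real (cbox c d) x *\<^sub>R f x)) \<in> borel_measurable lebesgue" for n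
        using int by (intro borel_measurable_times) (auto dest: borel_measurable_integrable)
    qed (use int in simp)
    moreover have eq1: "box_cutoff c d n x * (indicat_real (cbox c d) x *\<^sub>R f x)
        = indicat_real U x *\<^sub>R (f x * box_cutoff c d n x)" for n x
      using sub box_cutoff_eq_0[of x c d n] box_subset_cbox[of c d] by (auto simp: indicator_def)
    moreover have eq2: "(LINT x|lebesgue. indicat_real U x *\<^sub>R (f x * box_cutoff c d n x)) = 0" for n
      using zero[OF box_cutoff_test_function[OF sub]] by (simp add: set_lebesgue_integral_def)
    moreover have eq3: "indicat_real (box c d) x * (indicat_real (cbox c d) x *\<^sub>R f x)
        = indicat_real (box c d) x *\<^sub>R f x" for x
      using box_subset_cbox[of c d] by (auto simp: indicator_def)
    ultimately show ?thesis
      unfolding eq1 eq2 eq3 LIMSEQ_const_iff set_lebesgue_integral_def by simp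
  qed
  have AE_box: "AE x in lebesgue. x \<in> cbox a b \<longrightarrow> f x = 0" if sub: "cbox a b \<subseteq> U" for a b
  proof -
    let ?f = "\<lambda>x. indicat_real (box a b) x *\<^sub>R f x"
    have "set_integrable lebesgue (box a b) f"
    proof (rule set_integrable_subset)
      show "set_integrable lebesgue (cbox a b) f" using f sub by (simp add: L1_loc_def)
    qed (use box_subset_cbox[of a b] in simp_all)
    then have int: "integrable lebesgue ?f" by (simp add: set_integrable_def)
    then obtain g where g[measurable]: "g \<in> borel_measurable lborel" and eq: "AE x in lborel. ?f x = g x"
      using completion_ex_borel_measurable_real[of ?f lborel] by auto
    have eq': "AE x in lebesgue. ?f x = g x" using eq by (rule AE_completion)
    have "integrable lebesgue g"
      using int eq' by (subst integrable_cong_AE[of g lebesgue ?f]) (auto intro: measurable_completion)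
    then have g_int: "integrable lborel g" by (simp add: integrable_completion)
    have "AE x in lborel. g x = 0"
    proof (rule integrals_over_boxes_zero_imp_AE_zero[OF g_int])
      fix c d :: 'b
      obtain c' d' where cd: "box c d \<inter> box a b = box c' d'" by (simp add: box_Int_box)
      have "(LINT x:box c d|lborel. g x) = (LINT x|lebesgue. indicat_real (box c d) x *\<^sub>R g x)"
        by (simp add: set_lebesgue_integral_def integral_completion)
      also have "\<dots> = (LINT x|lebesgue. indicat_real (box c d) x *\<^sub>R ?f x)"
      proof (rule integral_cong_AE)
        show "(\<lambda>x. indicat_real (box c d) x *\<^sub>R ?f x) \<in> borel_measurable lebesgue"
          by (rule borel_measurable_integrable[OF integrable_mult_indicator[OF _ int]]) simp
        show "AE x in lebesgue. indicat_real (box c d) x *\<^sub>R g x = indicat_real (box c d) x *\<^sub>R ?f x"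
          using eq' by eventually_elim simp
      qed (auto intro: measurable_completion)
      also have "\<dots> = (LINT x:box c' d'|lebesgue. f x)"
        by (simp add: set_lebesgue_integral_def cd[symmetric] indicator_inter_arith mult.assoc)
      also have "\<dots> = 0"
      proof (cases "box c' d' = {}")
        case False
        then have "cbox c' d' = closure (box c' d')" by simp
        also have "\<dots> \<subseteq> cbox a b"
          using cd box_subset_cbox[of a b] by (intro closure_minimal) auto
        finally show ?thesis using sub by (intro box_zero) simp
      qed (simp add: set_lebesgue_integral_def)
      finally show "(LINT x:box c d|lborel. g x) = 0" .
    qed
    then have "AE x in lebesgue. g x = 0" by (rule AE_completion)
    \<comment> \<open>The intersection of two open boxes is an open box, whence the passage to the interior; the faces
      of the closed box that this leaves out are null.\<close>
    moreover have "AE x in lebesgue. x \<notin> cbox a b - box a b"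
      by (rule AE_not_in) (simp add: negligible_frontier_interval negligible_iff_null_sets[symmetric])
    ultimately show ?thesis using eq' by eventually_elim (auto simp: indicator_def split: if_splits)
  qed
  obtain \<D> where \<D>: "countable \<D>" "\<D> \<subseteq> Pow U" "\<And>X. X \<in> \<D> \<Longrightarrow> \<exists>a b. X = cbox a b" "\<Union>\<D> = U"
    using open_countable_Union_open_cbox[OF U] by metis
  have "AE x in lebesgue. \<forall>X\<in>\<D>. x \<in> X \<longrightarrow> f x = 0"
    using \<D> AE_box by (subst AE_ball_countable) (auto, blast)
  then have "AE x in lebesgue. x \<in> U \<longrightarrow> f x = 0" by eventually_elim (use \<D>(4) in blast)
  then show ?thesis using U by (simp add: AE_restrict_space_iff)
qed

lemma has_weak_gradientD:
  assumes "has_weak_gradient U u g"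
  shows "L1_loc U u"
    and "b \<in> Basis \<Longrightarrow> L1_loc U (\<lambda>x. g x \<bullet> b)"
    and "b \<in> Basis \<Longrightarrow> \<phi> \<in> test_functions U \<Longrightarrow>
      (LINT x:U|lebesgue. u x * frechet_derivative \<phi> (at x) b) = - (LINT x:U|lebesgue. (g x \<bullet> b) * \<phi> x)"
  using assms unfolding has_weak_gradient_def by blast+

lemma has_weak_gradient_measurable:
  assumes "open U" "has_weak_gradient U u g"
  shows "u \<in> borel_measurable (lebesgue_on U)" "g \<in> borel_measurable (lebesgue_on U)"
proof -
  show "u \<in> borel_measurable (lebesgue_on U)"
    by (rule L1_loc_measurable[OF assms(1) has_weak_gradientD(1)[OF assms(2)]])
  have "(\<lambda>x. g x \<bullet> b) \<in> borel_measurable (lebesgue_on U)" if "b \<in> Basis" for b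
    by (rule L1_loc_measurable[OF assms(1) has_weak_gradientD(2)[OF assms(2) that]])
  then show "g \<in> borel_measurable (lebesgue_on U)"
    unfolding borel_measurable_euclidean_space[of g] by blast
qed

lemma has_weak_gradient_unique:
  assumes U: "open U" and g: "has_weak_gradient U u g" and h: "has_weak_gradient U u h"
  shows "AE x in lebesgue_on U. g x = h x"
proof -
  have "AE x in lebesgue_on U. g x \<bullet> b + (-1) * (h x \<bullet> b) = 0" if b: "b \<in> Basis" for b
  proof (rule fundamental_lemma[OF U])
    have loc: "L1_loc U (\<lambda>x. g x \<bullet> b)" "L1_loc U (\<lambda>x. h x \<bullet> b)"
      by (rule has_weak_gradientD(2)[OF g b] has_weak_gradientD(2)[OF h b])+
    then show "L1_loc U (\<lambda>x. g x \<bullet> b + (-1) * (h x \<bullet> b))" by (intro L1_loc_add L1_loc_cmult)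
    fix \<phi> assume \<phi>: "\<phi> \<in> test_functions U"
    have "set_integrable lebesgue U (\<lambda>x. (g x \<bullet> b) * \<phi> x)" "set_integrable lebesgue U (\<lambda>x. (h x \<bullet> b) * \<phi> x)"
      by (rule L1_loc_times_test_function_integrable[OF U _ \<phi>], rule loc)+
    then have "(LINT x:U|lebesgue. (g x \<bullet> b) * \<phi> x - (h x \<bullet> b) * \<phi> x) =
      (LINT x:U|lebesgue. (g x \<bullet> b) * \<phi> x) - (LINT x:U|lebesgue. (h x \<bullet> b) * \<phi> x)"
      by (rule set_integral_diff)
    moreover have "(LINT x:U|lebesgue. (g x \<bullet> b) * \<phi> x) = (LINT x:U|lebesgue. (h x \<bullet> b) * \<phi> x)"
    proof -
      have "- (LINT x:U|lebesgue. (g x \<bullet> b) * \<phi> x) = - (LINT x:U|lebesgue. (h x \<bullet> b) * \<phi> x)"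
        by (rule trans[OF has_weak_gradientD(3)[OF g b \<phi>, symmetric] has_weak_gradientD(3)[OF h b \<phi>]])
      then show ?thesis by linarith
    qed
    ultimately show "(LINT x:U|lebesgue. (g x \<bullet> b + (-1) * (h x \<bullet> b)) * \<phi> x) = 0"
      by (simp add: algebra_simps)
  qed
  then have "AE x in lebesgue_on U. \<forall>b\<in>Basis. g x \<bullet> b + (-1) * (h x \<bullet> b) = 0"
    by (simp add: AE_ball_countable countable_finite)
  then show ?thesis by eventually_elim (auto intro: euclidean_eqI)
qed

lemma weak_gradient_eq:
  assumes "open U" "has_weak_gradient U u g"
  shows "AE x in lebesgue_on U. weak_gradient U u x = g x"
  unfolding weak_gradient_def
  by (rule has_weak_gradient_unique[OF assms(1) someI[of "has_weak_gradient U u"] assms(2)]) (rule assms(2))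

lemma has_weak_gradient_weak_gradient:
  "(\<exists>g. has_weak_gradient U u g) \<Longrightarrow> has_weak_gradient U u (weak_gradient U u)"
  using someI_ex[of "has_weak_gradient U u"] by (simp only: weak_gradient_def)

lemma has_weak_gradient_lin:
  assumes U: "open U" and u: "has_weak_gradient U u g" and v: "has_weak_gradient U v h"
  shows "has_weak_gradient U (\<lambda>x. u x + c * v x) (\<lambda>x. g x + c *\<^sub>R h x)"
  unfolding has_weak_gradient_def
proof (intro conjI ballI)
  show "L1_loc U (\<lambda>x. u x + c * v x)"
    by (intro L1_loc_add L1_loc_cmult has_weak_gradientD(1)[OF u] has_weak_gradientD(1)[OF v])
  fix b :: 'a assume b: "b \<in> Basis"
  have loc: "L1_loc U u" "L1_loc U v" "L1_loc U (\<lambda>x. g x \<bullet> b)" "L1_loc U (\<lambda>x. h x \<bullet> b)"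
    by (rule has_weak_gradientD(1)[OF u] has_weak_gradientD(1)[OF v] has_weak_gradientD(2)[OF u b] has_weak_gradientD(2)[OF v b])+
  show "L1_loc U (\<lambda>x. (g x + c *\<^sub>R h x) \<bullet> b)"
    unfolding inner_add_left inner_scaleR_left by (intro L1_loc_add L1_loc_cmult loc)
  fix \<phi> assume \<phi>: "\<phi> \<in> test_functions U"
  note i1 = L1_loc_times_test_function_integrable[OF U _ \<phi>]
  note i2 = L1_loc_times_test_function_derivative_integrable[OF U _ \<phi> b]
  have "(LINT x:U|lebesgue. (u x + c * v x) * frechet_derivative \<phi> (at x) b) =
      (LINT x:U|lebesgue. u x * frechet_derivative \<phi> (at x) b) + c * (LINT x:U|lebesgue. v x * frechet_derivative \<phi> (at x) b)"
    using i2[OF loc(1)] i2[OF loc(2)] by (simp add: distrib_right mult.assoc)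
  also have "\<dots> = - ((LINT x:U|lebesgue. (g x \<bullet> b) * \<phi> x) + c * (LINT x:U|lebesgue. (h x \<bullet> b) * \<phi> x))"
    by (simp add: has_weak_gradientD(3)[OF u b \<phi>] has_weak_gradientD(3)[OF v b \<phi>])
  also have "\<dots> = - (LINT x:U|lebesgue. ((g x + c *\<^sub>R h x) \<bullet> b) * \<phi> x)"
    using i1[OF loc(3)] i1[OF loc(4)] by (simp add: inner_add_left distrib_right mult.assoc)
  finally show "(LINT x:U|lebesgue. (u x + c * v x) * frechet_derivative \<phi> (at x) b) =
      - (LINT x:U|lebesgue. ((g x + c *\<^sub>R h x) \<bullet> b) * \<phi> x)" .
qed

section \<open>Classical derivatives as weak derivatives\<close>

text \<open>
  By translation invariance the difference quotients of a compactly supported function have integral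
  zero; they converge boundedly to the directional derivative.
\<close>

lemma integral_directional_derivative_zero:
  fixes f D :: "'b::euclidean_space \<Rightarrow> real"
  assumes der: "\<And>x. ((\<lambda>t. f (x + t *\<^sub>R b)) has_real_derivative D x) (at 0)"
    and D: "continuous_on UNIV D" and f: "continuous_on UNIV f"
    and K: "compact K" "\<And>x. x \<notin> K \<Longrightarrow> f x = 0"
  shows "integrable lborel D" "(LINT x|lborel. D x) = 0"
proof -
  have [measurable]: "D \<in> borel_measurable borel" "f \<in> borel_measurable borel"
    using D f by (auto intro: borel_measurable_continuous_onI)
  have D_supp: "D x = 0" if "x \<notin> K" for x
  proof -
    have op: "open ((\<lambda>t. x + t *\<^sub>R b) -` (- K))"
      using K(1) by (intro open_vimage) (auto intro!: continuous_intros simp: open_Compl compact_imp_closed)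
    have "((\<lambda>t. 0) has_real_derivative 0) (at 0)" by simp
    then have "((\<lambda>t. f (x + t *\<^sub>R b)) has_real_derivative 0) (at 0)"
      by (rule has_field_derivative_transform_within_open[OF _ op]) (use that K(2) in auto)
    with der[of x] show ?thesis by (rule DERIV_unique)
  qed
  have int: "integrable lborel h" if "continuous_on UNIV h" "\<And>x. x \<notin> K \<Longrightarrow> h x = 0" for h :: "'b \<Rightarrow> real"
  proof -
    have "integrable lborel (\<lambda>x. indicat_real K x *\<^sub>R h x)"
      using K(1) that(1) by (intro borel_integrable_compact) (auto intro: continuous_on_subset)
    also have "(\<lambda>x. indicat_real K x *\<^sub>R h x) = h"
    proof
      show "indicat_real K x *\<^sub>R h x = h x" for x
        using that(2)[of x] by (cases "x \<in> K") auto
    qed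
    finally show ?thesis .
  qed
  show "integrable lborel D" by (rule int[OF D D_supp])
  have "bounded (D ` K)"
    using K(1) D by (intro compact_imp_bounded compact_continuous_image) (auto intro: continuous_on_subset)
  then obtain B where "\<And>x. x \<in> K \<Longrightarrow> \<bar>D x\<bar> \<le> B" by (metis bounded_iff imageI real_norm_def)
  then have B: "\<bar>D x\<bar> \<le> \<bar>B\<bar>" for x using D_supp[of x] by (cases "x \<in> K") force+
  \<comment> \<open>A compact set that contains the supports of all the difference quotients with step at most 1.\<close>
  define K' where "K' = (\<lambda>(x, s). x - s *\<^sub>R b) ` (K \<times> {0..1})"
  have K': "compact K'"
    unfolding K'_def split_def using K(1)
    by (intro compact_continuous_image compact_Times) (auto intro!: continuous_intros)
  define t where "t n = 1 / real (Suc n)" for n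
  have t: "0 < t n" "t n \<le> 1" for n by (auto simp: t_def)
  have t_lim: "t \<longlonglongrightarrow> 0" unfolding t_def by (rule LIMSEQ_Suc[OF lim_1_over_n])
  define q where "q n x = (f (x + t n *\<^sub>R b) - f x) / t n" for n x
  have [measurable]: "q n \<in> borel_measurable borel" for n unfolding q_def by measurable
  have q_int: "(LINT x|lborel. q n x) = 0" for n
  proof -
    have shift: "integrable lborel (\<lambda>x. f (x + t n *\<^sub>R b))"
      "(LINT x|lborel. f (x + t n *\<^sub>R b)) = (LINT x|lborel. f x)"
    proof -
      have "integrable (distr lborel borel ((+) (t n *\<^sub>R b))) f"
        using int[OF f K(2)] by (simp add: lborel_distr_plus)
      then show "integrable lborel (\<lambda>x. f (x + t n *\<^sub>R b))"
        by (subst (asm) integrable_distr_eq) (auto simp: add.commute)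
      have "(LINT x|lborel. f x) = (LINT x|distr lborel borel ((+) (t n *\<^sub>R b)). f x)"
        by (simp add: lborel_distr_plus)
      then show "(LINT x|lborel. f (x + t n *\<^sub>R b)) = (LINT x|lborel. f x)"
        by (simp add: integral_distr add.commute)
    qed
    then show ?thesis using int[OF f K(2)] by (simp add: q_def)
  qed
  have "(\<lambda>n. LINT x|lborel. q n x) \<longlonglongrightarrow> (LINT x|lborel. D x)"
  proof (rule integral_dominated_convergence[where w = "\<lambda>x. indicat_real K' x *\<^sub>R \<bar>B\<bar>"])
    show "integrable lborel (\<lambda>x. indicat_real K' x *\<^sub>R \<bar>B\<bar>)"
      by (rule borel_integrable_compact[OF K' continuous_on_const])
    show "AE x in lborel. (\<lambda>n. q n x) \<longlonglongrightarrow> D x"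
    proof (rule AE_I2)
      fix x
      have "((\<lambda>h. (f (x + h *\<^sub>R b) - f x) / h) \<longlongrightarrow> D x) (at 0)"
        using der[of x] by (simp add: DERIV_def)
      moreover have "filterlim t (at 0) sequentially"
        using t_lim t(1) by (simp add: filterlim_at less_imp_neq[symmetric])
      ultimately show "(\<lambda>n. q n x) \<longlonglongrightarrow> D x"
        unfolding q_def by (rule filterlim_compose)
    qed
    have "\<bar>q n x\<bar> \<le> indicat_real K' x * \<bar>B\<bar>" for n x
    proof -
      have line: "((\<lambda>t. f (x + t *\<^sub>R b)) has_real_derivative D (x + s *\<^sub>R b)) (at s)" for s
        using der[of "x + s *\<^sub>R b"] DERIV_shift[of "\<lambda>t. f (x + t *\<^sub>R b)" "D (x + s *\<^sub>R b)" 0 s]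
        by (simp add: scaleR_add_left add.commute add.left_commute)
      obtain z where z: "0 < z" "z < t n" "f (x + t n *\<^sub>R b) - f (x + 0 *\<^sub>R b) = (t n - 0) * D (x + z *\<^sub>R b)"
        using MVT2[of 0 "t n" "\<lambda>t. f (x + t *\<^sub>R b)" "\<lambda>s. D (x + s *\<^sub>R b)", OF t(1) line] by auto
      then have q: "q n x = D (x + z *\<^sub>R b)" using t(1)[of n] by (simp add: q_def)
      show ?thesis
      proof (cases "x \<in> K'")
        case False
        have "x + z *\<^sub>R b \<notin> K"
        proof
          assume "x + z *\<^sub>R b \<in> K"
          then have "(x + z *\<^sub>R b) - z *\<^sub>R b \<in> K'"
            unfolding K'_def using z t(2)[of n] by (intro image_eqI[of _ _ "(x + z *\<^sub>R b, z)"]) auto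
          with False show False by simp
        qed
        then show ?thesis using q D_supp by simp
      qed (use q B in simp)
    qed
    then show "AE x in lborel. norm (q n x) \<le> indicat_real K' x *\<^sub>R \<bar>B\<bar>" for n by simp
  qed simp_all
  then show "(LINT x|lborel. D x) = 0" by (simp add: q_int LIMSEQ_const_iff)
qed

lemma L1_loc_continuous:
  assumes "continuous_on U f"
  shows "L1_loc U f"
  unfolding L1_loc_def
proof (intro allI impI)
  fix K assume K: "compact K \<and> K \<subseteq> U"
  then have "integrable lborel (\<lambda>x. indicat_real K x *\<^sub>R f x)"
    using assms by (intro borel_integrable_compact) (auto intro: continuous_on_subset)
  then show "set_integrable lebesgue K f"
    by (simp add: set_integrable_def integrable_completion borel_measurable_integrable)
qed

text \<open>
  Extended by zero, \<open>u \<phi>\<close> is continuously differentiable along \<open>b\<close> on the whole space with compact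
  support, although \<open>u\<close> itself is only controlled in \<open>U\<close>. So its derivative has integral zero.
\<close>

lemma integration_by_parts_test_function:
  fixes u D :: "'b::euclidean_space \<Rightarrow> real"
  assumes U: "open U" and b: "b \<in> Basis" and u: "continuous_on U u" and D: "continuous_on U D"
    and der: "\<And>x. x \<in> U \<Longrightarrow> ((\<lambda>t. u (x + t *\<^sub>R b)) has_real_derivative D x) (at 0)"
    and \<phi>: "\<phi> \<in> test_functions U"
  shows "(LINT x:U|lebesgue. u x * frechet_derivative \<phi> (at x) b) = - (LINT x:U|lebesgue. D x * \<phi> x)"
proof -
  define K where "K = closure {x. \<phi> x \<noteq> 0}"
  define d where "d x = frechet_derivative \<phi> (at x) b" for x
  have K: "compact K" "K \<subseteq> U" and \<phi>0: "\<And>x. x \<notin> K \<Longrightarrow> \<phi> x = 0"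
    using \<phi> closure_subset[of "{x. \<phi> x \<noteq> 0}"] by (auto simp: test_functions_def K_def)
  have d0: "d x = 0" if "x \<notin> K" for x
    using test_function_derivative_support[OF \<phi>] that by (simp add: K_def d_def)
  have cont: "continuous_on UNIV \<phi>" "continuous_on UNIV d"
    using test_function_continuous[OF \<phi>] test_function_derivative_continuous[OF \<phi> b] by (simp_all add: d_def[abs_def])
  define f where "f x = (if x \<in> U then u x * \<phi> x else 0)" for x
  define F where "F x = (if x \<in> U then D x * \<phi> x + u x * d x else 0)" for x
  have ext: "continuous_on UNIV h" if "continuous_on U h" "\<And>x. x \<notin> K \<Longrightarrow> h x = 0" for h :: "'b \<Rightarrow> real"
  proof -
    have "continuous_on (- K) h"
      using that(2) by (subst continuous_on_cong[of "- K" "- K" h "\<lambda>_. 0"]) auto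
    then have "continuous_on (U \<union> - K) h"
      using U K that(1) by (intro continuous_on_open_Un) (auto simp: open_Compl compact_imp_closed)
    moreover have "U \<union> - K = UNIV" using K by auto
    ultimately show ?thesis by simp
  qed
  have f_cont: "continuous_on UNIV f"
  proof (rule ext)
    have "continuous_on U (\<lambda>x. u x * \<phi> x)"
      by (intro continuous_on_mult u continuous_on_subset[OF cont(1)]) auto
    then show "continuous_on U f" by (simp add: f_def cong: continuous_on_cong)
  qed (simp add: f_def \<phi>0)
  have F_cont: "continuous_on UNIV F"
  proof (rule ext)
    have "continuous_on U (\<lambda>x. D x * \<phi> x + u x * d x)"
      by (intro continuous_on_add continuous_on_mult u D continuous_on_subset[OF cont(1)]
          continuous_on_subset[OF cont(2)]) auto
    then show "continuous_on U F" by (simp add: F_def cong: continuous_on_cong)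
  qed (simp add: F_def \<phi>0 d0)
  have line_open: "open ((\<lambda>t. x + t *\<^sub>R b) -` S)" if "open S" for x and S :: "'b set"
    using that by (intro open_vimage) (auto intro!: continuous_intros)
  have f_der: "((\<lambda>t. f (x + t *\<^sub>R b)) has_real_derivative F x) (at 0)" for x
  proof (cases "x \<in> U")
    case True
    have "((\<lambda>t. x + t *\<^sub>R b) has_derivative (\<lambda>t. t *\<^sub>R b)) (at 0)"
      by (auto intro!: derivative_eq_intros)
    moreover have "(\<phi> has_derivative frechet_derivative \<phi> (at x)) (at (x + 0 *\<^sub>R b))"
      using test_function_has_derivative[OF \<phi>] by simp
    ultimately have "((\<lambda>t. \<phi> (x + t *\<^sub>R b)) has_derivative (\<lambda>t. frechet_derivative \<phi> (at x) (t *\<^sub>R b))) (at 0)"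
      by (rule has_derivative_compose)
    moreover have "(\<lambda>t. frechet_derivative \<phi> (at x) (t *\<^sub>R b)) = (*) (d x)"
      using has_derivative_linear[OF test_function_has_derivative[OF \<phi>, of x]]
      by (simp add: fun_eq_iff d_def linear_scale mult.commute)
    ultimately have "((\<lambda>t. \<phi> (x + t *\<^sub>R b)) has_real_derivative d x) (at 0)"
      by (simp add: has_field_derivative_def)
    from DERIV_mult[OF der[OF True] this]
    have "((\<lambda>t. u (x + t *\<^sub>R b) * \<phi> (x + t *\<^sub>R b)) has_real_derivative F x) (at 0)"
      using True by (simp add: F_def mult.commute add.commute)
    then show ?thesis
      by (rule has_field_derivative_transform_within_open[OF _ line_open[OF U]]) (use True in \<open>auto simp: f_def\<close>)
  next
    case False
    then have "x \<in> - K" using K by auto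
    have "((\<lambda>t. 0) has_real_derivative F x) (at 0)" using False by (simp add: F_def)
    then show ?thesis
      by (rule has_field_derivative_transform_within_open[OF _ line_open[of "- K"]])
        (use K \<open>x \<in> - K\<close> \<phi>0 in \<open>auto simp: f_def open_Compl compact_imp_closed\<close>)
  qed
  have zero: "(LINT x|lborel. F x) = 0"
    by (rule integral_directional_derivative_zero(2)[OF f_der F_cont f_cont K(1)]) (simp add: f_def \<phi>0)
  have int: "set_integrable lebesgue U (\<lambda>x. D x * \<phi> x)" "set_integrable lebesgue U (\<lambda>x. u x * d x)"
    using L1_loc_continuous[OF D] L1_loc_continuous[OF u] U K cont \<phi>0 d0
    by (blast intro: L1_loc_times_continuous_integrable)+
  have "(LINT x:U|lebesgue. D x * \<phi> x) + (LINT x:U|lebesgue. u x * d x)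
      = (LINT x:U|lebesgue. D x * \<phi> x + u x * d x)"
    using int by simp
  also have "\<dots> = (LINT x|lebesgue. F x)"
    unfolding set_lebesgue_integral_def by (rule Bochner_Integration.integral_cong) (auto simp: F_def)
  also have "\<dots> = 0"
    using zero F_cont by (simp add: integral_completion borel_measurable_continuous_onI)
  finally show ?thesis by (simp add: d_def)
qed

text \<open>
  Stated for a single direction, because the trace inequality involves the vertical derivative only.
\<close>

lemma weak_gradient_component_classical:
  fixes u D :: "'b::euclidean_space \<Rightarrow> real"
  assumes U: "open U" and b: "b \<in> Basis" and u: "continuous_on U u" and D: "continuous_on U D"
    and der: "\<And>x. x \<in> U \<Longrightarrow> ((\<lambda>t. u (x + t *\<^sub>R b)) has_real_derivative D x) (at 0)"
    and g: "has_weak_gradient U u g"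
  shows "AE x in lebesgue_on U. g x \<bullet> b = D x"
proof -
  have loc: "L1_loc U (\<lambda>x. g x \<bullet> b)" "L1_loc U D"
    by (rule has_weak_gradientD(2)[OF g b] L1_loc_continuous[OF D])+
  have "AE x in lebesgue_on U. g x \<bullet> b + (-1) * D x = 0"
  proof (rule fundamental_lemma[OF U])
    show "L1_loc U (\<lambda>x. g x \<bullet> b + (-1) * D x)" by (intro L1_loc_add L1_loc_cmult loc)
    fix \<phi> assume \<phi>: "\<phi> \<in> test_functions U"
    note i = L1_loc_times_test_function_integrable[OF U _ \<phi>]
    have "(LINT x:U|lebesgue. (g x \<bullet> b) * \<phi> x - D x * \<phi> x) =
      (LINT x:U|lebesgue. (g x \<bullet> b) * \<phi> x) - (LINT x:U|lebesgue. D x * \<phi> x)"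
      by (intro set_integral_diff i loc)
    also have "\<dots> = 0"
      using integration_by_parts_test_function[OF U b u D der \<phi>] has_weak_gradientD(3)[OF g b \<phi>] by simp
    finally show "(LINT x:U|lebesgue. (g x \<bullet> b + (-1) * D x) * \<phi> x) = 0" by (simp add: algebra_simps)
  qed
  then show ?thesis by eventually_elim simp
qed

section \<open>Weighted Sobolev spaces\<close>

text \<open>
  Absorbing the weight into the measure turns weighted spaces into ordinary \<open>L\<^sup>2\<close> spaces. As weights
  are positive almost everywhere, the null sets do not change.
\<close>

definition weighted_measure :: "'b::euclidean_space set \<Rightarrow> ('b \<Rightarrow> real) \<Rightarrow> 'b measure" where
  "weighted_measure U \<rho> = density (lebesgue_on U) (\<lambda>x. ennreal (\<rho> x))"

lemma measurable_weighted_measure [simp]: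
  "f \<in> borel_measurable (weighted_measure U \<rho>) \<longleftrightarrow> f \<in> borel_measurable (lebesgue_on U)"
  by (simp add: weighted_measure_def)

lemma AE_weighted_measure:
  assumes "weight U \<rho>"
  shows "(AE x in weighted_measure U \<rho>. P x) \<longleftrightarrow> (AE x in lebesgue_on U. P x)"
proof -
  have pos: "AE x in lebesgue_on U. 0 < \<rho> x" and "\<rho> \<in> borel_measurable (lebesgue_on U)"
    using assms by (auto simp: weight_def)
  then have "(AE x in weighted_measure U \<rho>. P x) \<longleftrightarrow> (AE x in lebesgue_on U. 0 < ennreal (\<rho> x) \<longrightarrow> P x)"
    unfolding weighted_measure_def by (subst AE_density) auto
  also have "\<dots> \<longleftrightarrow> (AE x in lebesgue_on U. P x)"
  proof
    assume "AE x in lebesgue_on U. 0 < ennreal (\<rho> x) \<longrightarrow> P x"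
    with pos show "AE x in lebesgue_on U. P x" by eventually_elim simp
  qed (auto elim: eventually_mono)
  finally show ?thesis .
qed

lemma
  fixes f :: "'b::euclidean_space \<Rightarrow> real"
  assumes "open U" "weight U \<rho>" "f \<in> borel_measurable (lebesgue_on U)"
  shows integrable_weighted_measure:
      "integrable (weighted_measure U \<rho>) f \<longleftrightarrow> set_integrable lebesgue U (\<lambda>x. f x * \<rho> x)"
    and integral_weighted_measure:
      "(LINT x|weighted_measure U \<rho>. f x) = (LINT x:U|lebesgue. f x * \<rho> x)"
proof -
  have U: "U \<in> sets lebesgue" using assms(1) by simp
  have r: "\<rho> \<in> borel_measurable (lebesgue_on U)" "AE x in lebesgue_on U. 0 \<le> \<rho> x"
    using assms(2) by (auto simp: weight_def elim: eventually_mono)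
  show "integrable (weighted_measure U \<rho>) f \<longleftrightarrow> set_integrable lebesgue U (\<lambda>x. f x * \<rho> x)"
    unfolding weighted_measure_def set_integrable_lebesgue_on[OF U]
    by (subst integrable_density[OF assms(3) r]) (simp add: mult.commute)
  show "(LINT x|weighted_measure U \<rho>. f x) = (LINT x:U|lebesgue. f x * \<rho> x)"
    unfolding weighted_measure_def set_lebesgue_integral_lebesgue_on[OF U]
    by (subst integral_density[OF assms(3) r]) (simp add: mult.commute)
qed

lemma L2_iff_square_integrable:
  assumes "open U" "weight U \<rho>"
  shows "u \<in> L2 U \<rho> \<longleftrightarrow> square_integrable (weighted_measure U \<rho>) u"
  using integrable_weighted_measure[OF assms, of "\<lambda>x. (u x)\<^sup>2"]
  by (auto simp: L2_def square_integrable_def)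

lemma L2_norm_squared:
  assumes "open U" "weight U \<rho>" "u \<in> L2 U \<rho>"
  shows "(L2_norm U \<rho> u)\<^sup>2 = (LINT x|weighted_measure U \<rho>. (u x)\<^sup>2)"
proof -
  have [measurable]: "u \<in> borel_measurable (lebesgue_on U)" using assms(3) by (simp add: L2_def)
  have "0 \<le> (LINT x|weighted_measure U \<rho>. (u x)\<^sup>2)" by simp
  then show ?thesis
    using integral_weighted_measure[OF assms(1,2), of "\<lambda>x. (u x)\<^sup>2"]
    by (simp add: L2_norm_def)
qed

locale sobolev_weight =
  fixes U :: "'b::euclidean_space set" and \<rho> :: "'b \<Rightarrow> real"
  assumes U: "open U" and weight: "weight U \<rho>" and inv_loc: "L1_loc U (\<lambda>x. inverse (\<rho> x))"
begin

abbreviation "\<mu> \<equiv> weighted_measure U \<rho>"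
abbreviation "grad \<equiv> weak_gradient U"
abbreviation "W \<equiv> W12 U \<rho>"

text \<open>
  A function together with its gradient. The Sobolev norm is the \<open>L\<^sup>2\<close> norm of this one
  vector-valued function.
\<close>

definition jet :: "('b \<Rightarrow> real) \<Rightarrow> 'b \<Rightarrow> real \<times> 'b" where
  "jet u x = (u x, grad u x)"

definition sqnorm :: "('b \<Rightarrow> real) \<Rightarrow> real" where
  "sqnorm u = (LINT x|\<mu>. (norm (jet u x))\<^sup>2)"

lemma norm_jet_squared: "(norm (jet u x))\<^sup>2 = (u x)\<^sup>2 + (norm (grad u x))\<^sup>2"
  by (simp add: jet_def norm_Pair)

lemma W12_weak_gradient: "u \<in> W \<Longrightarrow> has_weak_gradient U u (grad u)"
  by (rule has_weak_gradient_weak_gradient) (simp add: W12_def)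

lemma W12_iff:
  "u \<in> W \<longleftrightarrow> (\<exists>g. has_weak_gradient U u g) \<and> square_integrable \<mu> (jet u)"
proof (cases "\<exists>g. has_weak_gradient U u g")
  case True
  then have "has_weak_gradient U u (grad u)" by (rule has_weak_gradient_weak_gradient)
  note [measurable] = has_weak_gradient_measurable[OF U this]
  have jet: "jet u \<in> borel_measurable (lebesgue_on U)"
    unfolding jet_def[abs_def] by measurable
  have "integrable \<mu> (\<lambda>x. (norm (jet u x))\<^sup>2) \<longleftrightarrow>
      integrable \<mu> (\<lambda>x. (u x)\<^sup>2) \<and> integrable \<mu> (\<lambda>x. (norm (grad u x))\<^sup>2)"
  proof (intro iffI conjI)
    assume int: "integrable \<mu> (\<lambda>x. (norm (jet u x))\<^sup>2)"
    show "integrable \<mu> (\<lambda>x. (u x)\<^sup>2)"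
      by (rule Bochner_Integration.integrable_bound[OF int]) (auto simp: norm_jet_squared)
    show "integrable \<mu> (\<lambda>x. (norm (grad u x))\<^sup>2)"
      by (rule Bochner_Integration.integrable_bound[OF int]) (auto simp: norm_jet_squared)
  qed (auto simp: norm_jet_squared)
  then show ?thesis
    using True jet by (auto simp: W12_def L2_iff_square_integrable[OF U weight] square_integrable_def)
qed (simp add: W12_def)

text \<open>Membership may be tested with any weak gradient in place of the chosen one.\<close>

lemma W12I:
  assumes wg: "has_weak_gradient U u g" and sq: "square_integrable \<mu> (\<lambda>x. (u x, g x))"
  shows "u \<in> W" "AE x in \<mu>. jet u x = (u x, g x)"
proof -
  have "has_weak_gradient U u (grad u)" using wg by (intro has_weak_gradient_weak_gradient) blast
  note [measurable] = has_weak_gradient_measurable[OF U this]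
  have meas: "jet u \<in> borel_measurable \<mu>" unfolding jet_def[abs_def] by simp
  show eq: "AE x in \<mu>. jet u x = (u x, g x)"
    unfolding AE_weighted_measure[OF weight] using weak_gradient_eq[OF U wg]
    by eventually_elim (simp add: jet_def)
  have "integrable \<mu> (\<lambda>x. (norm (jet u x))\<^sup>2)"
  proof (rule integrable_cong_AE_imp)
    show "integrable \<mu> (\<lambda>x. (norm (u x, g x))\<^sup>2)" using sq by (simp add: square_integrable_def)
    show "(\<lambda>x. (norm (jet u x))\<^sup>2) \<in> borel_measurable \<mu>" using meas by measurable
    show "AE x in \<mu>. (norm (u x, g x))\<^sup>2 = (norm (jet u x))\<^sup>2" using eq by eventually_elim simp
  qed
  then show "u \<in> W" using wg meas by (auto simp: W12_iff square_integrable_def)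
qed

lemma W12_square_integrable:
  assumes "u \<in> W"
  shows "square_integrable \<mu> (jet u)" "square_integrable \<mu> u" "square_integrable \<mu> (grad u)"
proof -
  show "square_integrable \<mu> (jet u)" using assms by (simp add: W12_iff)
  show "square_integrable \<mu> u" using assms L2_iff_square_integrable[OF U weight] by (simp add: W12_def)
  have "square_integrable \<mu> (\<lambda>x. norm (grad u x))"
    using assms L2_iff_square_integrable[OF U weight] by (simp add: W12_def)
  then show "square_integrable \<mu> (grad u)"
    using has_weak_gradient_measurable(2)[OF U W12_weak_gradient[OF assms]] by (simp add: square_integrable_def)
qed

lemma W12_norm_eq:
  assumes "u \<in> W"
  shows "W12_norm U \<rho> u = sqrt (sqnorm u)"
proof -
  note [measurable] = has_weak_gradient_measurable[OF U W12_weak_gradient[OF assms]]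
  have "sqnorm u = (LINT x|\<mu>. (u x)\<^sup>2) + (LINT x|\<mu>. (norm (grad u x))\<^sup>2)"
    using W12_square_integrable[OF assms] by (simp add: sqnorm_def norm_jet_squared square_integrable_def)
  moreover have "(LINT x|\<mu>. (u x)\<^sup>2) = (LINT x:U|lebesgue. (u x)\<^sup>2 * \<rho> x)"
    by (intro integral_weighted_measure[OF U weight]) measurable
  moreover have "(LINT x|\<mu>. (norm (grad u x))\<^sup>2) = (LINT x:U|lebesgue. (norm (grad u x))\<^sup>2 * \<rho> x)"
    by (intro integral_weighted_measure[OF U weight]) measurable
  ultimately show ?thesis by (simp add: W12_norm_def)
qed

lemma grad_lin:
  assumes "u \<in> W" "v \<in> W"
  shows "AE x in \<mu>. grad (\<lambda>x. u x + c * v x) x = grad u x + c *\<^sub>R grad v x"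
  unfolding AE_weighted_measure[OF weight]
  by (rule weak_gradient_eq[OF U has_weak_gradient_lin[OF U]]) (use assms in \<open>simp_all add: W12_weak_gradient\<close>)

lemma jet_lin:
  assumes "u \<in> W" "v \<in> W"
  shows "AE x in \<mu>. jet (\<lambda>x. u x + c * v x) x = jet u x + c *\<^sub>R jet v x"
  using grad_lin[OF assms, of c] by eventually_elim (simp add: jet_def)

lemma W12_lin:
  assumes u: "u \<in> W" and v: "v \<in> W"
  shows "(\<lambda>x. u x + c * v x) \<in> W"
proof (rule W12I)
  show "has_weak_gradient U (\<lambda>x. u x + c * v x) (\<lambda>x. grad u x + c *\<^sub>R grad v x)"
    by (rule has_weak_gradient_lin[OF U W12_weak_gradient[OF u] W12_weak_gradient[OF v]])
  have "square_integrable \<mu> (\<lambda>x. jet u x + c *\<^sub>R jet v x)"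
    by (intro square_integrable_add square_integrable_scale W12_square_integrable u v)
  then show "square_integrable \<mu> (\<lambda>x. (u x + c * v x, grad u x + c *\<^sub>R grad v x))"
    by (simp add: jet_def)
qed

lemma W12_diff: "u \<in> W \<Longrightarrow> v \<in> W \<Longrightarrow> (\<lambda>x. u x - v x) \<in> W"
  using W12_lin[of u v "-1"] by simp

lemma sqnorm_lin:
  assumes "u \<in> W" "v \<in> W"
  shows "sqnorm (\<lambda>x. u x + c * v x) = (LINT x|\<mu>. (norm (jet u x + c *\<^sub>R jet v x))\<^sup>2)"
  unfolding sqnorm_def
proof (rule integral_cong_AE)
  show "AE x in \<mu>. (norm (jet (\<lambda>x. u x + c * v x) x))\<^sup>2 = (norm (jet u x + c *\<^sub>R jet v x))\<^sup>2"
    using jet_lin[OF assms, of c] by eventually_elim simp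
qed (use W12_square_integrable(1)[OF assms(1)] W12_square_integrable(1)[OF assms(2)]
      W12_square_integrable(1)[OF W12_lin[OF assms, of c]] in \<open>auto simp: square_integrable_def\<close>)

lemma sqnorm_nonneg: "0 \<le> sqnorm u"
  by (simp add: sqnorm_def)

lemma sqnorm_add_le:
  assumes "u \<in> W" "v \<in> W"
  shows "sqnorm (\<lambda>x. u x + v x) \<le> 2 * sqnorm u + 2 * sqnorm v"
  using integral_norm_add_squared_le[OF W12_square_integrable(1)[OF assms(1)] W12_square_integrable(1)[OF assms(2)]]
    sqnorm_lin[OF assms, of 1] by (simp add: sqnorm_def)

lemma sqnorm_scale:
  assumes "u \<in> W"
  shows "(\<lambda>x. c * u x) \<in> W" "sqnorm (\<lambda>x. c * u x) = c\<^sup>2 * sqnorm u"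
proof -
  have "(\<lambda>x. u x + (c - 1) * u x) = (\<lambda>x. c * u x)" by (simp add: fun_eq_iff algebra_simps)
  moreover have "jet u x + (c - 1) *\<^sub>R jet u x = c *\<^sub>R jet u x" for x by (simp add: scaleR_diff_left)
  ultimately show "(\<lambda>x. c * u x) \<in> W" "sqnorm (\<lambda>x. c * u x) = c\<^sup>2 * sqnorm u"
    using W12_lin[OF assms assms, of "c - 1"] sqnorm_lin[OF assms assms, of "c - 1"]
    by (simp_all add: sqnorm_def power_mult_distrib)
qed

lemma sqnorm_diff_commute:
  assumes "u \<in> W" "v \<in> W"
  shows "sqnorm (\<lambda>x. u x - v x) = sqnorm (\<lambda>x. v x - u x)"
  using sqnorm_scale(2)[OF W12_diff[OF assms], of "-1"] by simp

lemma sqnorm_triangle: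
  assumes "u \<in> W" "v \<in> W" "w \<in> W"
  shows "sqnorm (\<lambda>x. u x - w x) \<le> 2 * sqnorm (\<lambda>x. u x - v x) + 2 * sqnorm (\<lambda>x. v x - w x)"
  using sqnorm_add_le[OF W12_diff[OF assms(1,2)] W12_diff[OF assms(2,3)]] by simp

text \<open>
  Local integrability of \<open>1/\<rho>\<close> makes \<open>\<psi>/\<rho>\<close> square integrable for bounded \<open>\<psi>\<close> with compact support.
  Integration of a function against \<open>\<psi>\<close> without weight is therefore a continuous functional on the
  weighted \<open>L\<^sup>2\<close> space.
\<close>

lemma square_integrable_over_weight:
  fixes \<psi> :: "'b \<Rightarrow> 'v::euclidean_space"
  assumes meas: "\<psi> \<in> borel_measurable lebesgue" and K: "compact K" "K \<subseteq> U"
    and B: "\<And>x. norm (\<psi> x) \<le> B" and supp: "\<And>x. x \<notin> K \<Longrightarrow> \<psi> x = 0"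
  shows "square_integrable \<mu> (\<lambda>x. inverse (\<rho> x) *\<^sub>R \<psi> x)"
proof -
  have \<rho>: "\<rho> \<in> borel_measurable (lebesgue_on U)" "AE x in lebesgue_on U. 0 < \<rho> x"
    using weight by (auto simp: weight_def)
  note [measurable] = \<rho>(1)
  have \<psi>[measurable]: "\<psi> \<in> borel_measurable (lebesgue_on U)"
    using meas by (rule measurable_restrict_space1)
  have "integrable lebesgue (\<lambda>x. indicat_real K x *\<^sub>R inverse (\<rho> x))"
    using inv_loc K by (simp add: L1_loc_def set_integrable_def)
  then have "integrable (lebesgue_on U) (\<lambda>x. indicat_real K x *\<^sub>R inverse (\<rho> x))"
    using integrable_mult_indicator[of U lebesgue "\<lambda>x. indicat_real K x *\<^sub>R inverse (\<rho> x)"] U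
    by (subst integrable_restrict_space) simp_all
  then have i: "integrable (lebesgue_on U) (\<lambda>x. B\<^sup>2 * (indicat_real K x *\<^sub>R inverse (\<rho> x)))" by simp
  have "integrable (lebesgue_on U) (\<lambda>x. (norm (inverse (\<rho> x) *\<^sub>R \<psi> x))\<^sup>2 * \<rho> x)"
  proof (rule Bochner_Integration.integrable_bound[OF i])
    show "AE x in lebesgue_on U. norm ((norm (inverse (\<rho> x) *\<^sub>R \<psi> x))\<^sup>2 * \<rho> x)
        \<le> norm (B\<^sup>2 * (indicat_real K x *\<^sub>R inverse (\<rho> x)))"
      using \<rho>(2)
    proof eventually_elim
      case (elim x)
      have "(norm (\<psi> x))\<^sup>2 \<le> B\<^sup>2" using B[of x] by (intro power_mono) auto
      then have "(norm (\<psi> x))\<^sup>2 \<le> B\<^sup>2 * indicat_real K x" using supp[of x] by (auto simp: indicator_def)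
      then have "(norm (\<psi> x))\<^sup>2 * inverse (\<rho> x) \<le> B\<^sup>2 * indicat_real K x * inverse (\<rho> x)"
        using elim by (intro mult_right_mono) auto
      moreover have "(norm (inverse (\<rho> x) *\<^sub>R \<psi> x))\<^sup>2 * \<rho> x = (norm (\<psi> x))\<^sup>2 * inverse (\<rho> x)"
        using elim by (simp add: power_mult_distrib power2_eq_square field_simps)
      ultimately show ?case using elim by (simp add: abs_mult mult.assoc)
    qed
  qed measurable
  then show ?thesis
    using integrable_weighted_measure[OF U weight, of "\<lambda>x. (norm (inverse (\<rho> x) *\<^sub>R \<psi> x))\<^sup>2"] U
    by (simp add: square_integrable_def set_integrable_lebesgue_on)
qed

lemma integral_inner_over_weight:
  fixes \<psi> h :: "'b \<Rightarrow> 'v::euclidean_space"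
  assumes h: "h \<in> borel_measurable (lebesgue_on U)" and \<psi>: "\<psi> \<in> borel_measurable lebesgue"
  shows "(LINT x|\<mu>. h x \<bullet> (inverse (\<rho> x) *\<^sub>R \<psi> x)) = (LINT x:U|lebesgue. h x \<bullet> \<psi> x)"
    and "integrable \<mu> (\<lambda>x. h x \<bullet> (inverse (\<rho> x) *\<^sub>R \<psi> x)) \<longleftrightarrow> set_integrable lebesgue U (\<lambda>x. h x \<bullet> \<psi> x)"
proof -
  have \<rho>: "\<rho> \<in> borel_measurable (lebesgue_on U)" "AE x in lebesgue_on U. 0 < \<rho> x"
    using weight by (auto simp: weight_def)
  note [measurable] = \<rho>(1) h measurable_restrict_space1[OF \<psi>, of U]
  have eq: "AE x in lebesgue_on U. (h x \<bullet> (inverse (\<rho> x) *\<^sub>R \<psi> x)) * \<rho> x = h x \<bullet> \<psi> x"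
    using \<rho>(2) by eventually_elim simp
  have L: "U \<in> sets lebesgue" using U by simp
  show "(LINT x|\<mu>. h x \<bullet> (inverse (\<rho> x) *\<^sub>R \<psi> x)) = (LINT x:U|lebesgue. h x \<bullet> \<psi> x)"
    using eq by (subst integral_weighted_measure[OF U weight])
      (auto simp: set_lebesgue_integral_lebesgue_on[OF L] intro!: integral_cong_AE)
  show "integrable \<mu> (\<lambda>x. h x \<bullet> (inverse (\<rho> x) *\<^sub>R \<psi> x)) \<longleftrightarrow> set_integrable lebesgue U (\<lambda>x. h x \<bullet> \<psi> x)"
  proof (subst integrable_weighted_measure[OF U weight])
    show "set_integrable lebesgue U (\<lambda>x. (h x \<bullet> (inverse (\<rho> x) *\<^sub>R \<psi> x)) * \<rho> x) \<longleftrightarrow> set_integrable lebesgue U (\<lambda>x. h x \<bullet> \<psi> x)"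
      unfolding set_integrable_lebesgue_on[OF L] using eq by (intro integrable_cong_AE) measurable
  qed measurable
qed

lemma square_integrable_imp_L1_loc:
  fixes h :: "'b \<Rightarrow> real"
  assumes h: "square_integrable \<mu> h"
  shows "L1_loc U h"
  unfolding L1_loc_def
proof (intro allI impI)
  fix K assume K: "compact K \<and> K \<subseteq> U"
  have K_meas: "indicat_real K \<in> borel_measurable lebesgue"
    using K compact_imp_closed[of K] by (intro borel_measurable_indicator lmeasurable_compact[THEN fmeasurableD]) auto
  have "square_integrable \<mu> (\<lambda>x. inverse (\<rho> x) *\<^sub>R indicat_real K x)"
    using K by (intro square_integrable_over_weight[OF K_meas, where K = K and B = 1]) (auto simp: indicator_def)
  from square_integrable_inner[OF h this]
  have "set_integrable lebesgue U (\<lambda>x. h x \<bullet> indicat_real K x)"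
    using h by (subst (asm) integral_inner_over_weight(2)[OF _ K_meas]) (auto simp: square_integrable_def)
  moreover have "indicat_real U x *\<^sub>R (h x \<bullet> indicat_real K x) = indicat_real K x *\<^sub>R h x" for x
    using K by (auto simp: indicator_def)
  ultimately show "set_integrable lebesgue K h" by (simp only: set_integrable_def)
qed

text \<open>
  For a test function \<open>\<phi>\<close> and a direction \<open>b\<close> the defining identity says that the pair \<open>J = (u, g)\<close> is
  orthogonal in \<open>L\<^sup>2(\<mu>)\<close> to \<open>(\<partial>\<^sub>b \<phi>, \<phi> b) / \<rho>\<close>. This function is square integrable, so orthogonality is
  inherited by limits.
\<close>

lemma has_weak_gradient_limit:
  assumes F: "\<And>n. F n \<in> W" and J: "square_integrable \<mu> J"
    and lim: "(\<lambda>n. LINT x|\<mu>. (norm (jet (F n) x - J x))\<^sup>2) \<longlonglongrightarrow> 0"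
  shows "has_weak_gradient U (\<lambda>x. fst (J x)) (\<lambda>x. snd (J x))"
  unfolding has_weak_gradient_def
proof (intro conjI ballI)
  have [measurable]: "J \<in> borel_measurable (lebesgue_on U)" using J by (simp add: square_integrable_def)
  have component: "square_integrable \<mu> (\<lambda>x. J x \<bullet> e)" if "norm e \<le> 1" for e
  proof -
    have "integrable \<mu> (\<lambda>x. (J x \<bullet> e)\<^sup>2)"
    proof (rule Bochner_Integration.integrable_bound)
      show "integrable \<mu> (\<lambda>x. (norm (J x))\<^sup>2)" using J by (simp add: square_integrable_def)
      have "\<bar>J x \<bullet> e\<bar> \<le> norm (J x)" for x
        using Cauchy_Schwarz_ineq2[of "J x" e] mult_left_le[OF that, of "norm (J x)"] by simp
      then show "AE x in \<mu>. norm ((J x \<bullet> e)\<^sup>2) \<le> norm ((norm (J x))\<^sup>2)"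
        by (intro AE_I2) (simp add: abs_le_square_iff[symmetric])
    qed simp
    then show ?thesis by (simp add: square_integrable_def)
  qed
  have "L1_loc U (\<lambda>x. J x \<bullet> (1, 0))" by (intro square_integrable_imp_L1_loc component) simp
  then show "L1_loc U (\<lambda>x. fst (J x))" by (simp add: inner_prod_def)
  fix b :: 'b assume b: "b \<in> Basis"
  have "L1_loc U (\<lambda>x. J x \<bullet> (0, b))" using b by (intro square_integrable_imp_L1_loc component) simp
  then show loc_b: "L1_loc U (\<lambda>x. snd (J x) \<bullet> b)" by (simp add: inner_prod_def)
  fix \<phi> assume \<phi>: "\<phi> \<in> test_functions U"
  define d where "d x = frechet_derivative \<phi> (at x) b" for x
  define \<psi> where "\<psi> x = (d x, \<phi> x *\<^sub>R b)" for x
  define K where "K = closure {x. \<phi> x \<noteq> 0}"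
  have K: "compact K" "K \<subseteq> U" using \<phi> by (auto simp: test_functions_def K_def)
  have cont: "continuous_on UNIV \<psi>"
    unfolding \<psi>_def d_def using test_function_continuous[OF \<phi>] test_function_derivative_continuous[OF \<phi> b]
    by (intro continuous_intros)
  have meas: "\<psi> \<in> borel_measurable lebesgue"
    using cont by (intro measurable_completion) (simp add: borel_measurable_continuous_onI)
  have supp: "\<psi> x = 0" if "x \<notin> K" for x
    using that test_function_derivative_support[OF \<phi>, of x b] closure_subset[of "{x. \<phi> x \<noteq> 0}"]
    by (auto simp: \<psi>_def d_def K_def zero_prod_def)
  have "bounded (\<psi> ` K)"
    using K cont by (intro compact_imp_bounded compact_continuous_image) (auto intro: continuous_on_subset)
  then obtain B where "\<And>x. x \<in> K \<Longrightarrow> norm (\<psi> x) \<le> B" by (metis bounded_iff imageI)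
  then have "norm (\<psi> x) \<le> \<bar>B\<bar>" for x using supp[of x] by (cases "x \<in> K") force+
  then have sq: "square_integrable \<mu> (\<lambda>x. inverse (\<rho> x) *\<^sub>R \<psi> x)"
    by (intro square_integrable_over_weight[OF meas K _ supp])
  define L where "L H = (LINT x|\<mu>. H x \<bullet> (inverse (\<rho> x) *\<^sub>R \<psi> x))" for H :: "'b \<Rightarrow> real \<times> 'b"
  have L_eq: "L H = (LINT x:U|lebesgue. fst (H x) * d x) + (LINT x:U|lebesgue. (snd (H x) \<bullet> b) * \<phi> x)"
    if "H \<in> borel_measurable (lebesgue_on U)" "L1_loc U (\<lambda>x. fst (H x))" "L1_loc U (\<lambda>x. snd (H x) \<bullet> b)" for H
  proof -
    have "L H = (LINT x:U|lebesgue. fst (H x) * d x + (snd (H x) \<bullet> b) * \<phi> x)"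
      unfolding L_def integral_inner_over_weight(1)[OF that(1) meas]
      by (simp add: \<psi>_def inner_prod_def mult.commute)
    also have "\<dots> = (LINT x:U|lebesgue. fst (H x) * d x) + (LINT x:U|lebesgue. (snd (H x) \<bullet> b) * \<phi> x)"
      unfolding d_def
      by (rule set_integral_add(2)[OF L1_loc_times_test_function_derivative_integrable[OF U that(2) \<phi> b]
            L1_loc_times_test_function_integrable[OF U that(3) \<phi>]])
    finally show ?thesis .
  qed
  have L_jet: "L (jet (F n)) = 0" for n
  proof -
    note g = W12_weak_gradient[OF F[of n]]
    have "L (jet (F n)) = (LINT x:U|lebesgue. F n x * d x) + (LINT x:U|lebesgue. (grad (F n) x \<bullet> b) * \<phi> x)"
      using L_eq[of "jet (F n)"] has_weak_gradientD(1)[OF g] has_weak_gradientD(2)[OF g b]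
        W12_square_integrable(1)[OF F[of n]]
      by (simp add: jet_def square_integrable_def)
    then show ?thesis using has_weak_gradientD(3)[OF g b \<phi>] by (simp add: d_def)
  qed
  have "(L J)\<^sup>2 \<le> (LINT x|\<mu>. (norm (jet (F n) x - J x))\<^sup>2) * (LINT x|\<mu>. (norm (inverse (\<rho> x) *\<^sub>R \<psi> x))\<^sup>2)" for n
  proof -
    have "L (\<lambda>x. jet (F n) x - J x) = L (jet (F n)) - L J"
      unfolding L_def inner_diff_left
      by (rule Bochner_Integration.integral_diff[OF square_integrable_inner[OF W12_square_integrable(1)[OF F] sq]
            square_integrable_inner[OF J sq]])
    then have "(L J)\<^sup>2 = (L (\<lambda>x. jet (F n) x - J x))\<^sup>2" by (simp add: L_jet)
    also have "\<dots> \<le> (LINT x|\<mu>. (norm (jet (F n) x - J x))\<^sup>2) * (LINT x|\<mu>. (norm (inverse (\<rho> x) *\<^sub>R \<psi> x))\<^sup>2)"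
      unfolding L_def by (rule integral_Cauchy_Schwarz[OF square_integrable_diff[OF W12_square_integrable(1)[OF F] J] sq])
    finally show ?thesis .
  qed
  moreover have "(\<lambda>n. (LINT x|\<mu>. (norm (jet (F n) x - J x))\<^sup>2) * (LINT x|\<mu>. (norm (inverse (\<rho> x) *\<^sub>R \<psi> x))\<^sup>2)) \<longlonglongrightarrow> 0"
    using tendsto_mult_left_zero[OF lim] by blast
  ultimately have "(L J)\<^sup>2 \<le> 0" by (intro LIMSEQ_le_const) auto
  then have "L J = 0" by simp
  moreover have "L1_loc U (\<lambda>x. fst (J x))"
    using \<open>L1_loc U (\<lambda>x. J x \<bullet> (1, 0))\<close> by (simp add: inner_prod_def)
  ultimately show "(LINT x:U|lebesgue. fst (J x) * frechet_derivative \<phi> (at x) b) =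
      - (LINT x:U|lebesgue. (snd (J x) \<bullet> b) * \<phi> x)"
    using L_eq[of J] loc_b by (simp add: d_def)
qed

lemma W12_complete:
  assumes F: "\<And>n. F n \<in> W"
    and cauchy: "\<And>\<epsilon>. 0 < \<epsilon> \<Longrightarrow> \<exists>N. \<forall>m\<ge>N. \<forall>n\<ge>N. sqnorm (\<lambda>x. F m x - F n x) \<le> \<epsilon>"
  shows "\<exists>u\<in>W. (\<lambda>n. sqnorm (\<lambda>x. F n x - u x)) \<longlonglongrightarrow> 0"
proof -
  have diff: "sqnorm (\<lambda>x. u x - v x) = (LINT x|\<mu>. (norm (jet u x - jet v x))\<^sup>2)"
    if "u \<in> W" "v \<in> W" for u v
    using sqnorm_lin[OF that, of "-1"] by simp
  obtain J where J: "square_integrable \<mu> J" "(\<lambda>n. LINT x|\<mu>. (norm (jet (F n) x - J x))\<^sup>2) \<longlonglongrightarrow> 0"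
    using square_integrable_complete[of \<mu> "\<lambda>n. jet (F n)"] W12_square_integrable(1)[OF F] cauchy
    by (auto simp: diff F)
  define u where "u x = fst (J x)" for x
  have wg: "has_weak_gradient U u (\<lambda>x. snd (J x))"
    unfolding u_def by (rule has_weak_gradient_limit[OF F J])
  have pair: "(u x, snd (J x)) = J x" for x by (simp add: u_def)
  have sq: "square_integrable \<mu> (\<lambda>x. (u x, snd (J x)))" using J(1) by (simp add: pair)
  have u: "u \<in> W" by (rule W12I(1)[OF wg sq])
  have jet_u: "AE x in \<mu>. jet u x = J x" using W12I(2)[OF wg sq] by (simp add: pair)
  have eq: "sqnorm (\<lambda>x. F n x - u x) = (LINT x|\<mu>. (norm (jet (F n) x - J x))\<^sup>2)" for n
    unfolding diff[OF F u]
  proof (rule integral_cong_AE)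
    show "AE x in \<mu>. (norm (jet (F n) x - jet u x))\<^sup>2 = (norm (jet (F n) x - J x))\<^sup>2"
      using jet_u by eventually_elim simp
  qed (use J(1) W12_square_integrable(1)[OF u] W12_square_integrable(1)[OF F[of n]] in \<open>auto simp: square_integrable_def\<close>)
  show ?thesis using J(2) by (intro bexI[OF _ u]) (simp only: eq)
qed

end

section \<open>The trace inequality on a vertical line\<close>

text \<open>
  For one vertical line. By Cauchy--Schwarz \<open>|f 0 - f y|\<^sup>2\<close> is at most
  \<open>y\<^bsup>2\<sigma>\<^esup> / (2\<sigma>)\<close> times the weighted energy of the derivative. Averaging over \<open>y\<close> in \<open>(1, 2)\<close> avoids
  the origin, where \<open>t\<^bsup>1 - 2\<sigma>\<^esup>\<close> fails to be integrable when \<open>\<sigma> = 1\<close>. The factor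
  \<open>(2\<sigma>)\<^sup>2\<close> absorbs the constant, which blows up as \<open>\<sigma>\<close> tends to 0.
\<close>

lemma trace_inequality_line:
  fixes f g :: "real \<Rightarrow> real"
  assumes \<sigma>: "0 < \<sigma>" "\<sigma> \<le> 1" and f: "continuous_on UNIV f" and g: "continuous_on UNIV g"
    and der: "\<And>t. 0 < t \<Longrightarrow> (f has_real_derivative g t) (at t)"
  shows "ennreal ((2 * \<sigma>)\<^sup>2 * (f 0)\<^sup>2)
    \<le> 16 * (\<integral>\<^sup>+t. ennreal (t powr (1 - 2 * \<sigma>) * ((f t)\<^sup>2 + (g t)\<^sup>2)) * indicator {0<..} t \<partial>lborel)"
proof -
  have [measurable]: "f \<in> borel_measurable borel" "g \<in> borel_measurable borel"
    using f g by (auto intro: borel_measurable_continuous_onI)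
  define E where "E = (\<integral>\<^sup>+t. ennreal (t powr (1 - 2 * \<sigma>) * (g t)\<^sup>2) * indicator {0<..} t \<partial>lborel)"
  define F where "F = (\<integral>\<^sup>+t. ennreal (t powr (1 - 2 * \<sigma>) * (f t)\<^sup>2) * indicator {0<..} t \<partial>lborel)"
  have "(\<integral>\<^sup>+t. ennreal (t powr (1 - 2 * \<sigma>) * ((f t)\<^sup>2 + (g t)\<^sup>2)) * indicator {0<..} t \<partial>lborel) =
    (\<integral>\<^sup>+t. ennreal (t powr (1 - 2 * \<sigma>) * (f t)\<^sup>2) * indicator {0<..} t +
       ennreal (t powr (1 - 2 * \<sigma>) * (g t)\<^sup>2) * indicator {0<..} t \<partial>lborel)"
    by (intro nn_integral_cong) (auto simp: distrib_left indicator_def)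
  also have "\<dots> = F + E" unfolding F_def E_def by (intro nn_integral_add) measurable
  finally have sum: "(\<integral>\<^sup>+t. ennreal (t powr (1 - 2 * \<sigma>) * ((f t)\<^sup>2 + (g t)\<^sup>2)) * indicator {0<..} t \<partial>lborel) = F + E" .
  have step: "ennreal ((f y - f 0)\<^sup>2) \<le> ennreal (y powr (2 * \<sigma>) / (2 * \<sigma>)) * E" if "0 < y" for y
  proof -
    \<comment> \<open>\<open>|g|\<close> is split into \<open>t\<^bsup>\<sigma> - 1/2\<^esup>\<close> and its inverse times \<open>|g|\<close>, whose square is the energy density.\<close>
    let ?A = "\<lambda>t. ennreal (t powr (\<sigma> - 1/2)) * indicator {0..y} t"
    let ?B = "\<lambda>t. ennreal (t powr (1/2 - \<sigma>) * \<bar>g t\<bar>) * indicator {0<..} t"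
    have int: "integrable lborel (\<lambda>t. indicat_real {0..y} t *\<^sub>R g t)"
      using g by (intro borel_integrable_compact) (auto intro: continuous_on_subset)
    have "(g has_integral (f y - f 0)) {0..y}"
      using \<open>0 < y\<close> f der
      by (intro fundamental_theorem_of_calculus_interior)
        (auto intro: continuous_on_subset simp: has_real_derivative_iff_has_vector_derivative[symmetric])
    then have "f y - f 0 = (LINT t:{0..y}|lborel. g t)"
      using set_borel_integral_eq_integral(2)[of "{0..y}" g] int
      by (simp add: set_integrable_def integral_unique)
    then have "ennreal \<bar>f y - f 0\<bar> \<le> (\<integral>\<^sup>+t. norm (indicat_real {0..y} t *\<^sub>R g t) \<partial>lborel)"
      using integral_norm_bound_ennreal[OF int] by (simp add: set_lebesgue_integral_def)
    also have "\<dots> = (\<integral>\<^sup>+t. ?A t * ?B t \<partial>lborel)"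
    proof (rule nn_integral_cong_AE)
      show "AE t in lborel. ennreal (norm (indicat_real {0..y} t *\<^sub>R g t)) = ?A t * ?B t"
        using AE_lborel_singleton[of 0]
      proof eventually_elim
        case (elim t)
        have "t powr (\<sigma> - 1/2) * (t powr (1/2 - \<sigma>) * \<bar>g t\<bar>) = \<bar>g t\<bar>" if "0 < t"
          using that by (simp add: mult.assoc[symmetric] powr_add[symmetric])
        then show ?case using elim by (auto simp: indicator_def ennreal_mult[symmetric])
      qed
    qed
    finally have "(ennreal \<bar>f y - f 0\<bar>)\<^sup>2 \<le> (\<integral>\<^sup>+t. ?A t * ?B t \<partial>lborel)\<^sup>2"
      by (rule power_mono) simp
    moreover have "(ennreal \<bar>f y - f 0\<bar>)\<^sup>2 = ennreal ((f y - f 0)\<^sup>2)"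
      by (simp add: ennreal_power)
    ultimately have "ennreal ((f y - f 0)\<^sup>2) \<le> (\<integral>\<^sup>+t. ?A t * ?B t \<partial>lborel)\<^sup>2"
      by (simp only:)
    also have "\<dots> \<le> (\<integral>\<^sup>+t. (?A t)\<^sup>2 \<partial>lborel) * (\<integral>\<^sup>+t. (?B t)\<^sup>2 \<partial>lborel)"
      by (rule Cauchy_Schwarz_nn_integral) measurable
    also have "(\<integral>\<^sup>+t. (?B t)\<^sup>2 \<partial>lborel) = E"
      unfolding E_def
    proof (rule nn_integral_cong)
      fix t :: real
      have "(t powr (1/2 - \<sigma>))\<^sup>2 = t powr (1 - 2 * \<sigma>)"
        by (simp add: power2_eq_square powr_add[symmetric])
      then have "(t powr (1/2 - \<sigma>) * \<bar>g t\<bar>)\<^sup>2 = t powr (1 - 2 * \<sigma>) * (g t)\<^sup>2"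
        by (simp add: power_mult_distrib)
      then show "(?B t)\<^sup>2 = ennreal (t powr (1 - 2 * \<sigma>) * (g t)\<^sup>2) * indicator {0<..} t"
        by (auto simp: indicator_def ennreal_power)
    qed
    also have "(\<integral>\<^sup>+t. (?A t)\<^sup>2 \<partial>lborel) = (\<integral>\<^sup>+t. ennreal (t powr (2 * \<sigma> - 1)) * indicator {0..y} t \<partial>lborel)"
    proof (rule nn_integral_cong)
      fix t :: real
      have "(t powr (\<sigma> - 1/2))\<^sup>2 = t powr (2 * \<sigma> - 1)"
        by (simp add: power2_eq_square powr_add[symmetric])
      then show "(?A t)\<^sup>2 = ennreal (t powr (2 * \<sigma> - 1)) * indicator {0..y} t"
        by (auto simp: indicator_def ennreal_power)
    qed
    also have "\<dots> = ennreal (y powr (2 * \<sigma>) / (2 * \<sigma>))"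
      using has_integral_powr_from_0[of "2 * \<sigma> - 1" y] \<sigma> \<open>0 < y\<close>
      by (intro nn_integral_has_integral_lebesgue') auto
    finally show ?thesis .
  qed
  \<comment> \<open>For \<open>1 < y < 2\<close> one has \<open>y\<^bsup>2\<sigma>\<^esup> \<le> 4\<close> and \<open>y\<^bsup>1 - 2\<sigma>\<^esup> \<ge> 1/2\<close>, which gives the constant 16.\<close>
  have main: "ennreal ((2 * \<sigma>)\<^sup>2 * (f 0)\<^sup>2) \<le> 16 * ennreal (y powr (1 - 2 * \<sigma>) * (f y)\<^sup>2) + 16 * E"
    if y: "1 < y" "y < 2" for y
  proof (cases "E = \<infinity>")
    case True
    then show ?thesis by (simp add: ennreal_mult_top)
  next
    case False
    then obtain e where e: "E = ennreal e" "0 \<le> e" by (cases E) auto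
    have "(f y - f 0)\<^sup>2 \<le> y powr (2 * \<sigma>) / (2 * \<sigma>) * e"
      using step[of y] y e \<sigma> by (simp add: ennreal_mult[symmetric])
    then have "(2 * \<sigma>)\<^sup>2 * (f y - f 0)\<^sup>2 \<le> (2 * \<sigma>)\<^sup>2 * (y powr (2 * \<sigma>) / (2 * \<sigma>) * e)"
      by (intro mult_left_mono) auto
    also have "\<dots> = (2 * \<sigma>) * (y powr (2 * \<sigma>)) * e"
      using \<sigma> by (simp add: power2_eq_square)
    also have "\<dots> \<le> 2 * 4 * e"
    proof (intro mult_right_mono mult_mono)
      have "y powr (2 * \<sigma>) \<le> y powr 2" using y \<sigma> by (intro powr_mono) auto
      also have "\<dots> \<le> 2\<^sup>2" using y power_mono[of y 2 2] by (simp add: powr_numeral)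
      finally show "y powr (2 * \<sigma>) \<le> 4" by simp
    qed (use \<sigma> e in auto)
    finally have d: "(2 * \<sigma>)\<^sup>2 * (f y - f 0)\<^sup>2 \<le> 8 * e" by simp
    have "(1/2) * (f y)\<^sup>2 \<le> y powr (1 - 2 * \<sigma>) * (f y)\<^sup>2"
    proof (rule mult_right_mono)
      have "1 / 2 \<le> inverse y" using y by (simp add: field_simps)
      also have "\<dots> = y powr (-1)" using y by (simp add: powr_minus)
      also have "\<dots> \<le> y powr (1 - 2 * \<sigma>)" using y \<sigma> by (intro powr_mono) auto
      finally show "1 / 2 \<le> y powr (1 - 2 * \<sigma>)" .
    qed simp
    moreover have "(2 * \<sigma>)\<^sup>2 * (f y)\<^sup>2 \<le> 4 * (f y)\<^sup>2"
      using power_mono[of "2 * \<sigma>" 2 2] \<sigma> by (intro mult_right_mono) auto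
    moreover have "(2 * \<sigma>)\<^sup>2 * (f 0)\<^sup>2 \<le> 2 * ((2 * \<sigma>)\<^sup>2 * (f y)\<^sup>2) + 2 * ((2 * \<sigma>)\<^sup>2 * (f y - f 0)\<^sup>2)"
    proof -
      have "(f 0)\<^sup>2 \<le> 2 * (f y)\<^sup>2 + 2 * (f y - f 0)\<^sup>2"
        using norm_add_squared_le[of "f y" "f 0 - f y"] by (simp add: power2_commute)
      from mult_left_mono[OF this, of "(2 * \<sigma>)\<^sup>2"] show ?thesis by (simp add: algebra_simps)
    qed
    ultimately have "(2 * \<sigma>)\<^sup>2 * (f 0)\<^sup>2 \<le> 16 * (y powr (1 - 2 * \<sigma>) * (f y)\<^sup>2) + 16 * e"
      using d by linarith
    then have "ennreal ((2 * \<sigma>)\<^sup>2 * (f 0)\<^sup>2) \<le> ennreal (16 * (y powr (1 - 2 * \<sigma>) * (f y)\<^sup>2) + 16 * e)"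
      by (rule ennreal_leI)
    also have "\<dots> = 16 * ennreal (y powr (1 - 2 * \<sigma>) * (f y)\<^sup>2) + 16 * E"
      using e by (simp add: ennreal_plus ennreal_mult)
    finally show ?thesis .
  qed
  have "ennreal ((2 * \<sigma>)\<^sup>2 * (f 0)\<^sup>2) = (\<integral>\<^sup>+y. ennreal ((2 * \<sigma>)\<^sup>2 * (f 0)\<^sup>2) * indicator {1<..<2::real} y \<partial>lborel)"
    by (simp add: nn_integral_cmult)
  also have "\<dots> \<le> (\<integral>\<^sup>+y. 16 * (ennreal (y powr (1 - 2 * \<sigma>) * (f y)\<^sup>2) * indicator {0<..} y)
      + 16 * E * indicator {1<..<2} y \<partial>lborel)"
    using main by (intro nn_integral_mono) (auto simp: indicator_def)
  also have "\<dots> = 16 * F + 16 * E * 1"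
    unfolding F_def by (simp add: nn_integral_add nn_integral_cmult)
  finally show ?thesis unfolding sum by (simp add: distrib_left)
qed

section \<open>The weights on the cylinder\<close>

lemma AE_lborel_fst:
  fixes P :: "'a::euclidean_space \<Rightarrow> bool"
  assumes "AE x in lborel. P x"
  shows "AE X in (lborel :: ('a \<times> 'b::euclidean_space) measure). P (fst X)"
proof -
  obtain N where N: "{x \<in> space lborel. \<not> P x} \<subseteq> N" "emeasure lborel N = 0" "N \<in> sets lborel"
    using assms by (rule AE_E)
  then have "N \<times> UNIV \<in> null_sets (lborel \<Otimes>\<^sub>M (lborel :: 'b measure))"
    by (intro lborel.times_in_null_sets1) auto
  then have "N \<times> UNIV \<in> null_sets (lborel :: ('a \<times> 'b) measure)" by (simp add: lborel_prod)
  then show ?thesis by (rule AE_I') (use N(1) in auto)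
qed

lemma borel_measurable_fst_borel: "fst \<in> borel_measurable (borel :: ('a::euclidean_space \<times> 'b::euclidean_space) measure)"
  and borel_measurable_snd_borel: "snd \<in> borel_measurable (borel :: ('a::euclidean_space \<times> 'b::euclidean_space) measure)"
  by (auto intro!: borel_measurable_continuous_onI continuous_intros)

lemma closure_cylinder: "closure (cylinder \<Omega>) = closure \<Omega> \<times> {0..}"
  by (simp add: cylinder_def closure_Times)

lemma open_cylinder: "open \<Omega> \<Longrightarrow> open (cylinder \<Omega>)"
  by (simp add: cylinder_def open_Times)

locale fractional_weight =
  fixes \<Omega> :: "'a::euclidean_space set" and s G wt :: "'a \<Rightarrow> real" and w :: "'a \<times> real \<Rightarrow> real"
  assumes \<Omega>: "open \<Omega>"
    and s_meas: "s \<in> borel_measurable (lebesgue_on \<Omega>)"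
    and s_range: "AE x in lebesgue_on \<Omega>. 0 \<le> s x \<and> s x \<le> 1"
    and s_zero: "{x \<in> \<Omega>. s x = 0} \<in> null_sets lebesgue"
    and G_weight: "weight \<Omega> G"
    and G_inv: "L1_loc \<Omega> (\<lambda>x. inverse (G x))"
    and w_def: "w = (\<lambda>(x, y). G x * y powr (1 - 2 * s x))"
    and wt_def: "wt = (\<lambda>x. G x * (2 * s x)\<^sup>2)"
begin

lemma s_G_range: "AE x in lebesgue. x \<in> \<Omega> \<longrightarrow> 0 < G x \<and> 0 < s x \<and> s x \<le> 1"
proof -
  have "AE x in lebesgue. x \<in> \<Omega> \<longrightarrow> 0 < G x"
    using G_weight \<Omega> by (simp add: weight_def AE_restrict_space_iff)
  moreover have "AE x in lebesgue. x \<in> \<Omega> \<longrightarrow> 0 \<le> s x \<and> s x \<le> 1"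
    using s_range \<Omega> by (subst (asm) AE_restrict_space_iff) auto
  moreover have "AE x in lebesgue. x \<notin> {x \<in> \<Omega>. s x = 0}"
    using s_zero by (rule AE_not_in)
  ultimately show ?thesis by eventually_elim (auto simp: less_le)
qed

lemma wt_weight: "weight \<Omega> wt"
  unfolding weight_def wt_def
proof
  have [measurable]: "G \<in> borel_measurable (lebesgue_on \<Omega>)" "s \<in> borel_measurable (lebesgue_on \<Omega>)"
    using G_weight s_meas by (auto simp: weight_def)
  show "(\<lambda>x. G x * (2 * s x)\<^sup>2) \<in> borel_measurable (lebesgue_on \<Omega>)" by measurable
  have "AE x in lebesgue. x \<in> \<Omega> \<longrightarrow> 0 < G x * (2 * s x)\<^sup>2"
    using s_G_range by eventually_elim auto
  then show "AE x in lebesgue_on \<Omega>. 0 < G x * (2 * s x)\<^sup>2"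
    using \<Omega> by (simp add: AE_restrict_space_iff)
qed

text \<open>Tonelli's theorem is applied to Borel functions that agree with the data almost everywhere.\<close>

lemma borel_representatives:
  obtains G' s' where "G' \<in> borel_measurable borel" "s' \<in> borel_measurable borel"
    and "AE x in lborel. x \<in> \<Omega> \<longrightarrow> G' x = G x \<and> s' x = s x \<and> 0 < G x \<and> 0 < s x \<and> s x \<le> 1"
proof -
  have ex: "\<exists>f'\<in>borel_measurable borel. AE x in lborel. x \<in> \<Omega> \<longrightarrow> f' x = f x"
    if "f \<in> borel_measurable (lebesgue_on \<Omega>)" for f :: "'a \<Rightarrow> real"
  proof -
    have "(\<lambda>x. indicat_real \<Omega> x *\<^sub>R f x) \<in> borel_measurable lebesgue"
      using that \<Omega> by (simp add: borel_measurable_restrict_space_iff)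
    then obtain f' where "f' \<in> borel_measurable lborel" "AE x in lborel. indicat_real \<Omega> x *\<^sub>R f x = f' x"
      using completion_ex_borel_measurable_real by blast
    then show ?thesis by (intro bexI[of _ f']) (auto elim: eventually_mono)
  qed
  have "G \<in> borel_measurable (lebesgue_on \<Omega>)" using G_weight by (simp add: weight_def)
  from ex[OF this] ex[OF s_meas]
  obtain G' s' where *: "G' \<in> borel_measurable borel" "AE x in lborel. x \<in> \<Omega> \<longrightarrow> G' x = G x"
    "s' \<in> borel_measurable borel" "AE x in lborel. x \<in> \<Omega> \<longrightarrow> s' x = s x"
    by blast
  have "AE x in lborel. x \<in> \<Omega> \<longrightarrow> 0 < G x \<and> 0 < s x \<and> s x \<le> 1"
    using s_G_range by (simp add: AE_completion_iff)
  with *(2,4) have "AE x in lborel. x \<in> \<Omega> \<longrightarrow> G' x = G x \<and> s' x = s x \<and> 0 < G x \<and> 0 < s x \<and> s x \<le> 1"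
    by eventually_elim auto
  then show thesis by (rule that[OF *(1,3)])
qed

lemma borel_weight_measurable:
  assumes "G' \<in> borel_measurable borel" "s' \<in> borel_measurable borel"
  shows "(\<lambda>X. G' (fst X) * snd X powr (1 - 2 * s' (fst X))) \<in> borel_measurable (borel :: ('a \<times> real) measure)"
proof -
  note [measurable] = assms borel_measurable_fst_borel[where ?'b = real] borel_measurable_snd_borel[where ?'b = real]
  show ?thesis by measurable
qed

lemma w_weight: "weight (cylinder \<Omega>) w"
proof -
  obtain G' s' where *: "G' \<in> borel_measurable borel" "s' \<in> borel_measurable borel"
    "AE x in lborel. x \<in> \<Omega> \<longrightarrow> G' x = G x \<and> s' x = s x \<and> 0 < G x \<and> 0 < s x \<and> s x \<le> 1"
    by (rule borel_representatives)
  let ?w = "\<lambda>X. G' (fst X) * snd X powr (1 - 2 * s' (fst X))"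
  have cyl: "cylinder \<Omega> \<in> sets borel" using open_cylinder[OF \<Omega>] by simp
  have eq: "AE X in lebesgue. X \<in> cylinder \<Omega> \<longrightarrow> ?w X = w X \<and> 0 < w X"
    using AE_completion[OF AE_lborel_fst[OF *(3), where ?'b = real]]
    by eventually_elim (auto simp: w_def cylinder_def)
  have "(\<lambda>X. indicat_real (cylinder \<Omega>) X *\<^sub>R ?w X) \<in> borel_measurable lebesgue"
    using cyl borel_weight_measurable[OF *(1,2)] by (intro measurable_completion) simp
  then have "(\<lambda>X. indicat_real (cylinder \<Omega>) X *\<^sub>R w X) \<in> borel_measurable lebesgue"
    by (rule borel_measurable_AE) (use eq in \<open>auto elim: eventually_mono simp: indicator_def\<close>)
  then have "w \<in> borel_measurable (lebesgue_on (cylinder \<Omega>))"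
    using open_cylinder[OF \<Omega>] by (simp add: borel_measurable_restrict_space_iff)
  moreover have "AE X in lebesgue_on (cylinder \<Omega>). 0 < w X"
    using eq open_cylinder[OF \<Omega>] by (auto simp: AE_restrict_space_iff elim: eventually_mono)
  ultimately show ?thesis by (simp add: weight_def)
qed

text \<open>
  On a compact subset of the cylinder the height \<open>y\<close> stays between some \<open>\<delta> > 0\<close> and \<open>M\<close>. The exponent of
  \<open>y\<^bsup>2s - 1\<^esup>\<close> lies in \<open>[-1, 1]\<close>, so this factor is at most \<open>M + 1/\<delta>\<close>, while \<open>1/G\<close> is integrable over the
  projection of the set to \<open>\<Omega>\<close>.
\<close>

lemma w_inverse_L1_loc: "L1_loc (cylinder \<Omega>) (\<lambda>X. inverse (w X))"
  unfolding L1_loc_def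
proof (intro allI impI)
  fix K assume "compact K \<and> K \<subseteq> cylinder \<Omega>"
  then have K: "compact K" "K \<subseteq> cylinder \<Omega>" by auto
  have fstK: "compact (fst ` K)" "fst ` K \<subseteq> \<Omega>"
    using K by (auto intro!: compact_continuous_image continuous_intros simp: cylinder_def)
  have sndK: "compact (snd ` K)" using K by (auto intro!: compact_continuous_image continuous_intros)
  have "\<exists>\<delta>>0. \<forall>y\<in>snd ` K. \<delta> \<le> y"
  proof (cases "K = {}")
    case False
    then obtain y where "y \<in> snd ` K" "\<forall>z\<in>snd ` K. y \<le> z" using compact_attains_inf[OF sndK] by auto
    then show ?thesis using K(2) by (auto simp: cylinder_def intro!: exI[of _ y])
  qed (auto intro: exI[of _ 1])
  then obtain \<delta> where \<delta>: "0 < \<delta>" "\<And>X. X \<in> K \<Longrightarrow> \<delta> \<le> snd X" by auto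
  obtain M where M: "\<And>X. X \<in> K \<Longrightarrow> snd X \<le> M"
    using bounded_has_Sup(1)[of "snd ` K"] compact_imp_bounded[OF sndK] by (metis empty_iff imageI)
  define B where "B = M + inverse \<delta>"
  have powr_le: "snd X powr a \<le> B" if "X \<in> K" "-1 \<le> a" "a \<le> 1" for X a
  proof -
    have y: "0 < snd X" "\<delta> \<le> snd X" "snd X \<le> M" using \<delta>(1) \<delta>(2)[OF that(1)] M[OF that(1)] by linarith+
    have "0 \<le> M" "0 < inverse \<delta>" using y \<delta>(1) by auto
    show ?thesis
    proof (cases "1 \<le> snd X")
      case True
      then have "snd X powr a \<le> snd X powr 1" using that by (intro powr_mono) auto
      then have "snd X powr a \<le> snd X" using y by simp
      then show ?thesis using y(3) \<open>0 < inverse \<delta>\<close> unfolding B_def by linarith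
    next
      case False
      then have "snd X powr a \<le> snd X powr (-1)" using that y by (intro powr_mono') auto
      also have "\<dots> = inverse (snd X)" using y by (simp add: powr_minus)
      also have "\<dots> \<le> inverse \<delta>" using y \<delta>(1) by (intro le_imp_inverse_le) auto
      finally show ?thesis using \<open>0 \<le> M\<close> by (simp add: B_def)
    qed
  qed
  obtain G' s' where *: "G' \<in> borel_measurable borel" "s' \<in> borel_measurable borel"
    "AE x in lborel. x \<in> \<Omega> \<longrightarrow> G' x = G x \<and> s' x = s x \<and> 0 < G x \<and> 0 < s x \<and> s x \<le> 1"
    by (rule borel_representatives)
  note [measurable] = *(1,2) borel_measurable_fst_borel[where ?'b = real] borel_measurable_snd_borel[where ?'b = real]
  have [measurable]: "fst ` K \<in> sets borel" "K \<in> sets borel"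
    using fstK(1) K(1) by (auto intro: borel_compact)
  define p where "p x = indicat_real (fst ` K) x *\<^sub>R inverse (G' x)" for x
  have p_meas[measurable]: "p \<in> borel_measurable borel" unfolding p_def by measurable
  have "integrable lebesgue p"
  proof (rule integrable_cong_AE_imp)
    show "integrable lebesgue (\<lambda>x. indicat_real (fst ` K) x *\<^sub>R inverse (G x))"
      using G_inv fstK by (simp add: L1_loc_def set_integrable_def)
    show "AE x in lebesgue. indicat_real (fst ` K) x *\<^sub>R inverse (G x) = p x"
      using AE_completion[OF *(3)] by eventually_elim (use fstK(2) in \<open>auto simp: p_def indicator_def\<close>)
  qed (use p_meas in \<open>simp add: measurable_completion\<close>)
  then have "integrable lborel p" by (simp add: integrable_completion)
  then have p_fin: "(\<integral>\<^sup>+x. ennreal \<bar>p x\<bar> \<partial>lborel) < \<infinity>" by (simp add: integrable_iff_bounded)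
  define q where "q X = p (fst X) * indicat_real {\<delta>..M} (snd X)" for X :: "'a \<times> real"
  have q_meas[measurable]: "q \<in> borel_measurable borel" unfolding q_def by measurable
  have "(\<integral>\<^sup>+X. ennreal \<bar>q X\<bar> \<partial>lborel) = (\<integral>\<^sup>+x. \<integral>\<^sup>+y. ennreal \<bar>q (x, y)\<bar> \<partial>lborel \<partial>lborel)"
    unfolding lborel_prod[symmetric] by (subst lborel.nn_integral_fst) (simp_all add: lborel_prod)
  also have "\<dots> = (\<integral>\<^sup>+x. ennreal \<bar>p x\<bar> * ennreal (max 0 (M - \<delta>)) \<partial>lborel)"
  proof (rule nn_integral_cong)
    fix x
    have "(\<integral>\<^sup>+y. ennreal \<bar>q (x, y)\<bar> \<partial>lborel) = (\<integral>\<^sup>+y. ennreal \<bar>p x\<bar> * indicator {\<delta>..M} y \<partial>lborel)"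
      by (intro nn_integral_cong) (auto simp: q_def indicator_def)
    then show "(\<integral>\<^sup>+y. ennreal \<bar>q (x, y)\<bar> \<partial>lborel) = ennreal \<bar>p x\<bar> * ennreal (max 0 (M - \<delta>))"
      by (cases "\<delta> \<le> M") (simp_all add: nn_integral_cmult)
  qed
  also have "\<dots> < \<infinity>" using p_fin by (simp add: nn_integral_multc ennreal_mult_less_top)
  finally have "integrable lborel q" by (simp add: integrable_iff_bounded)
  then have q_int: "integrable lebesgue q" by (simp add: integrable_completion)
  let ?w = "\<lambda>X. G' (fst X) * snd X powr (1 - 2 * s' (fst X))"
  have eq: "AE X in lebesgue. X \<in> K \<longrightarrow> ?w X = w X \<and> 0 < G (fst X) \<and> 0 < s (fst X) \<and> s (fst X) \<le> 1 \<and> G' (fst X) = G (fst X)"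
    using AE_completion[OF AE_lborel_fst[OF *(3), where ?'b = real]]
    by eventually_elim (use K(2) in \<open>auto simp: w_def cylinder_def\<close>)
  have "(\<lambda>X. indicat_real K X *\<^sub>R inverse (?w X)) \<in> borel_measurable lebesgue"
    using borel_weight_measurable[OF *(1,2)] by (intro measurable_completion) simp
  then have meas: "(\<lambda>X. indicat_real K X *\<^sub>R inverse (w X)) \<in> borel_measurable lebesgue"
    by (rule borel_measurable_AE) (use eq in \<open>auto elim: eventually_mono simp: indicator_def simp del: inverse_mult_distrib\<close>)
  have "integrable lebesgue (\<lambda>X. indicat_real K X *\<^sub>R inverse (w X))"
  proof (rule Bochner_Integration.integrable_bound)
    show "integrable lebesgue (\<lambda>X. B * q X)" using q_int by simp
    show "AE X in lebesgue. norm (indicat_real K X *\<^sub>R inverse (w X)) \<le> norm (B * q X)"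
      using eq
    proof eventually_elim
      case (elim X)
      show ?case
      proof (cases "X \<in> K")
        case True
        then have y: "0 < snd X" "snd X \<in> {\<delta>..M}" using \<delta>(1) \<delta>(2)[OF True] M[OF True] by auto
        have G: "0 < G (fst X)" "G' (fst X) = G (fst X)" using elim True by auto
        have "inverse (w X) = inverse (G (fst X)) * snd X powr (2 * s (fst X) - 1)"
          using y(1) by (simp add: w_def case_prod_beta powr_minus[symmetric])
        moreover have "snd X powr (2 * s (fst X) - 1) \<le> B" using elim True by (intro powr_le) auto
        moreover have "q X = inverse (G (fst X))" using True y(2) G(2) by (simp add: q_def p_def)
        moreover have "0 \<le> snd X powr (2 * s (fst X) - 1)" by simp
        ultimately show ?thesis using True G(1)
          by (simp add: abs_mult mult.commute[of _ "inverse (G (fst X))"] mult_left_mono)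
      qed simp
    qed
  qed (rule meas)
  then show "set_integrable lebesgue K (\<lambda>X. inverse (w X))" by (simp add: set_integrable_def)
qed

end

sublocale fractional_weight \<subseteq> sobolev_weight "cylinder \<Omega>" w
  by unfold_locales (rule open_cylinder[OF \<Omega>] w_weight w_inverse_L1_loc)+

section \<open>Boundary values of smooth functions\<close>

lemma vertical_in_Basis: "(0, 1) \<in> (Basis :: ('a::euclidean_space \<times> real) set)"
  by (simp add: Basis_prod_def)

text \<open>
  Smoothness up to the boundary extends the vertical derivative continuously to the base, so the
  fundamental theorem of calculus applies on lines that start at height 0.
\<close>

lemma Cc_cylinder_vertical_derivative:
  fixes \<phi> :: "'a::euclidean_space \<times> real \<Rightarrow> real"
  assumes "\<phi> \<in> Cc_cylinder \<Omega>"
  obtains g where "continuous_on (closure (cylinder \<Omega>)) \<phi>" "continuous_on (closure (cylinder \<Omega>)) g"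
    and "\<And>X t. X + t *\<^sub>R (0, 1) \<in> cylinder \<Omega> \<Longrightarrow>
      ((\<lambda>t. \<phi> (X + t *\<^sub>R (0, 1))) has_real_derivative g (X + t *\<^sub>R (0, 1))) (at t)"
proof -
  have C1: "Ck_closure (Suc 0) (cylinder \<Omega>) \<phi>"
    using assms by (simp add: Cc_cylinder_def smooth_closure_def)
  obtain D g where *: "continuous_on (closure (cylinder \<Omega>)) \<phi>"
    "\<And>X. X \<in> cylinder \<Omega> \<Longrightarrow> (\<phi> has_derivative D X) (at X)"
    "\<And>b. b \<in> Basis \<Longrightarrow> Ck_closure 0 (cylinder \<Omega>) (g b)"
    "\<And>b X. b \<in> Basis \<Longrightarrow> X \<in> cylinder \<Omega> \<Longrightarrow> g b X = D X b"
    using C1 by (rule Ck_closure_SucE) blast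
  show thesis
  proof (rule that[OF *(1)])
    show "continuous_on (closure (cylinder \<Omega>)) (g (0, 1))" using *(3)[OF vertical_in_Basis] by simp
    fix X t assume X: "X + t *\<^sub>R (0, 1) \<in> cylinder \<Omega>"
    have "((\<lambda>t. X + t *\<^sub>R (0, 1)) has_derivative (\<lambda>h. h *\<^sub>R (0, 1))) (at t)"
      by (auto intro!: derivative_eq_intros)
    then have "((\<lambda>t. \<phi> (X + t *\<^sub>R (0, 1))) has_derivative (\<lambda>h. D (X + t *\<^sub>R (0, 1)) (h *\<^sub>R (0, 1)))) (at t)"
      using *(2)[OF X] by (rule has_derivative_compose)
    moreover have "(\<lambda>h. D (X + t *\<^sub>R (0, 1)) (h *\<^sub>R (0, 1))) = (*) (g (0, 1) (X + t *\<^sub>R (0, 1)))"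
    proof
      fix h
      show "D (X + t *\<^sub>R (0, 1)) (h *\<^sub>R (0, 1)) = g (0, 1) (X + t *\<^sub>R (0, 1)) * h"
        unfolding *(4)[OF vertical_in_Basis X] linear_scale[OF has_derivative_linear[OF *(2)[OF X]]]
        by simp
    qed
    ultimately show "((\<lambda>t. \<phi> (X + t *\<^sub>R (0, 1))) has_real_derivative g (0, 1) (X + t *\<^sub>R (0, 1))) (at t)"
      by (simp only: has_field_derivative_def)
  qed
qed

context fractional_weight
begin

abbreviation "\<nu> \<equiv> weighted_measure \<Omega> wt"

text \<open>
  The inequality on vertical lines, integrated over \<open>\<Omega>\<close>. The classical vertical derivative is bounded
  by the weak gradient because it is one of its components almost everywhere.
\<close>

lemma trace_inequality:
  assumes Cc: "\<phi> \<in> Cc_cylinder \<Omega>" and W: "\<phi> \<in> W"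
  shows "square_integrable \<nu> (\<lambda>x. \<phi> (x, 0))"
    and "(LINT x|\<nu>. (\<phi> (x, 0))\<^sup>2) \<le> 16 * sqnorm \<phi>"
proof -
  let ?C = "closure (cylinder \<Omega>)"
  obtain g where \<phi>: "continuous_on ?C \<phi>" and g: "continuous_on ?C g"
    and der: "\<And>X t. X + t *\<^sub>R (0, 1) \<in> cylinder \<Omega> \<Longrightarrow>
      ((\<lambda>t. \<phi> (X + t *\<^sub>R (0, 1))) has_real_derivative g (X + t *\<^sub>R (0, 1))) (at t)"
    using Cc_cylinder_vertical_derivative[OF Cc] by blast
  have C: "X \<in> ?C" if "fst X \<in> \<Omega>" "0 \<le> snd X" for X
    using that closure_subset[of \<Omega>] by (cases X) (auto simp: closure_cylinder)
  have cyl_C: "cylinder \<Omega> \<subseteq> ?C" by (rule closure_subset)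
  have grad_g: "AE X in lebesgue_on (cylinder \<Omega>). grad \<phi> X \<bullet> (0, 1) = g X"
  proof (rule weak_gradient_component_classical[OF U vertical_in_Basis])
    show "((\<lambda>t. \<phi> (X + t *\<^sub>R (0, 1))) has_real_derivative g X) (at 0)" if "X \<in> cylinder \<Omega>" for X
      using der[of X 0] that by (simp add: zero_prod_def[symmetric])
  qed (use \<phi> g cyl_C W12_weak_gradient[OF W] in \<open>auto intro: continuous_on_subset\<close>)
  obtain G' s' where *: "G' \<in> borel_measurable borel" "s' \<in> borel_measurable borel"
    "AE x in lborel. x \<in> \<Omega> \<longrightarrow> G' x = G x \<and> s' x = s x \<and> 0 < G x \<and> 0 < s x \<and> s x \<le> 1"
    by (rule borel_representatives)
  \<comment> \<open>Restricting \<open>\<phi>\<close> and \<open>g\<close> to the closed cylinder, on which they are continuous, makes the integrand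
    Borel measurable.\<close>
  define H where "H X = ennreal (G' (fst X)) * (ennreal (snd X powr (1 - 2 * s' (fst X)) *
      ((indicat_real ?C X *\<^sub>R \<phi> X)\<^sup>2 + (indicat_real ?C X *\<^sub>R g X)\<^sup>2)) * indicator (cylinder \<Omega>) X)" for X
  have H_meas: "H \<in> borel_measurable borel"
  proof -
    note [measurable] = *(1,2) borel_measurable_fst_borel[where ?'b = real] borel_measurable_snd_borel[where ?'b = real]
    have [measurable]: "cylinder \<Omega> \<in> sets borel" using U by simp
    have [measurable]: "(\<lambda>X. indicat_real ?C X *\<^sub>R \<phi> X) \<in> borel_measurable borel"
      "(\<lambda>X. indicat_real ?C X *\<^sub>R g X) \<in> borel_measurable borel"
      by (rule borel_measurable_continuous_on_indicator[OF _ \<phi>] borel_measurable_continuous_on_indicator[OF _ g], simp)+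
    show ?thesis unfolding H_def by measurable
  qed
  have H_eq: "AE X in lebesgue. H X = ennreal (w X) * ennreal ((\<phi> X)\<^sup>2 + (g X)\<^sup>2) * indicator (cylinder \<Omega>) X"
    using AE_completion[OF AE_lborel_fst[OF *(3), where ?'b = real]]
  proof eventually_elim
    case (elim X)
    show ?case
    proof (cases "X \<in> cylinder \<Omega>")
      case True
      then have "X \<in> ?C" "fst X \<in> \<Omega>" using cyl_C by (auto simp: cylinder_def)
      then show ?thesis using True elim
        by (auto simp: H_def w_def case_prod_beta ennreal_mult[symmetric] mult.assoc simp del: ennreal_plus)
    qed (simp add: H_def)
  qed
  have line: "AE x in lborel. ennreal (wt x * (\<phi> (x, 0))\<^sup>2) * indicator \<Omega> x \<le> 16 * (\<integral>\<^sup>+y. H (x, y) \<partial>lborel)"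
    using *(3)
  proof eventually_elim
    case (elim x)
    show ?case
    proof (cases "x \<in> \<Omega>")
      case True
      then have e: "G' x = G x" "s' x = s x" "0 < G x" "0 < s x" "s x \<le> 1" using elim by auto
      \<comment> \<open>Constant continuation below the base gives functions on the whole line.\<close>
      define f where "f t = \<phi> (x, max 0 t)" for t
      define k where "k t = g (x, max 0 t)" for t
      have fk: "continuous_on UNIV f" "continuous_on UNIV k"
        unfolding f_def k_def using True
        by (auto intro!: continuous_on_compose2[OF \<phi>] continuous_on_compose2[OF g] continuous_intros C)
      have fk_der: "(f has_real_derivative k t) (at t)" if "0 < t" for t
      proof -
        have "((\<lambda>t. \<phi> (x, t)) has_real_derivative g (x, t)) (at t)"
          using der[of "(x, 0)" t] True that by (simp add: cylinder_def)
        then have "((\<lambda>t. \<phi> (x, t)) has_real_derivative k t) (at t)" using that by (simp add: k_def)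
        then show ?thesis
          by (rule has_field_derivative_transform_within_open[of _ _ _ "{0<..}"]) (use that in \<open>auto simp: f_def\<close>)
      qed
      have "ennreal (wt x * (\<phi> (x, 0))\<^sup>2) = ennreal (G x) * ennreal ((2 * s x)\<^sup>2 * (f 0)\<^sup>2)"
        using e by (simp add: wt_def f_def ennreal_mult[symmetric] mult.assoc)
      also have "\<dots> \<le> ennreal (G x) * (16 * (\<integral>\<^sup>+t. ennreal (t powr (1 - 2 * s x) * ((f t)\<^sup>2 + (k t)\<^sup>2)) * indicator {0<..} t \<partial>lborel))"
        by (intro mult_left_mono trace_inequality_line e fk fk_der) simp_all
      also have "\<dots> = 16 * (\<integral>\<^sup>+t. ennreal (G x) * (ennreal (t powr (1 - 2 * s x) * ((f t)\<^sup>2 + (k t)\<^sup>2)) * indicator {0<..} t) \<partial>lborel)"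
      proof -
        have [measurable]: "f \<in> borel_measurable borel" "k \<in> borel_measurable borel"
          using fk by (auto intro: borel_measurable_continuous_onI)
        show ?thesis by (subst nn_integral_cmult) (auto simp: mult.left_commute)
      qed
      also have "(\<lambda>t. ennreal (G x) * (ennreal (t powr (1 - 2 * s x) * ((f t)\<^sup>2 + (k t)\<^sup>2)) * indicator {0<..} t))
        = (\<lambda>y. H (x, y))"
        using True e C[of "(x, _)"] by (auto simp: fun_eq_iff H_def f_def k_def cylinder_def indicator_def)
      finally show ?thesis using True by simp
    qed simp
  qed
  have [measurable]: "(\<lambda>x. \<phi> (x, 0)) \<in> borel_measurable (lebesgue_on \<Omega>)"
  proof (rule continuous_imp_measurable_on_sets_lebesgue)
    show "continuous_on \<Omega> (\<lambda>x. \<phi> (x, 0))"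
      by (auto intro!: continuous_on_compose2[OF \<phi>] continuous_intros C)
  qed (use \<Omega> in simp)
  have [measurable]: "wt \<in> borel_measurable (lebesgue_on \<Omega>)" "w \<in> borel_measurable (lebesgue_on (cylinder \<Omega>))"
    using wt_weight weight by (auto simp: weight_def)
  have wt_pos: "AE x in lebesgue_on \<Omega>. 0 < wt x" using wt_weight by (simp add: weight_def)
  have "(\<integral>\<^sup>+x. ennreal ((\<phi> (x, 0))\<^sup>2) \<partial>\<nu>) = (\<integral>\<^sup>+x. ennreal (wt x * (\<phi> (x, 0))\<^sup>2) \<partial>lebesgue_on \<Omega>)"
    unfolding weighted_measure_def using wt_pos
    by (subst nn_integral_density) (auto intro!: nn_integral_cong_AE simp: ennreal_mult'' elim: eventually_mono)
  also have "\<dots> = (\<integral>\<^sup>+x. ennreal (wt x * (\<phi> (x, 0))\<^sup>2) * indicator \<Omega> x \<partial>lborel)"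
    using \<Omega> by (simp add: nn_integral_restrict_space nn_integral_completion)
  also have "\<dots> \<le> (\<integral>\<^sup>+x. 16 * (\<integral>\<^sup>+y. H (x, y) \<partial>lborel) \<partial>lborel)"
    by (rule nn_integral_mono_AE[OF line])
  also have "\<dots> = 16 * (\<integral>\<^sup>+x. (\<integral>\<^sup>+y. H (x, y) \<partial>lborel) \<partial>lborel)"
    using H_meas by (intro nn_integral_cmult lborel.borel_measurable_nn_integral_fst) (simp add: lborel_prod)
  also have "(\<integral>\<^sup>+x. (\<integral>\<^sup>+y. H (x, y) \<partial>lborel) \<partial>lborel) = (\<integral>\<^sup>+X. H X \<partial>lborel)"
    using H_meas by (subst lborel.nn_integral_fst) (simp_all add: lborel_prod)
  also have "\<dots> = (\<integral>\<^sup>+X. H X \<partial>lebesgue)" by (simp add: nn_integral_completion)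
  also have "\<dots> = (\<integral>\<^sup>+X. ennreal (w X) * ennreal ((\<phi> X)\<^sup>2 + (g X)\<^sup>2) * indicator (cylinder \<Omega>) X \<partial>lebesgue)"
    by (rule nn_integral_cong_AE[OF H_eq])
  also have "\<dots> = (\<integral>\<^sup>+X. ennreal (w X) * ennreal ((\<phi> X)\<^sup>2 + (g X)\<^sup>2) \<partial>lebesgue_on (cylinder \<Omega>))"
    using U by (simp add: nn_integral_restrict_space)
  also have "\<dots> \<le> (\<integral>\<^sup>+X. ennreal (w X) * ennreal ((norm (jet \<phi> X))\<^sup>2) \<partial>lebesgue_on (cylinder \<Omega>))"
  proof (rule nn_integral_mono_AE)
    show "AE X in lebesgue_on (cylinder \<Omega>). ennreal (w X) * ennreal ((\<phi> X)\<^sup>2 + (g X)\<^sup>2)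
        \<le> ennreal (w X) * ennreal ((norm (jet \<phi> X))\<^sup>2)"
      using grad_g
    proof eventually_elim
      case (elim X)
      have "\<bar>grad \<phi> X \<bullet> (0, 1)\<bar> \<le> norm (grad \<phi> X)"
        using Cauchy_Schwarz_ineq2[of "grad \<phi> X" "(0, 1)"] by simp
      then have "(g X)\<^sup>2 \<le> (norm (grad \<phi> X))\<^sup>2" using elim by (simp add: abs_le_square_iff[symmetric])
      then show ?case by (intro mult_left_mono ennreal_leI) (simp_all add: norm_jet_squared)
    qed
  qed
  also have "\<dots> = (\<integral>\<^sup>+X. ennreal ((norm (jet \<phi> X))\<^sup>2) \<partial>\<mu>)"
    unfolding weighted_measure_def using W12_square_integrable(1)[OF W]
    by (subst nn_integral_density) (auto simp: square_integrable_def)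
  also have "\<dots> = ennreal (sqnorm \<phi>)"
    unfolding sqnorm_def using W12_square_integrable(1)[OF W]
    by (intro nn_integral_eq_integral) (auto simp: square_integrable_def)
  finally have le: "(\<integral>\<^sup>+x. ennreal ((\<phi> (x, 0))\<^sup>2) \<partial>\<nu>) \<le> 16 * ennreal (sqnorm \<phi>)"
    by (simp add: mult_left_mono)
  also have "\<dots> = ennreal (16 * sqnorm \<phi>)" by (simp add: ennreal_mult sqnorm_nonneg)
  finally have le: "(\<integral>\<^sup>+x. ennreal ((\<phi> (x, 0))\<^sup>2) \<partial>\<nu>) \<le> ennreal (16 * sqnorm \<phi>)" .
  have int: "integrable \<nu> (\<lambda>x. (\<phi> (x, 0))\<^sup>2)"
    using le by (auto simp: integrable_iff_bounded intro: le_less_trans)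
  then show "square_integrable \<nu> (\<lambda>x. \<phi> (x, 0))" by (simp add: square_integrable_def)
  have "ennreal (LINT x|\<nu>. (\<phi> (x, 0))\<^sup>2) = (\<integral>\<^sup>+x. ennreal ((\<phi> (x, 0))\<^sup>2) \<partial>\<nu>)"
    using int by (intro nn_integral_eq_integral[symmetric]) auto
  then have "ennreal (LINT x|\<nu>. (\<phi> (x, 0))\<^sup>2) \<le> ennreal (16 * sqnorm \<phi>)" using le by (simp only:)
  then show "(LINT x|\<nu>. (\<phi> (x, 0))\<^sup>2) \<le> 16 * sqnorm \<phi>"
    by (subst (asm) ennreal_le_iff) (simp add: sqnorm_nonneg)
qed

end

section \<open>The trace operator\<close>

lemma Cc_cylinder_lin:
  assumes u: "u \<in> Cc_cylinder \<Omega>" and v: "v \<in> Cc_cylinder \<Omega>"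
  shows "(\<lambda>X. u X + c * v X) \<in> Cc_cylinder \<Omega>"
proof -
  define supp where "supp f = closure {X \<in> closure (cylinder \<Omega>). f X \<noteq> 0}" for f :: "'a \<times> real \<Rightarrow> real"
  have "supp (\<lambda>X. u X + c * v X) \<subseteq> closure ({X \<in> closure (cylinder \<Omega>). u X \<noteq> 0} \<union> {X \<in> closure (cylinder \<Omega>). v X \<noteq> 0})"
    unfolding supp_def by (rule closure_mono) auto
  then have sub: "supp (\<lambda>X. u X + c * v X) \<subseteq> supp u \<union> supp v" by (simp add: supp_def closure_Un)
  have "compact (supp u \<union> supp v)" using u v by (intro compact_Un) (simp_all add: Cc_cylinder_def supp_def)
  then have "bounded (supp (\<lambda>X. u X + c * v X))"
    using sub by (blast intro: bounded_subset compact_imp_bounded)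
  moreover have "closed (supp (\<lambda>X. u X + c * v X))" by (simp add: supp_def)
  ultimately have "compact (supp (\<lambda>X. u X + c * v X))" by (simp add: compact_eq_bounded_closed)
  moreover have "supp u \<union> supp v \<subseteq> cylinder_base \<Omega>" using u v by (auto simp: Cc_cylinder_def supp_def)
  moreover have "smooth_closure (cylinder \<Omega>) (\<lambda>X. u X + c * v X)"
    using u v by (simp add: Cc_cylinder_def smooth_closure_def Ck_closure_add Ck_closure_cmult)
  ultimately show ?thesis using sub unfolding Cc_cylinder_def supp_def by blast
qed

context fractional_weight
begin

abbreviation "smooth_functions \<equiv> Cc_cylinder \<Omega> \<inter> W"
abbreviation "H \<equiv> H0L \<Omega> w"

lemma smooth_functions_lin:
  "u \<in> smooth_functions \<Longrightarrow> v \<in> smooth_functions \<Longrightarrow> (\<lambda>X. u X + c * v X) \<in> smooth_functions"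
  using Cc_cylinder_lin W12_lin by blast

lemma H_W12: "u \<in> H \<Longrightarrow> u \<in> W"
  by (simp add: H0L_def)

lemma sqrt_arbitrarily_small_iff:
  fixes f :: "'b \<Rightarrow> real"
  shows "(\<forall>\<epsilon>>0. \<exists>x\<in>A. sqrt (f x) < \<epsilon>) \<longleftrightarrow> (\<forall>\<epsilon>>0. \<exists>x\<in>A. f x < \<epsilon>)"
proof (intro iffI allI impI)
  fix \<epsilon> :: real
  assume "\<forall>\<epsilon>>0. \<exists>x\<in>A. sqrt (f x) < \<epsilon>" and "0 < \<epsilon>"
  then have "\<exists>x\<in>A. sqrt (f x) < sqrt \<epsilon>" using real_sqrt_gt_zero by blast
  then show "\<exists>x\<in>A. f x < \<epsilon>" by simp
next
  fix \<epsilon> :: real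
  assume small: "\<forall>\<epsilon>>0. \<exists>x\<in>A. f x < \<epsilon>" and "0 < \<epsilon>"
  then obtain x where "x \<in> A" "f x < \<epsilon>\<^sup>2" by (meson zero_less_power)
  then have "sqrt (f x) < \<epsilon>" using real_sqrt_less_mono[of "f x" "\<epsilon>\<^sup>2"] \<open>0 < \<epsilon>\<close> by simp
  then show "\<exists>x\<in>A. sqrt (f x) < \<epsilon>" using \<open>x \<in> A\<close> by blast
qed

lemma H_iff:
  "u \<in> H \<longleftrightarrow> u \<in> W \<and> (\<forall>\<epsilon>>0. \<exists>\<phi>\<in>smooth_functions. sqnorm (\<lambda>X. u X - \<phi> X) < \<epsilon>)"
proof -
  have "W12_norm (cylinder \<Omega>) w (\<lambda>X. u X - \<phi> X) = sqrt (sqnorm (\<lambda>X. u X - \<phi> X))"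
    if "u \<in> W" "\<phi> \<in> smooth_functions" for \<phi>
    using that by (intro W12_norm_eq W12_diff) auto
  then have eq: "(\<exists>\<phi>\<in>smooth_functions. W12_norm (cylinder \<Omega>) w (\<lambda>X. u X - \<phi> X) < \<epsilon>) \<longleftrightarrow>
      (\<exists>\<phi>\<in>smooth_functions. sqrt (sqnorm (\<lambda>X. u X - \<phi> X)) < \<epsilon>)" if "u \<in> W" for \<epsilon>
    using that by (intro bex_cong refl) simp
  show ?thesis
  proof (cases "u \<in> W")
    case True
    then show ?thesis
      by (simp only: H0L_def mem_Collect_eq eq[OF True] sqrt_arbitrarily_small_iff)
  qed (simp add: H0L_def)
qed

lemma smooth_in_H: "\<phi> \<in> smooth_functions \<Longrightarrow> \<phi> \<in> H"
proof -
  assume \<phi>: "\<phi> \<in> smooth_functions"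
  then have "sqnorm (\<lambda>X. \<phi> X - \<phi> X) = 0" using sqnorm_scale(2)[of \<phi> 0] by simp
  then show ?thesis using \<phi> unfolding H_iff by (metis IntD2)
qed

lemma H_approximating_sequence:
  assumes "u \<in> H"
  obtains \<phi> where "\<And>n. \<phi> n \<in> smooth_functions" "(\<lambda>n. sqnorm (\<lambda>X. u X - \<phi> n X)) \<longlonglongrightarrow> 0"
proof -
  have "\<forall>n. \<exists>\<phi>\<in>smooth_functions. sqnorm (\<lambda>X. u X - \<phi> X) < inverse (real (Suc n))"
    using assms by (simp add: H_iff)
  then obtain \<phi> where \<phi>: "\<And>n. \<phi> n \<in> smooth_functions" "\<And>n. sqnorm (\<lambda>X. u X - \<phi> n X) < inverse (real (Suc n))"
    by metis
  have "(\<lambda>n. sqnorm (\<lambda>X. u X - \<phi> n X)) \<longlonglongrightarrow> 0"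
    by (rule tendsto_sandwich[OF _ _ tendsto_const LIMSEQ_inverse_real_of_nat])
      (use \<phi>(2) in \<open>auto intro!: always_eventually less_imp_le simp: sqnorm_nonneg\<close>)
  then show thesis using that \<phi>(1) by blast
qed

lemma H_closed:
  assumes F: "\<And>n. F n \<in> H" and u: "u \<in> W"
    and lim: "(\<lambda>n. sqnorm (\<lambda>X. F n X - u X)) \<longlonglongrightarrow> 0"
  shows "u \<in> H"
  unfolding H_iff
proof (intro conjI allI impI)
  fix \<epsilon> :: real assume "0 < \<epsilon>"
  then have "0 < \<epsilon> / 4" by simp
  from LIMSEQ_D[OF lim this] obtain n where n: "sqnorm (\<lambda>X. F n X - u X) < \<epsilon> / 4"
    by (auto simp: sqnorm_nonneg)
  obtain \<phi> where \<phi>: "\<phi> \<in> smooth_functions" "sqnorm (\<lambda>X. F n X - \<phi> X) < \<epsilon> / 4"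
    using F[of n] \<open>0 < \<epsilon> / 4\<close> unfolding H_iff by blast
  have "sqnorm (\<lambda>X. u X - \<phi> X) \<le> 2 * sqnorm (\<lambda>X. u X - F n X) + 2 * sqnorm (\<lambda>X. F n X - \<phi> X)"
    using u H_W12[OF F[of n]] \<phi>(1) by (intro sqnorm_triangle) auto
  also have "\<dots> < \<epsilon>" using n \<phi>(2) sqnorm_diff_commute[OF u H_W12[OF F[of n]]] by simp
  finally show "\<exists>\<phi>\<in>smooth_functions. sqnorm (\<lambda>X. u X - \<phi> X) < \<epsilon>" using \<phi>(1) by blast
qed (rule u)

lemma sqnorm_lin_tendsto_0:
  assumes "\<And>n. F n \<in> W" "\<And>n. E n \<in> W"
    and "(\<lambda>n. sqnorm (F n)) \<longlonglongrightarrow> 0" "(\<lambda>n. sqnorm (E n)) \<longlonglongrightarrow> 0"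
  shows "(\<lambda>n. sqnorm (\<lambda>X. F n X + c * E n X)) \<longlonglongrightarrow> 0"
proof (rule tendsto_sandwich[OF _ _ tendsto_const])
  have "sqnorm (\<lambda>X. F n X + c * E n X) \<le> 2 * sqnorm (F n) + 2 * (c\<^sup>2 * sqnorm (E n))" for n
    using sqnorm_add_le[OF assms(1) sqnorm_scale(1)[OF assms(2)], of n c n] sqnorm_scale(2)[OF assms(2)] by simp
  then show "\<forall>\<^sub>F n in sequentially. sqnorm (\<lambda>X. F n X + c * E n X) \<le> 2 * sqnorm (F n) + 2 * (c\<^sup>2 * sqnorm (E n))"
    by simp
  show "(\<lambda>n. 2 * sqnorm (F n) + 2 * (c\<^sup>2 * sqnorm (E n))) \<longlonglongrightarrow> 0"
    using tendsto_add[OF tendsto_mult[OF tendsto_const[of 2] assms(3)] tendsto_mult[OF tendsto_const[of 2] tendsto_mult[OF tendsto_const[of "c\<^sup>2"] assms(4)]]]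
    by simp
qed (simp add: sqnorm_nonneg)

lemma H_lin:
  assumes u: "u \<in> H" and v: "v \<in> H"
  shows "(\<lambda>X. u X + c * v X) \<in> H"
proof -
  obtain \<phi> where \<phi>: "\<And>n. \<phi> n \<in> smooth_functions" "(\<lambda>n. sqnorm (\<lambda>X. u X - \<phi> n X)) \<longlonglongrightarrow> 0"
    using H_approximating_sequence[OF u] by blast
  obtain \<psi> where \<psi>: "\<And>n. \<psi> n \<in> smooth_functions" "(\<lambda>n. sqnorm (\<lambda>X. v X - \<psi> n X)) \<longlonglongrightarrow> 0"
    using H_approximating_sequence[OF v] by blast
  let ?F = "\<lambda>n X. \<phi> n X + c * \<psi> n X"
  have F: "?F n \<in> H" for n by (rule smooth_in_H[OF smooth_functions_lin[OF \<phi>(1) \<psi>(1)]])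
  have W: "(\<lambda>X. u X + c * v X) \<in> W" by (rule W12_lin[OF H_W12[OF u] H_W12[OF v]])
  have "(\<lambda>n. sqnorm (\<lambda>X. (u X - \<phi> n X) + c * (v X - \<psi> n X))) \<longlonglongrightarrow> 0"
    by (rule sqnorm_lin_tendsto_0[OF _ _ \<phi>(2) \<psi>(2)]) (use u v \<phi>(1) \<psi>(1) in \<open>auto intro: W12_diff[OF H_W12]\<close>)
  moreover have "(\<lambda>X. (u X - \<phi> n X) + c * (v X - \<psi> n X)) = (\<lambda>X. (u X + c * v X) - ?F n X)" for n
    by (simp add: fun_eq_iff algebra_simps)
  ultimately have "(\<lambda>n. sqnorm (\<lambda>X. ?F n X - (u X + c * v X))) \<longlonglongrightarrow> 0"
    using sqnorm_diff_commute[OF W H_W12[OF F]] by simp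
  then show ?thesis by (rule H_closed[OF F W])
qed

lemma H_add: "u \<in> H \<Longrightarrow> v \<in> H \<Longrightarrow> (\<lambda>X. u X + v X) \<in> H"
  using H_lin[of u v 1] by simp

lemma H_diff: "u \<in> H \<Longrightarrow> v \<in> H \<Longrightarrow> (\<lambda>X. u X - v X) \<in> H"
  using H_lin[of u v "-1"] by simp

lemma H_scale: "u \<in> H \<Longrightarrow> (\<lambda>X. c * u X) \<in> H"
  using H_lin[of u u "c - 1"] by (simp add: algebra_simps)

text \<open>The trace is the closure of the graph of \<open>\<phi> \<mapsto> \<phi>(\<cdot>, 0)\<close> on smooth functions.\<close>

definition is_trace :: "('a \<times> real \<Rightarrow> real) \<Rightarrow> ('a \<Rightarrow> real) \<Rightarrow> bool" where
  "is_trace u t \<longleftrightarrow> square_integrable \<nu> t \<and>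
     (\<exists>\<phi>. (\<forall>n. \<phi> n \<in> smooth_functions) \<and> (\<lambda>n. sqnorm (\<lambda>X. u X - \<phi> n X)) \<longlonglongrightarrow> 0 \<and>
       (\<lambda>n. LINT x|\<nu>. (t x - \<phi> n (x, 0))\<^sup>2) \<longlonglongrightarrow> 0)"

text \<open>By the trace inequality the boundary values of an approximating sequence are Cauchy.\<close>

lemma is_trace_exists:
  assumes u: "u \<in> H"
  shows "\<exists>t. is_trace u t"
proof -
  obtain \<phi> where \<phi>: "\<And>n. \<phi> n \<in> smooth_functions" "(\<lambda>n. sqnorm (\<lambda>X. u X - \<phi> n X)) \<longlonglongrightarrow> 0"
    using H_approximating_sequence[OF u] by blast
  have "\<exists>t. square_integrable \<nu> t \<and> (\<lambda>n. LINT x|\<nu>. (norm (\<phi> n (x, 0) - t x))\<^sup>2) \<longlonglongrightarrow> 0"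
  proof (rule square_integrable_complete)
    show "square_integrable \<nu> (\<lambda>x. \<phi> n (x, 0))" for n using \<phi>(1)[of n] by (intro trace_inequality(1)) auto
    fix \<epsilon> :: real assume "0 < \<epsilon>"
    then have "0 < \<epsilon> / 64" by simp
    from LIMSEQ_D[OF \<phi>(2) this] obtain N where N: "\<And>n. n \<ge> N \<Longrightarrow> sqnorm (\<lambda>X. u X - \<phi> n X) < \<epsilon> / 64"
      by (auto simp: sqnorm_nonneg)
    have "(LINT x|\<nu>. (norm (\<phi> m (x, 0) - \<phi> n (x, 0)))\<^sup>2) \<le> \<epsilon>" if mn: "m \<ge> N" "n \<ge> N" for m n
    proof -
      have W: "\<phi> n \<in> W" for n using \<phi>(1) by blast
      have "(\<lambda>X. \<phi> m X - \<phi> n X) \<in> smooth_functions"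
        using smooth_functions_lin[OF \<phi>(1) \<phi>(1), of m "-1" n] by simp
      then have "(LINT x|\<nu>. (\<phi> m (x, 0) - \<phi> n (x, 0))\<^sup>2) \<le> 16 * sqnorm (\<lambda>X. \<phi> m X - \<phi> n X)"
        using trace_inequality(2)[of "\<lambda>X. \<phi> m X - \<phi> n X"] by blast
      also have "\<dots> \<le> 16 * (2 * sqnorm (\<lambda>X. \<phi> m X - u X) + 2 * sqnorm (\<lambda>X. u X - \<phi> n X))"
        by (intro mult_left_mono sqnorm_triangle W H_W12 u) simp
      also have "\<dots> \<le> \<epsilon>"
        using N[OF mn(1)] N[OF mn(2)] sqnorm_diff_commute[OF W H_W12[OF u], of m] by simp
      finally show ?thesis by simp
    qed
    then show "\<exists>N. \<forall>m\<ge>N. \<forall>n\<ge>N. (LINT x|\<nu>. (norm (\<phi> m (x, 0) - \<phi> n (x, 0)))\<^sup>2) \<le> \<epsilon>" by blast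
  qed
  then show ?thesis using \<phi> unfolding is_trace_def by (auto simp: power2_commute)
qed

lemma is_trace_bound:
  assumes u: "u \<in> H" and t: "is_trace u t"
  shows "(LINT x|\<nu>. (t x)\<^sup>2) \<le> 64 * sqnorm u"
proof -
  obtain \<phi> where \<phi>: "\<And>n. \<phi> n \<in> smooth_functions" "(\<lambda>n. sqnorm (\<lambda>X. u X - \<phi> n X)) \<longlonglongrightarrow> 0"
    "(\<lambda>n. LINT x|\<nu>. (t x - \<phi> n (x, 0))\<^sup>2) \<longlonglongrightarrow> 0" and sq: "square_integrable \<nu> t"
    using t unfolding is_trace_def by blast
  have "(LINT x|\<nu>. (t x)\<^sup>2) \<le> 2 * (LINT x|\<nu>. (t x - \<phi> n (x, 0))\<^sup>2) + 64 * sqnorm u + 64 * sqnorm (\<lambda>X. u X - \<phi> n X)" for n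
  proof -
    have W: "\<phi> n \<in> W" using \<phi>(1) by blast
    have sq': "square_integrable \<nu> (\<lambda>x. \<phi> n (x, 0))" using \<phi>(1)[of n] by (intro trace_inequality(1)) auto
    have "(LINT x|\<nu>. (t x)\<^sup>2) \<le> 2 * (LINT x|\<nu>. (t x - \<phi> n (x, 0))\<^sup>2) + 2 * (LINT x|\<nu>. (\<phi> n (x, 0))\<^sup>2)"
      using integral_norm_add_squared_le[OF square_integrable_diff[OF sq sq'] sq'] by simp
    moreover have "(LINT x|\<nu>. (\<phi> n (x, 0))\<^sup>2) \<le> 16 * sqnorm (\<phi> n)"
      using \<phi>(1)[of n] by (intro trace_inequality(2)) auto
    moreover have "sqnorm (\<phi> n) \<le> 2 * sqnorm (\<lambda>X. \<phi> n X - u X) + 2 * sqnorm u"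
      using sqnorm_add_le[OF W12_diff[OF W H_W12[OF u]] H_W12[OF u]] by simp
    moreover have "sqnorm (\<lambda>X. \<phi> n X - u X) = sqnorm (\<lambda>X. u X - \<phi> n X)"
      by (rule sqnorm_diff_commute[OF W H_W12[OF u]])
    ultimately show ?thesis by simp
  qed
  moreover have "(\<lambda>n. 2 * (LINT x|\<nu>. (t x - \<phi> n (x, 0))\<^sup>2) + 64 * sqnorm u + 64 * sqnorm (\<lambda>X. u X - \<phi> n X))
      \<longlonglongrightarrow> 2 * 0 + 64 * sqnorm u + 64 * 0"
    by (intro tendsto_add tendsto_mult tendsto_const \<phi>(2,3))
  ultimately show ?thesis by (intro LIMSEQ_le_const) auto
qed

lemma is_trace_lin:
  assumes u: "u \<in> H" "is_trace u t" and v: "v \<in> H" "is_trace v r"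
  shows "is_trace (\<lambda>X. u X + c * v X) (\<lambda>x. t x + c * r x)"
proof -
  obtain \<phi> where \<phi>: "\<And>n. \<phi> n \<in> smooth_functions" "(\<lambda>n. sqnorm (\<lambda>X. u X - \<phi> n X)) \<longlonglongrightarrow> 0"
    "(\<lambda>n. LINT x|\<nu>. (t x - \<phi> n (x, 0))\<^sup>2) \<longlonglongrightarrow> 0" and t: "square_integrable \<nu> t"
    using u(2) unfolding is_trace_def by blast
  obtain \<psi> where \<psi>: "\<And>n. \<psi> n \<in> smooth_functions" "(\<lambda>n. sqnorm (\<lambda>X. v X - \<psi> n X)) \<longlonglongrightarrow> 0"
    "(\<lambda>n. LINT x|\<nu>. (r x - \<psi> n (x, 0))\<^sup>2) \<longlonglongrightarrow> 0" and r: "square_integrable \<nu> r"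
    using v(2) unfolding is_trace_def by blast
  have sq: "square_integrable \<nu> (\<lambda>x. \<phi> n (x, 0))" "square_integrable \<nu> (\<lambda>x. \<psi> n (x, 0))" for n
    using \<phi>(1)[of n] \<psi>(1)[of n] by (auto intro!: trace_inequality(1))
  let ?F = "\<lambda>n X. \<phi> n X + c * \<psi> n X"
  have "(\<lambda>n. sqnorm (\<lambda>X. (u X - \<phi> n X) + c * (v X - \<psi> n X))) \<longlonglongrightarrow> 0"
    by (rule sqnorm_lin_tendsto_0[OF _ _ \<phi>(2) \<psi>(2)]) (use u v \<phi>(1) \<psi>(1) in \<open>auto intro: W12_diff[OF H_W12]\<close>)
  moreover have "(\<lambda>X. (u X - \<phi> n X) + c * (v X - \<psi> n X)) = (\<lambda>X. (u X + c * v X) - ?F n X)" for n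
    by (simp add: fun_eq_iff algebra_simps)
  ultimately have lim1: "(\<lambda>n. sqnorm (\<lambda>X. (u X + c * v X) - ?F n X)) \<longlonglongrightarrow> 0" by simp
  have lim2: "(\<lambda>n. LINT x|\<nu>. (t x + c * r x - ?F n (x, 0))\<^sup>2) \<longlonglongrightarrow> 0"
  proof (rule tendsto_sandwich[OF _ _ tendsto_const])
    have "(LINT x|\<nu>. (t x + c * r x - ?F n (x, 0))\<^sup>2)
        \<le> 2 * (LINT x|\<nu>. (t x - \<phi> n (x, 0))\<^sup>2) + 2 * (c\<^sup>2 * (LINT x|\<nu>. (r x - \<psi> n (x, 0))\<^sup>2))" for n
    proof -
      have "(LINT x|\<nu>. (t x + c * r x - ?F n (x, 0))\<^sup>2)
          = (LINT x|\<nu>. (norm ((t x - \<phi> n (x, 0)) + c *\<^sub>R (r x - \<psi> n (x, 0))))\<^sup>2)"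
        by (rule Bochner_Integration.integral_cong) (simp_all add: algebra_simps)
      also have "\<dots> \<le> 2 * (LINT x|\<nu>. (norm (t x - \<phi> n (x, 0)))\<^sup>2) + 2 * (LINT x|\<nu>. (norm (c *\<^sub>R (r x - \<psi> n (x, 0))))\<^sup>2)"
        by (rule integral_norm_add_squared_le[OF square_integrable_diff[OF t sq(1)]
          square_integrable_scale[OF square_integrable_diff[OF r sq(2)]]])
      also have "(\<lambda>x. (norm (c *\<^sub>R (r x - \<psi> n (x, 0))))\<^sup>2) = (\<lambda>x. c\<^sup>2 * (r x - \<psi> n (x, 0))\<^sup>2)"
        by (simp add: fun_eq_iff power_mult_distrib)
      finally show ?thesis by simp
    qed
    then show "\<forall>\<^sub>F n in sequentially. (LINT x|\<nu>. (t x + c * r x - ?F n (x, 0))\<^sup>2)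
        \<le> 2 * (LINT x|\<nu>. (t x - \<phi> n (x, 0))\<^sup>2) + 2 * (c\<^sup>2 * (LINT x|\<nu>. (r x - \<psi> n (x, 0))\<^sup>2))"
      by simp
    have "(\<lambda>n. 2 * (LINT x|\<nu>. (t x - \<phi> n (x, 0))\<^sup>2) + 2 * (c\<^sup>2 * (LINT x|\<nu>. (r x - \<psi> n (x, 0))\<^sup>2)))
        \<longlonglongrightarrow> 2 * 0 + 2 * (c\<^sup>2 * 0)"
      by (intro tendsto_add tendsto_mult tendsto_const \<phi>(3) \<psi>(3))
    then show "(\<lambda>n. 2 * (LINT x|\<nu>. (t x - \<phi> n (x, 0))\<^sup>2) + 2 * (c\<^sup>2 * (LINT x|\<nu>. (r x - \<psi> n (x, 0))\<^sup>2))) \<longlonglongrightarrow> 0"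
      by simp
  qed simp
  have "square_integrable \<nu> (\<lambda>x. t x + c * r x)"
    using square_integrable_add[OF t square_integrable_scale[OF r, of c]] by simp
  then show ?thesis
    unfolding is_trace_def using smooth_functions_lin[OF \<phi>(1) \<psi>(1)] lim1 lim2
    by (intro conjI exI[of _ ?F]) auto
qed

lemma AE_eq_0_of_integral_square:
  fixes t :: "'a \<Rightarrow> real"
  assumes "square_integrable \<nu> t" "(LINT x|\<nu>. (t x)\<^sup>2) \<le> 0"
  shows "AE x in lebesgue_on \<Omega>. t x = 0"
proof -
  have "0 \<le> (LINT x|\<nu>. (t x)\<^sup>2)" by simp
  with assms(2) have "(LINT x|\<nu>. (t x)\<^sup>2) = 0" by linarith
  then have "AE x in \<nu>. (t x)\<^sup>2 = 0"
    using assms(1) by (subst (asm) integral_nonneg_eq_0_iff_AE) (auto simp: square_integrable_def)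
  then show ?thesis by (simp add: AE_weighted_measure[OF wt_weight])
qed

text \<open>
  The difference of two traces of \<open>u\<close> is a trace of 0, to which the bound applies.
\<close>

lemma is_trace_unique:
  assumes u: "u \<in> H" and t: "is_trace u t" and r: "is_trace u r"
  shows "AE x in lebesgue_on \<Omega>. t x = r x"
proof -
  let ?d = "\<lambda>x. t x + (-1) * r x"
  have "is_trace (\<lambda>X. u X + (-1) * u X) ?d" by (rule is_trace_lin[OF u t u r])
  then have d: "is_trace (\<lambda>X. 0) ?d" by simp
  have "(LINT x|\<nu>. (?d x)\<^sup>2) \<le> 64 * sqnorm (\<lambda>X. 0)"
    using H_scale[OF u, of 0] by (intro is_trace_bound[OF _ d]) simp
  also have "sqnorm (\<lambda>X. 0) = 0" using sqnorm_scale(2)[OF H_W12[OF u], of 0] by simp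
  finally have "AE x in lebesgue_on \<Omega>. ?d x = 0"
    using d by (intro AE_eq_0_of_integral_square) (auto simp: is_trace_def)
  then show ?thesis by eventually_elim simp
qed

lemma is_trace_smooth:
  assumes "\<phi> \<in> smooth_functions"
  shows "is_trace \<phi> (\<lambda>x. \<phi> (x, 0))"
proof -
  have "sqnorm (\<lambda>X. \<phi> X - \<phi> X) = 0" using sqnorm_scale(2)[of \<phi> 0] assms by simp
  then show ?thesis
    unfolding is_trace_def using assms trace_inequality(1)[of \<phi>]
    by (intro conjI exI[of _ "\<lambda>n. \<phi>"]) auto
qed

end

section \<open>The Dirichlet form\<close>

locale fractional_extension = fractional_weight +
  assumes poincare: "\<exists>C>0. \<forall>u\<in>H0L \<Omega> w.
    L2_norm (cylinder \<Omega>) w u \<le> C * L2_norm (cylinder \<Omega>) w (\<lambda>X. norm (weak_gradient (cylinder \<Omega>) u X))"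
begin

definition form :: "('a \<times> real \<Rightarrow> real) \<Rightarrow> ('a \<times> real \<Rightarrow> real) \<Rightarrow> real" where
  "form u v = (LINT X|\<mu>. grad u X \<bullet> grad v X)"

abbreviation "dirichlet u \<equiv> form u u"

lemma grad_square_integrable: "u \<in> H \<Longrightarrow> square_integrable \<mu> (grad u)"
  by (rule W12_square_integrable(3)[OF H_W12])

lemma grad_measurable: "u \<in> H \<Longrightarrow> grad u \<in> borel_measurable (lebesgue_on (cylinder \<Omega>))"
  using grad_square_integrable by (simp add: square_integrable_def)

lemma form_commute: "form u v = form v u"
  by (simp add: form_def inner_commute)

lemma form_nonneg: "0 \<le> form u u"
  by (simp add: form_def)

lemma form_self: "form u u = (LINT X|\<mu>. (norm (grad u X))\<^sup>2)"
  by (simp add: form_def power2_norm_eq_inner)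

lemma form_lin:
  assumes u: "u \<in> H" and v: "v \<in> H" and z: "z \<in> H"
  shows "form (\<lambda>X. u X + c * v X) z = form u z + c * form v z"
    and "form z (\<lambda>X. u X + c * v X) = form z u + c * form z v"
proof -
  note [measurable] = grad_measurable[OF u] grad_measurable[OF v] grad_measurable[OF z]
    grad_measurable[OF H_lin[OF u v]]
  have "form (\<lambda>X. u X + c * v X) z = (LINT X|\<mu>. grad u X \<bullet> grad z X + c * (grad v X \<bullet> grad z X))"
    unfolding form_def
  proof (rule integral_cong_AE)
    show "AE X in \<mu>. grad (\<lambda>X. u X + c * v X) X \<bullet> grad z X = grad u X \<bullet> grad z X + c * (grad v X \<bullet> grad z X)"
      using grad_lin[OF H_W12[OF u] H_W12[OF v], of c] by eventually_elim (simp add: inner_add_left)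
  qed simp_all
  also have "\<dots> = form u z + c * form v z"
    unfolding form_def using square_integrable_inner[OF grad_square_integrable[OF u] grad_square_integrable[OF z]]
      square_integrable_inner[OF grad_square_integrable[OF v] grad_square_integrable[OF z]]
    by simp
  finally show "form (\<lambda>X. u X + c * v X) z = form u z + c * form v z" .
  then show "form z (\<lambda>X. u X + c * v X) = form z u + c * form z v" by (simp add: form_commute)
qed

lemma form_Cauchy_Schwarz: "u \<in> H \<Longrightarrow> v \<in> H \<Longrightarrow> (form u v)\<^sup>2 \<le> form u u * form v v"
  unfolding form_self form_def[of u v] by (intro integral_Cauchy_Schwarz grad_square_integrable)

lemma form_quadratic:
  assumes u: "u \<in> H" and v: "v \<in> H"
  shows "dirichlet (\<lambda>X. u X + c * v X) = form u u + 2 * c * form u v + c\<^sup>2 * form v v"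
  using u v H_lin[OF u v, of c]
  by (simp add: form_lin form_commute[of v u] power2_eq_square algebra_simps)

lemma H0L_norm_eq: "u \<in> H \<Longrightarrow> H0L_norm \<Omega> w u = sqrt (form u u)"
  unfolding H0L_norm_def L2_norm_def form_self using grad_measurable
  by (subst integral_weighted_measure[OF U weight]) auto

lemma energy_eq: 
  assumes u: "u \<in> H"
  shows "energy \<Omega> w u = form u u / 2"
proof -
  note [measurable] = grad_measurable[OF u]
  have "(LINT X|\<mu>. (norm (grad u X))\<^sup>2) = (LINT X:cylinder \<Omega>|lebesgue. (norm (grad u X))\<^sup>2 * w X)"
    by (rule integral_weighted_measure[OF U weight]) measurable
  then show ?thesis by (simp add: energy_def form_self mult.commute)
qed

lemma form_eq_weighted_integral:
  assumes u: "u \<in> H" and v: "v \<in> H"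
  shows "(LINT X:cylinder \<Omega>|lebesgue. w X * (grad u X \<bullet> grad v X)) = form u v"
proof -
  note [measurable] = grad_measurable[OF u] grad_measurable[OF v]
  have "form u v = (LINT X:cylinder \<Omega>|lebesgue. (grad u X \<bullet> grad v X) * w X)"
    unfolding form_def by (rule integral_weighted_measure[OF U weight]) measurable
  then show ?thesis by (simp add: mult.commute)
qed

lemma sqnorm_eq: "u \<in> H \<Longrightarrow> sqnorm u = (LINT X|\<mu>. (u X)\<^sup>2) + form u u"
  unfolding form_self sqnorm_def norm_jet_squared
  using W12_square_integrable(2,3)[OF H_W12] by (simp add: square_integrable_def)

lemma form_le_sqnorm: "u \<in> H \<Longrightarrow> form u u \<le> sqnorm u"
  by (simp add: sqnorm_eq)

text \<open>
  The Poincare inequality in the form in which it is used: the gradient controls the whole Sobolev norm.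
\<close>

lemma sqnorm_le_form: "\<exists>K>0. \<forall>u\<in>H. sqnorm u \<le> K * form u u"
proof -
  obtain C where C: "0 < C" "\<And>u. u \<in> H \<Longrightarrow> L2_norm (cylinder \<Omega>) w u \<le> C * H0L_norm \<Omega> w u"
    using poincare by (auto simp: H0L_norm_def)
  have "sqnorm u \<le> (C\<^sup>2 + 1) * form u u" if u: "u \<in> H" for u
  proof -
    have [measurable]: "u \<in> borel_measurable (lebesgue_on (cylinder \<Omega>))"
      using W12_square_integrable(2)[OF H_W12[OF u]] by (simp add: square_integrable_def)
    have u2: "u \<in> L2 (cylinder \<Omega>) w" using H_W12[OF u] by (simp add: W12_def)
    have "0 \<le> (LINT X|\<mu>. (u X)\<^sup>2)" by simp
    then have "0 \<le> L2_norm (cylinder \<Omega>) w u"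
      using integral_weighted_measure[OF U weight, of "\<lambda>X. (u X)\<^sup>2"] by (simp add: L2_norm_def)
    then have "(L2_norm (cylinder \<Omega>) w u)\<^sup>2 \<le> (C * H0L_norm \<Omega> w u)\<^sup>2"
      using C(2)[OF u] by (intro power_mono)
    then have "(LINT X|\<mu>. (u X)\<^sup>2) \<le> C\<^sup>2 * form u u"
      using L2_norm_squared[OF U weight u2] form_nonneg by (simp add: H0L_norm_eq[OF u] power_mult_distrib)
    then show ?thesis by (simp add: sqnorm_eq[OF u] algebra_simps)
  qed
  moreover have "0 < C\<^sup>2 + 1" by (simp add: add_nonneg_pos)
  ultimately show ?thesis by blast
qed

text \<open>
  The trace map is defined by choice, so nothing is known about it until an operator with the required
  properties has been exhibited.
\<close>

lemma trace_operator_exists: "\<exists>T. trace_operator \<Omega> w wt T"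
proof -
  define T where "T u = (SOME t. is_trace u t)" for u
  have T: "is_trace u (T u)" if "u \<in> H" for u
    unfolding T_def by (rule someI_ex[OF is_trace_exists[OF that]])
  obtain K where K: "0 < K" "\<And>u. u \<in> H \<Longrightarrow> sqnorm u \<le> K * form u u" using sqnorm_le_form by blast
  have L2: "T u \<in> L2 \<Omega> wt" if "u \<in> H" for u
    using T[OF that] by (simp add: is_trace_def L2_iff_square_integrable[OF \<Omega> wt_weight])
  have lin: "AE x in lebesgue_on \<Omega>. T (\<lambda>X. u X + c * v X) x = T u x + c * T v x" if "u \<in> H" "v \<in> H" for u v c
    using is_trace_unique[OF H_lin[OF that] T[OF H_lin[OF that]] is_trace_lin[OF that(1) T[OF that(1)] that(2) T[OF that(2)]]] .
  have "trace_operator \<Omega> w wt T"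
    unfolding trace_operator_def
  proof (intro conjI ballI allI)
    show "T u \<in> L2 \<Omega> wt" if "u \<in> H" for u by (rule L2[OF that])
    show "AE x in lebesgue_on \<Omega>. T (\<lambda>X. u X + v X) x = T u x + T v x" if "u \<in> H" "v \<in> H" for u v
      using lin[OF that, of 1] by simp
    show "AE x in lebesgue_on \<Omega>. T (\<lambda>X. c * u X) x = c * T u x" if "u \<in> H" for u c
    proof -
      have "(\<lambda>X. u X + (c - 1) * u X) = (\<lambda>X. c * u X)" by (simp add: fun_eq_iff algebra_simps)
      then show ?thesis using lin[OF that that, of "c - 1"] by (simp add: algebra_simps)
    qed
    show "\<exists>B. \<forall>u\<in>H. L2_norm \<Omega> wt (T u) \<le> B * H0L_norm \<Omega> w u"
    proof (intro exI ballI)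
      fix u assume u: "u \<in> H"
      have "(L2_norm \<Omega> wt (T u))\<^sup>2 \<le> 64 * sqnorm u"
        using is_trace_bound[OF u T[OF u]] L2_norm_squared[OF \<Omega> wt_weight L2[OF u]] by simp
      also have "\<dots> \<le> 64 * (K * form u u)" using K(2)[OF u] by simp
      finally have "L2_norm \<Omega> wt (T u) \<le> sqrt (64 * K * form u u)" by (intro real_le_rsqrt) simp
      then show "L2_norm \<Omega> wt (T u) \<le> sqrt (64 * K) * H0L_norm \<Omega> w u"
        by (simp add: H0L_norm_eq[OF u] real_sqrt_mult)
    qed
    show "AE x in lebesgue_on \<Omega>. T u x = u (x, 0)" if "u \<in> H \<inter> Cc_cylinder \<Omega>" for u
      using that is_trace_unique[of u "T u" "\<lambda>x. u (x, 0)"] T[of u] is_trace_smooth[of u] H_W12[of u] by simp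
  qed
  then show ?thesis by blast
qed

abbreviation "tr \<equiv> trace_map \<Omega> w wt"

lemma tr: "trace_operator \<Omega> w wt tr"
  unfolding trace_map_def by (rule someI_ex[OF trace_operator_exists])

lemma tr_L2: "u \<in> H \<Longrightarrow> tr u \<in> L2 \<Omega> wt" and tr_square_integrable: "u \<in> H \<Longrightarrow> square_integrable \<nu> (tr u)"
  using tr by (simp_all add: trace_operator_def L2_iff_square_integrable[OF \<Omega> wt_weight])

lemma tr_lin:
  assumes "u \<in> H" "v \<in> H"
  shows "AE x in lebesgue_on \<Omega>. tr (\<lambda>X. u X + c * v X) x = tr u x + c * tr v x"
proof -
  have add: "AE x in lebesgue_on \<Omega>. tr (\<lambda>X. u X + v X) x = tr u x + tr v x" if "u \<in> H" "v \<in> H" for u v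
    using tr that unfolding trace_operator_def by blast
  have "AE x in lebesgue_on \<Omega>. tr (\<lambda>X. u X + c * v X) x = tr u x + tr (\<lambda>X. c * v X) x"
    by (rule add[OF assms(1) H_scale[OF assms(2)]])
  moreover have "AE x in lebesgue_on \<Omega>. tr (\<lambda>X. c * v X) x = c * tr v x"
    using tr assms unfolding trace_operator_def by blast
  ultimately show ?thesis by eventually_elim simp
qed

lemma tr_bound: "\<exists>K\<ge>0. \<forall>u\<in>H. (LINT x|\<nu>. (tr u x)\<^sup>2) \<le> K * form u u"
proof -
  obtain B where B: "\<And>u. u \<in> H \<Longrightarrow> L2_norm \<Omega> wt (tr u) \<le> B * H0L_norm \<Omega> w u"
    using tr unfolding trace_operator_def by blast
  have "(LINT x|\<nu>. (tr u x)\<^sup>2) \<le> B\<^sup>2 * form u u" if u: "u \<in> H" for u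
  proof -
    have [measurable]: "tr u \<in> borel_measurable (lebesgue_on \<Omega>)" using tr_L2[OF u] by (simp add: L2_def)
    have "L2_norm \<Omega> wt (tr u) = sqrt (LINT x|\<nu>. (tr u x)\<^sup>2)"
      unfolding L2_norm_def by (subst integral_weighted_measure[OF \<Omega> wt_weight]) simp_all
    then have "0 \<le> L2_norm \<Omega> wt (tr u)" by simp
    then have "(L2_norm \<Omega> wt (tr u))\<^sup>2 \<le> (B * H0L_norm \<Omega> w u)\<^sup>2" using B[OF u] by (intro power_mono)
    then show ?thesis
      using L2_norm_squared[OF \<Omega> wt_weight tr_L2[OF u]] form_nonneg by (simp add: H0L_norm_eq[OF u] power_mult_distrib)
  qed
  then show ?thesis by (intro exI[of _ "B\<^sup>2"]) simp
qed

section \<open>Minimisation of quadratic functionals\<close>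

text \<open>Completeness of \<open>H\<close> for the norm given by the gradient alone.\<close>

lemma form_sequence_limit:
  assumes F: "\<And>n. F n \<in> H"
    and cauchy: "\<And>\<epsilon>. 0 < \<epsilon> \<Longrightarrow>
      \<exists>N. \<forall>m\<ge>N. \<forall>n\<ge>N. dirichlet (\<lambda>X. F m X - F n X) \<le> \<epsilon>"
  shows "\<exists>u\<in>H. (\<lambda>n. dirichlet (\<lambda>X. F n X - u X)) \<longlonglongrightarrow> 0"
proof -
  obtain K where K: "0 < K" "\<And>u. u \<in> H \<Longrightarrow> sqnorm u \<le> K * form u u" using sqnorm_le_form by blast
  have "\<exists>u\<in>W. (\<lambda>n. sqnorm (\<lambda>X. F n X - u X)) \<longlonglongrightarrow> 0"
  proof (rule W12_complete)
    show "F n \<in> W" for n by (rule H_W12[OF F])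
    fix \<epsilon> :: real assume "0 < \<epsilon>"
    then obtain N where N: "\<forall>m\<ge>N. \<forall>n\<ge>N. dirichlet (\<lambda>X. F m X - F n X) \<le> \<epsilon> / K"
      using cauchy[of "\<epsilon> / K"] K(1) by auto
    have "sqnorm (\<lambda>X. F m X - F n X) \<le> \<epsilon>" if "m \<ge> N" "n \<ge> N" for m n
    proof -
      have "sqnorm (\<lambda>X. F m X - F n X) \<le> K * dirichlet (\<lambda>X. F m X - F n X)"
        by (rule K(2)[OF H_diff[OF F F]])
      also have "\<dots> \<le> K * (\<epsilon> / K)" using N that K(1) by (intro mult_left_mono) auto
      finally show ?thesis using K(1) by simp
    qed
    then show "\<exists>N. \<forall>m\<ge>N. \<forall>n\<ge>N. sqnorm (\<lambda>X. F m X - F n X) \<le> \<epsilon>" by blast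
  qed
  then obtain u where u: "u \<in> W" "(\<lambda>n. sqnorm (\<lambda>X. F n X - u X)) \<longlonglongrightarrow> 0" by blast
  have uH: "u \<in> H" by (rule H_closed[OF F u])
  have "(\<lambda>n. dirichlet (\<lambda>X. F n X - u X)) \<longlonglongrightarrow> 0"
    by (rule tendsto_sandwich[OF _ _ tendsto_const u(2)])
      (auto intro!: always_eventually form_nonneg form_le_sqnorm H_diff F uH)
  with uH show ?thesis by blast
qed

text \<open>
  A minimising sequence of \<open>J u = form u u / 2 - l u\<close> is Cauchy by the parallelogram identity, since
  the set contains the midpoints of its elements, and the set contains the limit because it is closed.
  The two instances are the whole space, which gives the Riesz representation of \<open>l\<close>, and an equivalence
  class with \<open>l = 0\<close>, which gives the energy-minimising extension.
\<close>

lemma quadratic_minimum_exists: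
  assumes A: "A \<subseteq> H" "A \<noteq> {}"
    and mid: "\<And>u v. u \<in> A \<Longrightarrow> v \<in> A \<Longrightarrow> (\<lambda>X. u X + (1/2) * (v X - u X)) \<in> A"
    and closed: "\<And>F u. (\<And>n. F n \<in> A) \<Longrightarrow> u \<in> H \<Longrightarrow>
      (\<lambda>n. dirichlet (\<lambda>X. F n X - u X)) \<longlonglongrightarrow> 0 \<Longrightarrow> u \<in> A"
    and l_lin: "\<And>u v c. u \<in> H \<Longrightarrow> v \<in> H \<Longrightarrow> l (\<lambda>X. u X + c * v X) = l u + c * l v"
    and K: "0 \<le> K" and l_bound: "\<And>u. u \<in> H \<Longrightarrow> (l u)\<^sup>2 \<le> K * form u u"
  shows "\<exists>u\<in>A. \<forall>v\<in>A. form u u / 2 - l u \<le> form v v / 2 - l v"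
proof -
  define J where "J u = form u u / 2 - l u" for u
  define d where "d u v = (\<lambda>X. v X - u X)" for u v :: "'a \<times> real \<Rightarrow> real"
  have dH: "d u v \<in> H" if "u \<in> H" "v \<in> H" for u v unfolding d_def by (rule H_diff[OF that(2,1)])
  have expand: "J (\<lambda>X. u X + c * d u v X) = J u + c * (form u (d u v) - l (d u v)) + c\<^sup>2 / 2 * dirichlet (d u v)"
    if "u \<in> H" "v \<in> H" for u v c
    using form_quadratic[OF that(1) dH[OF that], of c] l_lin[OF that(1) dH[OF that], of c]
    by (simp add: J_def algebra_simps add_divide_distrib)
  have J_end: "J v = J u + (form u (d u v) - l (d u v)) + dirichlet (d u v) / 2" if "u \<in> H" "v \<in> H" for u v
    using expand[OF that, of 1] by (simp add: d_def)
  have parallelogram: "J (\<lambda>X. u X + (1/2) * (v X - u X)) = (J u + J v) / 2 - dirichlet (d u v) / 8"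
    if "u \<in> H" "v \<in> H" for u v
    using expand[OF that, of "1/2"] J_end[OF that] by (simp add: d_def power2_eq_square field_simps)
  \<comment> \<open>The bound on \<open>l\<close> and the inequality of means give \<open>l u \<le> (K + form u u) / 2\<close>.\<close>
  have below: "- (K / 2) \<le> J u" if u: "u \<in> H" for u
  proof -
    have "(l u)\<^sup>2 \<le> K * form u u" by (rule l_bound[OF u])
    also have "\<dots> \<le> ((K + form u u) / 2)\<^sup>2"
      using zero_le_power2[of "K - form u u"] by (simp add: power2_eq_square field_simps)
    finally have "l u \<le> (K + form u u) / 2"
      using K form_nonneg[of u] by (intro power2_le_imp_le[of "l u"]) auto
    then show ?thesis by (simp add: J_def field_simps)
  qed
  define m where "m = Inf (J ` A)"
  have bdd: "bdd_below (J ` A)" using below A(1) by (intro bdd_belowI2[of _ "- (K / 2)"]) auto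
  have m_le: "m \<le> J u" if "u \<in> A" for u unfolding m_def by (rule cINF_lower[OF bdd that])
  have "\<exists>u\<in>A. J u < m + inverse (real (Suc n))" for n
    using cInf_lessD[of "J ` A" "m + inverse (real (Suc n))"] A(2) by (auto simp: m_def)
  then obtain F where F: "\<And>n. F n \<in> A" "\<And>n. J (F n) < m + inverse (real (Suc n))" by metis
  have FH: "F n \<in> H" for n using F(1) A(1) by blast
  have "\<exists>u\<in>H. (\<lambda>n. dirichlet (\<lambda>X. F n X - u X)) \<longlonglongrightarrow> 0"
  proof (rule form_sequence_limit[OF FH])
    fix \<epsilon> :: real assume "0 < \<epsilon>"
    then have "0 < \<epsilon> / 8" by simp
    then obtain N where N: "inverse (real (Suc N)) < \<epsilon> / 8" using reals_Archimedean by blast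
    have "dirichlet (\<lambda>X. F i X - F j X) \<le> \<epsilon>" if "i \<ge> N" "j \<ge> N" for i j
    proof -
      have "inverse (real (Suc i)) \<le> inverse (real (Suc N))" "inverse (real (Suc j)) \<le> inverse (real (Suc N))"
        using that by (auto intro!: le_imp_inverse_le)
      then have "J (F i) < m + \<epsilon> / 8" "J (F j) < m + \<epsilon> / 8" using F(2)[of i] F(2)[of j] N by linarith+
      moreover have "m \<le> (J (F j) + J (F i)) / 2 - dirichlet (d (F j) (F i)) / 8"
        using m_le[OF mid[OF F(1)[of j] F(1)[of i]]] unfolding parallelogram[OF FH FH] .
      ultimately have "dirichlet (d (F j) (F i)) / 8 \<le> \<epsilon> / 8" by argo
      then have "dirichlet (d (F j) (F i)) \<le> \<epsilon>" by simp
      then show ?thesis by (simp add: d_def)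
    qed
    then show "\<exists>N. \<forall>i\<ge>N. \<forall>j\<ge>N. dirichlet (\<lambda>X. F i X - F j X) \<le> \<epsilon>" by blast
  qed
  then obtain u where u: "u \<in> H" and lim: "(\<lambda>n. dirichlet (d u (F n))) \<longlonglongrightarrow> 0"
    unfolding d_def by blast
  have uA: "u \<in> A" by (rule closed[OF F(1) u]) (use lim in \<open>simp add: d_def\<close>)
  define q where "q n = dirichlet (d u (F n))" for n
  have q: "0 \<le> q n" for n by (simp add: q_def form_nonneg)
  \<comment> \<open>Lower semicontinuity: the first-order terms of \<open>J (F n) - J u\<close> are controlled by Cauchy--Schwarz.\<close>
  have bound: "J u \<le> m + inverse (real (Suc n)) + (sqrt (form u u * q n) + sqrt (K * q n))" for n
  proof -
    have "J (F n) = J u + (form u (d u (F n)) - l (d u (F n))) + q n / 2"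
      unfolding q_def by (rule J_end[OF u FH])
    moreover have "\<bar>form u (d u (F n))\<bar> \<le> sqrt (form u u * q n)"
      unfolding q_def by (intro real_le_rsqrt) (simp add: form_Cauchy_Schwarz u dH FH)
    moreover have "\<bar>l (d u (F n))\<bar> \<le> sqrt (K * q n)"
      unfolding q_def by (intro real_le_rsqrt) (simp add: l_bound u dH FH)
    ultimately show ?thesis using F(2)[of n] q[of n] by linarith
  qed
  have "(\<lambda>n. m + inverse (real (Suc n)) + (sqrt (form u u * q n) + sqrt (K * q n)))
      \<longlonglongrightarrow> m + 0 + (sqrt (form u u * 0) + sqrt (K * 0))"
    using lim unfolding q_def[symmetric]
    by (intro tendsto_add tendsto_const tendsto_real_sqrt tendsto_mult LIMSEQ_inverse_real_of_nat)
  then have "J u \<le> m" using bound by (intro LIMSEQ_le_const) auto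
  then have "\<forall>v\<in>A. J u \<le> J v" using m_le by (blast intro: order_trans)
  then show ?thesis using uA by (auto simp: J_def)
qed

text \<open>
  Along the line \<open>u + t \<psi>\<close> the functional is a quadratic polynomial in \<open>t\<close> with minimum at 0, so its
  linear coefficient vanishes.
\<close>

lemma quadratic_minimum_stationary:
  assumes u: "u \<in> H" and \<psi>: "\<psi> \<in> H"
    and l_lin: "\<And>u v c. u \<in> H \<Longrightarrow> v \<in> H \<Longrightarrow> l (\<lambda>X. u X + c * v X) = l u + c * l v"
    and min: "\<And>t. form u u / 2 - l u \<le> dirichlet (\<lambda>X. u X + t * \<psi> X) / 2 - l (\<lambda>X. u X + t * \<psi> X)"
  shows "form u \<psi> = l \<psi>"
proof -
  have "(form u \<psi> - l \<psi>)\<^sup>2 \<le> 0 * form \<psi> \<psi>"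
  proof (rule nonneg_quadratic_discriminant)
    show "0 \<le> 0 + 2 * t * (form u \<psi> - l \<psi>) + t\<^sup>2 * form \<psi> \<psi>" for t
      using min[of t] unfolding form_quadratic[OF u \<psi>] l_lin[OF u \<psi>] by (simp add: field_simps)
  qed (rule form_nonneg)
  then show ?thesis by simp
qed

end

section \<open>The trace space and the operator\<close>

context fractional_extension
begin

abbreviation "Y \<equiv> Y_space \<Omega> w wt"
abbreviation "cls \<equiv> TR \<Omega> w wt"
abbreviation "Ker \<equiv> W0 \<Omega> w wt"
abbreviation "S \<equiv> minimizer \<Omega> w wt"
abbreviation "Lap \<equiv> frac_laplacian \<Omega> w wt"

lemma W0_iff: "u \<in> Ker \<longleftrightarrow> u \<in> H \<and> (AE x in lebesgue_on \<Omega>. tr u x = 0)"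
  by (simp add: W0_def)

lemma W0_lin:
  assumes "u \<in> Ker" "v \<in> Ker"
  shows "(\<lambda>X. u X + c * v X) \<in> Ker"
proof -
  have u: "u \<in> H" "AE x in lebesgue_on \<Omega>. tr u x = 0" and v: "v \<in> H" "AE x in lebesgue_on \<Omega>. tr v x = 0"
    using assms by (auto simp: W0_iff)
  have "AE x in lebesgue_on \<Omega>. tr (\<lambda>X. u X + c * v X) x = 0"
    using tr_lin[OF u(1) v(1), of c] u(2) v(2) by eventually_elim simp
  then show ?thesis using H_lin[OF u(1) v(1)] by (simp add: W0_iff)
qed

lemma zero_in_H: "(\<lambda>X. 0) \<in> H"
proof (rule smooth_in_H, rule IntI)
  show "(\<lambda>X. 0) \<in> Cc_cylinder \<Omega>" by (simp add: Cc_cylinder_def smooth_closure_def Ck_closure_const)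
  show "(\<lambda>X. 0) \<in> W"
  proof (rule W12I)
    show "has_weak_gradient (cylinder \<Omega>) (\<lambda>X. 0) (\<lambda>X. 0)"
      by (simp add: has_weak_gradient_def L1_loc_def set_integrable_def set_lebesgue_integral_def)
  qed (simp add: square_integrable_def)
qed

lemma W0_zero: "(\<lambda>X. 0) \<in> Ker"
proof -
  have "AE x in lebesgue_on \<Omega>. tr (\<lambda>X. 0 + (-1) * 0) x = 0"
    using tr_lin[OF zero_in_H zero_in_H, of "-1"] by eventually_elim simp
  then show ?thesis using zero_in_H by (simp add: W0_iff)
qed

lemma W0_scale: "u \<in> Ker \<Longrightarrow> (\<lambda>X. c * u X) \<in> Ker"
  using W0_lin[of u u "c - 1"] by (simp add: algebra_simps)

lemma W0_diff_commute: "(\<lambda>X. u X - v X) \<in> Ker \<Longrightarrow> (\<lambda>X. v X - u X) \<in> Ker"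
  using W0_scale[of "\<lambda>X. u X - v X" "-1"] by simp

lemma W0_trans:
  assumes "(\<lambda>X. u X - v X) \<in> Ker" "(\<lambda>X. v X - z X) \<in> Ker"
  shows "(\<lambda>X. u X - z X) \<in> Ker"
  using W0_lin[OF assms, of 1] by simp

lemma equiv_mod_W0: "equiv H (mod_W0 \<Omega> w wt)"
proof (rule equivI)
  show "mod_W0 \<Omega> w wt \<subseteq> H \<times> H" by (auto simp: mod_W0_def)
  show "refl_on H (mod_W0 \<Omega> w wt)" by (auto simp: refl_on_def mod_W0_def W0_zero)
  show "sym (mod_W0 \<Omega> w wt)" by (auto simp: sym_def mod_W0_def intro: W0_diff_commute)
  show "trans (mod_W0 \<Omega> w wt)" by (auto simp: trans_def mod_W0_def intro: W0_trans)
qed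

lemma cls_eq_iff: "u \<in> H \<Longrightarrow> v \<in> H \<Longrightarrow> cls u = cls v \<longleftrightarrow> (\<lambda>X. u X - v X) \<in> Ker"
  unfolding TR_def by (subst eq_equiv_class_iff[OF equiv_mod_W0]) (auto simp: mod_W0_def)

lemma cls_eq_iff_tr: "u \<in> H \<Longrightarrow> v \<in> H \<Longrightarrow> cls u = cls v \<longleftrightarrow> (AE x in lebesgue_on \<Omega>. tr u x = tr v x)"
proof -
  assume u: "u \<in> H" and v: "v \<in> H"
  have lin: "AE x in lebesgue_on \<Omega>. tr (\<lambda>X. u X - v X) x = tr u x - tr v x"
    using tr_lin[OF u v, of "-1"] by simp
  have "cls u = cls v \<longleftrightarrow> (AE x in lebesgue_on \<Omega>. tr (\<lambda>X. u X - v X) x = 0)"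
    using H_diff[OF u v] by (simp add: cls_eq_iff[OF u v] W0_iff)
  also have "\<dots> \<longleftrightarrow> (AE x in lebesgue_on \<Omega>. tr u x = tr v x)"
  proof
    assume "AE x in lebesgue_on \<Omega>. tr (\<lambda>X. u X - v X) x = 0"
    then show "AE x in lebesgue_on \<Omega>. tr u x = tr v x" using lin by eventually_elim simp
  next
    assume "AE x in lebesgue_on \<Omega>. tr u x = tr v x"
    then show "AE x in lebesgue_on \<Omega>. tr (\<lambda>X. u X - v X) x = 0" using lin by eventually_elim simp
  qed
  finally show ?thesis .
qed

lemma cls_in_Y: "u \<in> H \<Longrightarrow> cls u \<in> Y"
  by (simp add: Y_space_def TR_def quotientI)

lemma Y_cases:
  assumes "v \<in> Y"
  obtains u where "u \<in> H" "v = cls u"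
  using assms unfolding Y_space_def TR_def by (rule quotientE) blast

lemma in_cls_iff: "u \<in> H \<Longrightarrow> z \<in> cls u \<longleftrightarrow> z \<in> H \<and> cls z = cls u"
  using cls_eq_iff[of u z] by (auto simp: TR_def mod_W0_def)

lemma in_Y_iff: "v \<in> Y \<Longrightarrow> z \<in> v \<longleftrightarrow> z \<in> H \<and> cls z = v"
  using in_cls_iff by (metis Y_cases)

lemma some_in_Y: "v \<in> Y \<Longrightarrow> (SOME z. z \<in> v) \<in> H \<and> cls (SOME z. z \<in> v) = v"
proof -
  assume v: "v \<in> Y"
  then obtain u where "u \<in> v" using in_Y_iff by (metis Y_cases)
  then have "(SOME z. z \<in> v) \<in> v" by (rule someI[of "\<lambda>z. z \<in> v"])
  then show ?thesis by (simp only: in_Y_iff[OF v])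
qed

lemma Y_incl_cls: 
  assumes u: "u \<in> H"
  shows "AE x in lebesgue_on \<Omega>. Y_incl \<Omega> w wt (cls u) x = tr u x"
  unfolding Y_incl_def using some_in_Y[OF cls_in_Y[OF u]] cls_eq_iff_tr[OF _ u] by blast

lemma Y_incl_injective:
  assumes v: "v \<in> Y" "v' \<in> Y" and eq: "AE x in lebesgue_on \<Omega>. Y_incl \<Omega> w wt v x = Y_incl \<Omega> w wt v' x"
  shows "v = v'"
  using eq some_in_Y[OF v(1)] some_in_Y[OF v(2)] cls_eq_iff_tr[of "SOME z. z \<in> v" "SOME z. z \<in> v'"]
  by (simp add: Y_incl_def)

lemma Y_incl_L2: "v \<in> Y \<Longrightarrow> Y_incl \<Omega> w wt v \<in> L2 \<Omega> wt"
  unfolding Y_incl_def using some_in_Y tr_L2 by blast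

text \<open>
  The minimisation takes place in an equivalence class, which is closed because the trace is bounded.
  Competitors \<open>S v + t \<psi>\<close> with \<open>\<psi>\<close> of zero trace stay in the class, and stationarity in \<open>t\<close> is
  orthogonality.
\<close>

lemma minimizer:
  assumes v: "v \<in> Y"
  shows "S v \<in> H" "cls (S v) = v"
    and "\<And>\<psi>. \<psi> \<in> Ker \<Longrightarrow> form (S v) \<psi> = 0"
proof -
  obtain u0 where u0: "u0 \<in> H" "v = cls u0" using v by (rule Y_cases)
  let ?A = "{u \<in> H. cls u = v}"
  have A_iff: "u \<in> ?A \<longleftrightarrow> u \<in> H \<and> (AE x in lebesgue_on \<Omega>. tr u x = tr u0 x)" for u
    using cls_eq_iff_tr[OF _ u0(1)] u0(2) by blast
  have "\<exists>u\<in>?A. \<forall>v\<in>?A. form u u / 2 - 0 \<le> form v v / 2 - 0"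
  proof (rule quadratic_minimum_exists)
    show "?A \<noteq> {}" using u0 by blast
    show "(\<lambda>X. u X + (1/2) * (z X - u X)) \<in> ?A" if "u \<in> ?A" "z \<in> ?A" for u z
    proof -
      have uz: "u \<in> H" "z \<in> H" "AE x in lebesgue_on \<Omega>. tr u x = tr u0 x" "AE x in lebesgue_on \<Omega>. tr z x = tr u0 x"
        using that A_iff by blast+
      have "AE x in lebesgue_on \<Omega>. tr (\<lambda>X. z X - u X) x = tr z x - tr u x"
        using tr_lin[OF uz(2,1), of "-1"] by simp
      then have "AE x in lebesgue_on \<Omega>. tr (\<lambda>X. u X + (1/2) * (z X - u X)) x = tr u0 x"
        using tr_lin[OF uz(1) H_diff[OF uz(2,1)], of "1/2"] uz(3,4) by eventually_elim simp
      then show ?thesis using H_lin[OF uz(1) H_diff[OF uz(2,1)]] A_iff by blast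
    qed
    show "u \<in> ?A" if F: "\<And>n. F n \<in> ?A" and u: "u \<in> H"
      and lim: "(\<lambda>n. dirichlet (\<lambda>X. F n X - u X)) \<longlonglongrightarrow> 0" for F u
    proof -
      obtain K where K: "0 \<le> K" "\<And>u. u \<in> H \<Longrightarrow> (LINT x|\<nu>. (tr u x)\<^sup>2) \<le> K * form u u" using tr_bound by blast
      have FH: "F n \<in> H" "AE x in lebesgue_on \<Omega>. tr (F n) x = tr u0 x" for n using F A_iff by blast+
      have d: "(\<lambda>X. u0 X - u X) \<in> H" by (rule H_diff[OF u0(1) u])
      have "(LINT x|\<nu>. (tr (\<lambda>X. u0 X - u X) x)\<^sup>2) \<le> K * dirichlet (\<lambda>X. F n X - u X)" for n
      proof -
        have dn: "(\<lambda>X. F n X - u X) \<in> H" by (rule H_diff[OF FH(1) u])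
        have "AE x in lebesgue_on \<Omega>. tr (\<lambda>X. u0 X - u X) x = tr (\<lambda>X. F n X - u X) x"
          using tr_lin[OF u0(1) u, of "-1"] tr_lin[OF FH(1) u, of n "-1"] FH(2)[of n] by eventually_elim simp
        then have "(LINT x|\<nu>. (tr (\<lambda>X. u0 X - u X) x)\<^sup>2) = (LINT x|\<nu>. (tr (\<lambda>X. F n X - u X) x)\<^sup>2)"
          using tr_square_integrable[OF d] tr_square_integrable[OF dn]
          by (intro integral_cong_AE) (auto simp: AE_weighted_measure[OF wt_weight] square_integrable_def elim: eventually_mono)
        then show ?thesis using K(2)[OF dn] by simp
      qed
      then have "(LINT x|\<nu>. (tr (\<lambda>X. u0 X - u X) x)\<^sup>2) \<le> K * 0"
        by (intro LIMSEQ_le_const[OF tendsto_mult[OF tendsto_const lim]]) auto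
      then have "AE x in lebesgue_on \<Omega>. tr (\<lambda>X. u0 X - u X) x = 0"
        by (intro AE_eq_0_of_integral_square[OF tr_square_integrable[OF d]]) simp
      then have "(\<lambda>X. u0 X - u X) \<in> Ker" using d by (simp add: W0_iff)
      then have "cls u0 = cls u" using cls_eq_iff[OF u0(1) u] by simp
      then show ?thesis using u u0(2) by simp
    qed
    show "(0::real)\<^sup>2 \<le> 0 * form u u" for u by simp
  qed auto
  then obtain u where u: "u \<in> H" "cls u = v" "\<And>z. z \<in> H \<Longrightarrow> cls z = v \<Longrightarrow> form u u \<le> form z z" by auto
  have "\<exists>u. u \<in> H \<and> cls u = v \<and> (\<forall>u'\<in>H. cls u' = v \<longrightarrow> energy \<Omega> w u \<le> energy \<Omega> w u')"
    using u by (intro exI[of _ u]) (auto simp: energy_eq)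
  from someI_ex[OF this]
  have S: "S v \<in> H" "cls (S v) = v"
    "\<And>u'. u' \<in> H \<Longrightarrow> cls u' = v \<Longrightarrow> energy \<Omega> w (S v) \<le> energy \<Omega> w u'"
    by (auto simp: minimizer_def)
  show "S v \<in> H" "cls (S v) = v" by fact+
  fix \<psi> assume \<psi>: "\<psi> \<in> Ker"
  then have \<psi>H: "\<psi> \<in> H" by (simp add: W0_iff)
  show "form (S v) \<psi> = 0"
  proof (rule quadratic_minimum_stationary[OF S(1) \<psi>H, where l = "\<lambda>_. 0"])
    fix t
    let ?z = "\<lambda>X. S v X + t * \<psi> X"
    have z: "?z \<in> H" by (rule H_lin[OF S(1) \<psi>H])
    have "cls ?z = cls (S v)"
      using W0_scale[OF \<psi>, of t] by (simp add: cls_eq_iff[OF z S(1)])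
    then show "form (S v) (S v) / 2 - 0 \<le> form ?z ?z / 2 - 0"
      using S(2) S(3)[OF z] by (simp add: energy_eq[OF z] energy_eq[OF S(1)])
  qed simp
qed

text \<open>
  The quotient norm is an infimum over representatives, so it is enough to bound the functional by the
  norm of every representative.
\<close>

lemma Y_dualI:
  assumes F: "F \<in> extensional Y" "\<And>\<psi>. \<psi> \<in> H \<Longrightarrow> F (cls \<psi>) = l \<psi>"
    and lin: "\<And>u v c. u \<in> H \<Longrightarrow> v \<in> H \<Longrightarrow> l (\<lambda>X. u X + c * v X) = l u + c * l v"
    and K: "0 \<le> K" and bound: "\<And>u. u \<in> H \<Longrightarrow> (l u)\<^sup>2 \<le> K * form u u"
  shows "F \<in> Y_dual \<Omega> w wt"
proof -
  have scale: "l (\<lambda>X. c * u X) = c * l u" if "u \<in> H" for u c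
    using lin[OF that that, of "c - 1"] by (simp add: algebra_simps)
  have "\<bar>F z\<bar> \<le> sqrt K * Y_norm \<Omega> w z" if z: "z \<in> Y" for z
  proof -
    have ne: "z \<noteq> {}" using z by (metis Y_cases empty_iff in_cls_iff)
    have le: "\<bar>F z\<bar> \<le> sqrt K * H0L_norm \<Omega> w u" if "u \<in> z" for u
    proof -
      have u: "u \<in> H" "cls u = z" using that in_Y_iff[OF z] by blast+
      have "(l u)\<^sup>2 \<le> K * form u u" by (rule bound[OF u(1)])
      then have "\<bar>l u\<bar> \<le> sqrt (K * form u u)" by (intro real_le_rsqrt) simp
      then show ?thesis using F(2)[OF u(1)] u by (simp add: H0L_norm_eq real_sqrt_mult)
    qed
    show ?thesis
    proof (cases "K = 0")
      case True
      obtain u where "u \<in> z" using ne by blast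
      then show ?thesis using le[of u] True by simp
    next
      case False
      then have "0 < sqrt K" using K by simp
      then have "\<bar>F z\<bar> / sqrt K \<le> Y_norm \<Omega> w z"
        unfolding Y_norm_def using le ne by (intro cINF_greatest) (auto simp: field_simps)
      then show ?thesis using \<open>0 < sqrt K\<close> by (simp add: field_simps)
    qed
  qed
  then show ?thesis
    unfolding Y_dual_def using F(1) lin[of _ _ 1] scale
    by (auto simp: F(2) H_add H_scale intro!: exI[of _ "sqrt K"])
qed

text \<open>
  The functional does not depend on the representative, since \<open>S v\<close> is orthogonal to functions of zero
  trace. A functional on the quotient is determined by its values on classes and by being undefined
  elsewhere, so the description in the definition is satisfied by exactly one functional.
\<close>

lemma frac_laplacian:
  assumes v: "v \<in> Y"
  shows "Lap v \<in> Y_dual \<Omega> w wt"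
    and "\<And>\<psi>. \<psi> \<in> H \<Longrightarrow> Lap v (cls \<psi>) = form (S v) \<psi>"
proof -
  let ?S = "S v"
  note S = minimizer[OF v]
  let ?P = "\<lambda>F. F \<in> Y_dual \<Omega> w wt \<and> (\<forall>\<psi>\<in>H. F (cls \<psi>) =
    (LINT X:cylinder \<Omega>|lebesgue. w X * (weak_gradient (cylinder \<Omega>) ?S X \<bullet> weak_gradient (cylinder \<Omega>) \<psi> X)))"
  have P_iff: "?P F \<longleftrightarrow> F \<in> Y_dual \<Omega> w wt \<and> (\<forall>\<psi>\<in>H. F (cls \<psi>) = form ?S \<psi>)" for F
    using form_eq_weighted_integral[OF S(1)] by auto
  define F where "F = (\<lambda>z\<in>Y. form ?S (SOME u. u \<in> z))"
  have F: "F (cls \<psi>) = form ?S \<psi>" if \<psi>: "\<psi> \<in> H" for \<psi>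
  proof -
    let ?u = "SOME u. u \<in> cls \<psi>"
    have u: "?u \<in> H" "cls ?u = cls \<psi>" using some_in_Y[OF cls_in_Y[OF \<psi>]] by blast+
    then have "(\<lambda>X. ?u X - \<psi> X) \<in> Ker" using cls_eq_iff[OF u(1) \<psi>] by simp
    then have "form ?S (\<lambda>X. ?u X - \<psi> X) = 0" by (rule S(3))
    then show ?thesis using form_lin(2)[OF u(1) \<psi> S(1), of "-1"] cls_in_Y[OF \<psi>] by (simp add: F_def)
  qed
  have "F \<in> Y_dual \<Omega> w wt"
  proof (rule Y_dualI)
    show "F \<in> extensional Y" by (simp add: F_def)
    show "form ?S (\<lambda>X. u X + c * v X) = form ?S u + c * form ?S v" if "u \<in> H" "v \<in> H" for u v c
      by (rule form_lin(2)[OF that S(1)])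
    show "(form ?S u)\<^sup>2 \<le> form ?S ?S * form u u" if "u \<in> H" for u
      by (rule form_Cauchy_Schwarz[OF S(1) that])
  qed (use F form_nonneg in auto)
  then have "?P F" using F P_iff by blast
  moreover have "F' = F" if "?P F'" for F'
  proof
    fix z
    show "F' z = F z"
    proof (cases "z \<in> Y")
      case True
      then obtain u where "u \<in> H" "z = cls u" by (rule Y_cases)
      then show ?thesis using that F P_iff by simp
    next
      case False
      then show ?thesis
        using that \<open>F \<in> Y_dual \<Omega> w wt\<close> by (simp add: Y_dual_def extensional_def)
    qed
  qed
  ultimately have "?P (Lap v)"
    unfolding frac_laplacian_def by (rule theI)
  then show "Lap v \<in> Y_dual \<Omega> w wt"
    "\<And>\<psi>. \<psi> \<in> H \<Longrightarrow> Lap v (cls \<psi>) = form (S v) \<psi>"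
    using P_iff by blast+
qed

lemma form_zero_imp_W0:
  assumes u: "u \<in> H" and zero: "form u u = 0"
  shows "u \<in> Ker"
proof -
  obtain K where "\<And>u. u \<in> H \<Longrightarrow> (LINT x|\<nu>. (tr u x)\<^sup>2) \<le> K * form u u" using tr_bound by blast
  from this[OF u] have "(LINT x|\<nu>. (tr u x)\<^sup>2) \<le> 0" using zero by simp
  then show ?thesis using AE_eq_0_of_integral_square[OF tr_square_integrable[OF u]] u by (simp add: W0_iff)
qed

lemma form_zero_imp_orthogonal: "u \<in> H \<Longrightarrow> \<psi> \<in> H \<Longrightarrow> form u u = 0 \<Longrightarrow> form u \<psi> = 0"
  using form_Cauchy_Schwarz[of u \<psi>] by simp

text \<open>Testing with the difference of the two minimizers shows that its energy is zero.\<close>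

lemma frac_laplacian_injective:
  assumes v: "v \<in> Y" "v' \<in> Y" and eq: "Lap v = Lap v'"
  shows "v = v'"
proof -
  note S = minimizer[OF v(1)] and S' = minimizer[OF v(2)]
  let ?d = "\<lambda>X. S v X - S v' X"
  have d: "?d \<in> H" by (rule H_diff[OF S(1) S'(1)])
  have "form ?d ?d = form (S v) ?d - form (S v') ?d"
    using form_lin(1)[OF S(1) S'(1) d, of "-1"] by simp
  also have "\<dots> = 0" using frac_laplacian(2)[OF v(1) d] frac_laplacian(2)[OF v(2) d] eq by simp
  finally have "?d \<in> Ker" by (rule form_zero_imp_W0[OF d])
  then show ?thesis using cls_eq_iff[OF S(1) S'(1)] S(2) S'(2) by simp
qed

lemma Y_incl_adjoint_cls:
  assumes h: "h \<in> L2 \<Omega> wt" and \<psi>: "\<psi> \<in> H"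
  shows "Y_incl_adjoint \<Omega> w wt h (cls \<psi>) = (LINT x|\<nu>. h x * tr \<psi> x)"
proof -
  have [measurable]: "h \<in> borel_measurable (lebesgue_on \<Omega>)" "tr \<psi> \<in> borel_measurable (lebesgue_on \<Omega>)"
    "Y_incl \<Omega> w wt (cls \<psi>) \<in> borel_measurable (lebesgue_on \<Omega>)"
    using h tr_L2[OF \<psi>] Y_incl_L2[OF cls_in_Y[OF \<psi>]] by (auto simp: L2_def)
  have "Y_incl_adjoint \<Omega> w wt h (cls \<psi>) = (LINT x|\<nu>. h x * Y_incl \<Omega> w wt (cls \<psi>) x)"
    using cls_in_Y[OF \<psi>] by (simp add: Y_incl_adjoint_def integral_weighted_measure[OF \<Omega> wt_weight])
  also have "\<dots> = (LINT x|\<nu>. h x * tr \<psi> x)"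
  proof (rule integral_cong_AE)
    show "AE x in \<nu>. h x * Y_incl \<Omega> w wt (cls \<psi>) x = h x * tr \<psi> x"
      unfolding AE_weighted_measure[OF wt_weight] using Y_incl_cls[OF \<psi>] by eventually_elim simp
  qed simp_all
  finally show ?thesis .
qed

text \<open>
  The Riesz representative \<open>u\<close> of the functional and the minimizer \<open>S v\<close> in its class differ by a function
  of zero trace to which both are orthogonal. So the difference has energy zero, and both induce the
  same functional.
\<close>

lemma frac_laplacian_surjective:
  assumes h: "h \<in> L2 \<Omega> wt"
  shows "\<exists>v\<in>Y. Lap v = Y_incl_adjoint \<Omega> w wt h"
proof -
  define l where "l \<psi> = (LINT x|\<nu>. h x * tr \<psi> x)" for \<psi>
  have h2: "square_integrable \<nu> h" using h L2_iff_square_integrable[OF \<Omega> wt_weight] by simp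
  have int: "integrable \<nu> (\<lambda>x. h x * tr u x)" if "u \<in> H" for u
    using square_integrable_inner[OF h2 tr_square_integrable[OF that]] by simp
  have l_lin: "l (\<lambda>X. u X + c * v X) = l u + c * l v" if u: "u \<in> H" and v: "v \<in> H" for u v c
  proof -
    have "l (\<lambda>X. u X + c * v X) = (LINT x|\<nu>. h x * tr u x + c * (h x * tr v x))"
      unfolding l_def
    proof (rule integral_cong_AE)
      show "AE x in \<nu>. h x * tr (\<lambda>X. u X + c * v X) x = h x * tr u x + c * (h x * tr v x)"
        unfolding AE_weighted_measure[OF wt_weight] using tr_lin[OF u v, of c]
        by eventually_elim (simp add: algebra_simps)
    qed (rule borel_measurable_integrable, use int[OF u] int[OF v] int[OF H_lin[OF u v]] in simp)+
    then show ?thesis using int[OF u] int[OF v] by (simp add: l_def)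
  qed
  obtain K where K: "0 \<le> K" "\<And>u. u \<in> H \<Longrightarrow> (LINT x|\<nu>. (tr u x)\<^sup>2) \<le> K * form u u" using tr_bound by blast
  define B where "B = (LINT x|\<nu>. (h x)\<^sup>2) * K"
  have "0 \<le> B" unfolding B_def using K(1) by (intro mult_nonneg_nonneg) auto
  have l_bound: "(l u)\<^sup>2 \<le> B * form u u" if u: "u \<in> H" for u
  proof -
    have "(l u)\<^sup>2 \<le> (LINT x|\<nu>. (h x)\<^sup>2) * (LINT x|\<nu>. (tr u x)\<^sup>2)"
      using integral_Cauchy_Schwarz[OF h2 tr_square_integrable[OF u]] by (simp add: l_def)
    also have "\<dots> \<le> (LINT x|\<nu>. (h x)\<^sup>2) * (K * form u u)"
      using K(2)[OF u] by (intro mult_left_mono) auto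
    finally show ?thesis by (simp add: B_def mult.assoc)
  qed
  have "H \<noteq> {}" using zero_in_H by blast
  have "\<exists>u\<in>H. \<forall>v\<in>H. form u u / 2 - l u \<le> form v v / 2 - l v"
    by (rule quadratic_minimum_exists[where A = H and K = B])
      (use \<open>H \<noteq> {}\<close> \<open>0 \<le> B\<close> in \<open>auto intro: H_lin[OF _ H_diff, of _ _ _ "1/2", simplified] l_lin l_bound\<close>)
  then obtain u where u: "u \<in> H" and min: "\<And>v. v \<in> H \<Longrightarrow> form u u / 2 - l u \<le> form v v / 2 - l v" by blast
  have riesz: "form u \<psi> = l \<psi>" if "\<psi> \<in> H" for \<psi>
    by (rule quadratic_minimum_stationary[OF u that l_lin]) (auto intro: min H_lin u that)
  define v where "v = cls u"
  have v: "v \<in> Y" unfolding v_def by (rule cls_in_Y[OF u])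
  let ?S = "S v"
  note S = minimizer[OF v]
  let ?d = "\<lambda>X. ?S X - u X"
  have d: "?d \<in> H" by (rule H_diff[OF S(1) u])
  have d0: "?d \<in> Ker" using S(2) cls_eq_iff[OF S(1) u] by (simp add: v_def)
  have "l ?d = 0"
  proof -
    have "AE x in \<nu>. h x * tr ?d x = 0"
      unfolding AE_weighted_measure[OF wt_weight] using d0 by (auto simp: W0_iff elim: eventually_mono)
    then show ?thesis unfolding l_def by (rule integral_eq_zero_AE)
  qed
  then have "form ?d ?d = 0"
    using form_lin(1)[OF S(1) u d, of "-1"] S(3)[OF d0] riesz[OF d] by simp
  then have S_riesz: "form ?S \<psi> = l \<psi>" if "\<psi> \<in> H" for \<psi>
    using form_zero_imp_orthogonal[OF d that] form_lin(1)[OF S(1) u that, of "-1"] riesz[OF that] by simp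
  have "Lap v = Y_incl_adjoint \<Omega> w wt h"
  proof
    fix z
    show "Lap v z = Y_incl_adjoint \<Omega> w wt h z"
    proof (cases "z \<in> Y")
      case True
      then obtain \<psi> where \<psi>: "\<psi> \<in> H" "z = cls \<psi>" by (rule Y_cases)
      then show ?thesis
        using frac_laplacian(2)[OF v \<psi>(1)] S_riesz[OF \<psi>(1)] Y_incl_adjoint_cls[OF h \<psi>(1)] by (simp add: l_def)
    next
      case False
      then show ?thesis
        using frac_laplacian(1)[OF v] by (simp add: Y_dual_def extensional_def Y_incl_adjoint_def)
    qed
  qed
  then show ?thesis using v by blast
qed

end

theorem theorem7p4:
  fixes \<Omega> :: "'a::euclidean_space set"
    and s G wt h :: "'a \<Rightarrow> real"
    and w :: "'a \<times> real \<Rightarrow> real"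
  assumes \<Omega>: "open \<Omega>" "bounded \<Omega>" "\<Omega> \<noteq> {}" "lipschitz_boundary \<Omega>"
    and s_meas: "s \<in> borel_measurable (lebesgue_on \<Omega>)"
    and s_range: "AE x in lebesgue_on \<Omega>. 0 \<le> s x \<and> s x \<le> 1"
    and s_zero: "{x \<in> \<Omega>. s x = 0} \<in> null_sets lebesgue"
    and G_weight: "weight \<Omega> G"
    and G_inv: "L1_loc \<Omega> (\<lambda>x. inverse (G x))"
    and G_const: "\<And>c. 0 < c \<Longrightarrow> c < 1 \<Longrightarrow> (\<forall>x\<in>\<Omega>. s x = c) \<Longrightarrow>
        (\<forall>x\<in>\<Omega>. G x = 2 powr (2 * c - 1) * Gamma c / Gamma (1 - c))"
    and w_def: "w = (\<lambda>(x, y). G x * y powr (1 - 2 * s x))"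
    and wt_def: "wt = (\<lambda>x. G x * (2 * s x)\<^sup>2)"
    and poincare: "\<exists>C>0. \<forall>u\<in>H0L \<Omega> w.
        L2_norm (cylinder \<Omega>) w u
          \<le> C * L2_norm (cylinder \<Omega>) w (\<lambda>X. norm (weak_gradient (cylinder \<Omega>) u X))"
    and h: "h \<in> L2 \<Omega> wt"
  shows "(\<forall>v\<in>Y_space \<Omega> w wt. Y_incl \<Omega> w wt v \<in> L2 \<Omega> wt) \<and>
         (\<forall>v\<in>Y_space \<Omega> w wt. \<forall>v'\<in>Y_space \<Omega> w wt.
            (AE x in lebesgue_on \<Omega>. Y_incl \<Omega> w wt v x = Y_incl \<Omega> w wt v' x) \<longrightarrow> v = v') \<and>
         (\<exists>!v. v \<in> Y_space \<Omega> w wt \<and> frac_laplacian \<Omega> w wt v = Y_incl_adjoint \<Omega> w wt h)"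
proof -
  interpret fractional_extension \<Omega> s G wt w
    by unfold_locales fact+
  have "\<exists>!v. v \<in> Y \<and> Lap v = Y_incl_adjoint \<Omega> w wt h"
    using frac_laplacian_surjective[OF h] frac_laplacian_injective by metis
  then show ?thesis using Y_incl_L2 Y_incl_injective by blast
qed

end
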